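(* Let $k$ be a field with algebraic closure $\overline k$, and let $a\colon T_+\to k$ be a monoid map (to the multiplicative monoid of $k$), viewed as an object of $\mathcal X_\phi(k)$. Then $a\in\mathcal Z_\phi(k)$ if and only if there exist a group homomorphism $\lambda\colon T\to\overline k^*$ and $\mathcal E\in T_+^\vee$ such that $$a(t)=\lambda_t\,0^{\mathcal E(t)}\quad\text{for all }t\in T_+ .$$ In particular, if $\underline{\mathcal E}=\mathcal E^1,\dots,\mathcal E^s\in T_+^\vee$ generate the rational cone of $T_+^\vee$ (i.e. every element of $T_+^\vee$ is a nonnegative rational combination of the $\mathcal E^i$), then $\pi_{\underline{\mathcal E}}\colon\mathcal F_{\underline{\mathcal E}}(\overline k)\to\mathcal Z_\phi(\overline k)$ is essentially surjective, and so $\pi_{\underline{\mathcal E}}\colon|\mathcal F_{\underline{\mathcal E}}|\to|\mathcal Z_\phi|$ is surjective. Finally, if $\phi\colon T\to\mathbb Z^r$ is injective, there is a bijection $$\mathcal Z_\phi(\overline k)/\!\simeq\ \longrightarrow\ \{\mathrm{Supp}\,\mathcal E\mid\mathcal E\in T_+^\vee\},\qquad a\mapsto\{t\in T_+\mid a(t)=0\}.$$ In particular, in this case, $|\mathcal Z_\phi|=\big(\mathcal Z_\phi(\overline{\mathbb Q})/\!\simeq\big)\sqcup\bigsqcup_{p\text{ prime}}\big(\mathcal Z_\phi(\overline{\mathbb F_p})/\!\simeq\big)$.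
   Context: $T_+$ is a finitely generated commutative monoid whose associated group $T$ is free of finite rank; $T_+^{int}$ is the image of $T_+\to T$; $\phi\colon T_+\to\mathbb Z^r$ is a monoid map, and $\phi$ also denotes its extension $T\to\mathbb Z^r$. For $f=(a_i)\in\mathbb Z^r$ and invertible sheaves $\underline{\mathcal L}=\mathcal L_1,\dots,\mathcal L_r$ put $\underline{\mathcal L}^f=\bigotimes\mathcal L_i^{\otimes a_i}$. $\mathcal X_\phi$ is the stack over $\mathbb Z$ whose objects over a scheme $U$ are pairs $(\underline{\mathcal L},a)$ with $\underline{\mathcal L}=\mathcal L_1,\dots,\mathcal L_r$ invertible sheaves on $U$ and $a$ assigning to every $t\in T_+$ a section $a(t)\in\underline{\mathcal L}^{\phi(t)}$ with $a(0)=1$, $a(t+t')=a(t)\otimes a(t')$; isomorphisms $(\underline{\mathcal L},a)\to(\underline{\mathcal L}',a')$ are sequences of isomorphisms $\sigma_i\colon\mathcal L_i\to\mathcal L'_i$ with $\underline\sigma^{\phi(t)}(a(t))=a'(t)$. A monoid map $a\colon T_+\to(\mathcal O_U(U),\cdot)$ defines an object with $\mathcal L_i=\mathcal O_U$. One has $\mathcal X_\phi\simeq[\mathrm{Spec}\,\mathbb Z[T_+]/\mathrm D(\mathbb Z^r)]$, $\mathrm D(\mathbb Z^r)=\underline{\mathrm{Hom}}(\mathbb Z^r,\mathbb G_m)$, and $\mathcal Z_\phi$ is the closed substack $[\mathrm{Spec}\,\mathbb Z[T_+^{int}]/\mathrm D(\mathbb Z^r)]$ (the main irreducible component). $T_+^\vee=\mathrm{Hom}(T_+,\mathbb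 N)$ (monoid maps; regarded also as homomorphisms $T\to\mathbb Z$); $\mathrm{Supp}\,\mathcal E=\{v\in T_+\mid\mathcal E(v)>0\}$; the convention $0^0=1$ is used. For $\underline{\mathcal E}=\mathcal E^1,\dots,\mathcal E^s\in T_+^\vee$, $\mathcal F_{\underline{\mathcal E}}$ is the stack whose objects over $U$ are $(\underline{\mathcal L},\underline{\mathcal M},\underline z,\lambda)$, with $\underline{\mathcal L}=\mathcal L_1,\dots,\mathcal L_r$ and $\underline{\mathcal M}=\mathcal M_1,\dots,\mathcal M_s$ invertible sheaves on $U$, sections $z_i\in\mathcal M_i$, and isomorphisms $\lambda_t\colon\underline{\mathcal L}^{\phi(t)}\simeq\underline{\mathcal M}^{\underline{\mathcal E}(t)}$ for $t\in T$, additive in $t$; isomorphisms are families of isomorphisms of the $\mathcal L_i$ and $\mathcal M_j$ compatible with $\underline z$ and $\lambda$. $\pi_{\underline{\mathcal E}}\colon\mathcal F_{\underline{\mathcal E}}\to\mathcal X_\phi$ sends $(\underline{\mathcal L},\underline{\mathcal M},\underline z,\lambda)$ to $(\underline{\mathcal L},a)$ with $a(t)=\lambda_t^{-1}(\underline z^{\underline{\mathcal E}(t)})$, $\underline z^{\underline{\mathcal E}(t)}=z_1^{\mathcal E^1(t)}\otimes\cdots\otimes z_s^{\mathcal E^s(t)}$; it factors through $\mathcal Z_\phi$. $|\cdot|$ denotes the set of points of an algebraic stack. *)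

theory Defs
  imports
    "HOL-Algebra.Algebra"
    "HOL-Algebra.Algebraic_Closure_Type"
    "HOL-Number_Theory.Residues"
    "HOL-Library.Poly_Mapping"
begin

section \<open>Monoids and their associated groups\<close>

definition monoid_map :: "('a::comm_monoid_add \<Rightarrow> 'b::comm_monoid_add) \<Rightarrow> bool" where
  "monoid_map f \<longleftrightarrow> f 0 = 0 \<and> (\<forall>s t. f (s + t) = f s + f t)"

definition finitely_generated_monoid :: "'a::comm_monoid_add itself \<Rightarrow> bool" where
  "finitely_generated_monoid _ \<longleftrightarrow>
    (\<exists>S::'a set. finite S \<and>
      (\<forall>M. S \<subseteq> M \<and> 0 \<in> M \<and> (\<forall>x\<in>M. \<forall>y\<in>M. x + y \<in> M) \<longrightarrow> M = UNIV))"

definition free_of_finite_rank :: "'a::ab_group_add itself \<Rightarrow> bool" where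
  "free_of_finite_rank _ \<longleftrightarrow>
    (\<exists>n (f :: 'a \<Rightarrow> nat \<Rightarrow> int).
      bij_betw f UNIV (\<Pi>\<^sub>E i\<in>{..<n}. UNIV) \<and>
      (\<forall>x y. \<forall>i<n. f (x + y) i = f x i + f y i))"

text \<open>The group associated with a commutative monoid: pairs \<open>(s, t)\<close> stand for the
  formal differences \<open>s - t\<close>.\<close>

definition groth_rel :: "'t::comm_monoid_add \<times> 't \<Rightarrow> 't \<times> 't \<Rightarrow> bool" where
  "groth_rel p q \<longleftrightarrow> (\<exists>u. fst p + snd q + u = fst q + snd p + u)"

lemma groth_rel_equivp: "equivp (groth_rel :: 't::comm_monoid_add \<times> 't \<Rightarrow> _)"
proof (rule equivpI)
  show "reflp (groth_rel :: 't \<times> 't \<Rightarrow> _)"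
    by (rule reflpI) (simp add: groth_rel_def)
  show "symp (groth_rel :: 't \<times> 't \<Rightarrow> _)"
  proof (rule sympI)
    fix p q :: "'t \<times> 't"
    assume "groth_rel p q"
    then obtain u where "fst p + snd q + u = fst q + snd p + u"
      unfolding groth_rel_def ..
    from this[symmetric] show "groth_rel q p" unfolding groth_rel_def ..
  qed
  show "transp (groth_rel :: 't \<times> 't \<Rightarrow> _)"
  proof (rule transpI)
    fix p q w :: "'t \<times> 't"
    assume pq: "groth_rel p q" and qw: "groth_rel q w"
    from pq obtain u where u: "fst p + snd q + u = fst q + snd p + u"
      unfolding groth_rel_def ..
    from qw obtain v where v: "fst q + snd w + v = fst w + snd q + v"
      unfolding groth_rel_def ..
    have "fst p + snd w + (snd q + u + v) = (fst p + snd q + u) + (snd w + v)"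
      by (simp only: ac_simps)
    also have "\<dots> = (fst q + snd p + u) + (snd w + v)" by (simp only: u)
    also have "\<dots> = (fst q + snd w + v) + (snd p + u)" by (simp only: ac_simps)
    also have "\<dots> = (fst w + snd q + v) + (snd p + u)" by (simp only: v)
    also have "\<dots> = fst w + snd p + (snd q + u + v)" by (simp only: ac_simps)
    finally show "groth_rel p w" unfolding groth_rel_def ..
  qed
qed

quotient_type (overloaded) 't groth = "'t::comm_monoid_add \<times> 't" / groth_rel
  by (rule groth_rel_equivp)

instantiation groth :: (comm_monoid_add) ab_group_add
begin

lift_definition zero_groth :: "'a groth" is "(0, 0)" .

lift_definition plus_groth :: "'a groth \<Rightarrow> 'a groth \<Rightarrow> 'a groth"
  is "\<lambda>p q. (fst p + fst q, snd p + snd q)"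
proof -
  fix p p' q q' :: "'a \<times> 'a"
  assume "groth_rel p p'" "groth_rel q q'"
  then obtain u v where u: "fst p + snd p' + u = fst p' + snd p + u"
    and v: "fst q + snd q' + v = fst q' + snd q + v"
    unfolding groth_rel_def by blast
  have "fst p + fst q + (snd p' + snd q') + (u + v) =
      (fst p + snd p' + u) + (fst q + snd q' + v)" by (simp add: ac_simps)
  also have "\<dots> = fst p' + fst q' + (snd p + snd q) + (u + v)"
    unfolding u v by (simp add: ac_simps)
  finally show "groth_rel (fst p + fst q, snd p + snd q) (fst p' + fst q', snd p' + snd q')"
    unfolding groth_rel_def fst_conv snd_conv by blast
qed

lift_definition uminus_groth :: "'a groth \<Rightarrow> 'a groth" is "\<lambda>p. (snd p, fst p)"
proof -
  fix p p' :: "'a \<times> 'a"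
  assume "groth_rel p p'"
  then show "groth_rel (snd p, fst p) (snd p', fst p')"
    by (auto simp: groth_rel_def ac_simps intro: sym)
qed

definition minus_groth :: "'a groth \<Rightarrow> 'a groth \<Rightarrow> 'a groth" where
  "minus_groth x y = x + - y"

instance
proof
  fix a b c :: "'a groth"
  show "a + b + c = a + (b + c)" by transfer (auto simp: groth_rel_def ac_simps)
  show "a + b = b + a" by transfer (auto simp: groth_rel_def ac_simps)
  show "0 + a = a" by transfer (auto simp: groth_rel_def)
  show "- a + a = 0" by transfer (auto simp: groth_rel_def ac_simps)
  show "a - b = a + - b" by (rule minus_groth_def)
qed

end

lift_definition of_monoid :: "'t::comm_monoid_add \<Rightarrow> 't groth" is "\<lambda>t. (t, 0)" .

lemma of_monoid_0: "of_monoid 0 = 0"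
  by transfer (auto simp: groth_rel_def)

lemma of_monoid_add: "of_monoid (s + t) = of_monoid s + of_monoid t"
  by transfer (auto simp: groth_rel_def)

lemma of_monoid_eq_iff: "of_monoid s = of_monoid t \<longleftrightarrow> (\<exists>u. s + u = t + u)"
  by transfer (auto simp: groth_rel_def)

lemma groth_cases:
  fixes x :: "'a::comm_monoid_add groth"
  obtains s t where "x = of_monoid s - of_monoid t"
proof -
  have "\<exists>s t. x = of_monoid s + - of_monoid t"
  proof (transfer, intro exI)
    fix x :: "'a \<times> 'a"
    show "groth_rel x (fst (fst x, 0) + fst (snd (snd x, 0), fst (snd x, 0)),
        snd (fst x, 0) + snd (snd (snd x, 0), fst (snd x, 0)))"
      by (simp add: groth_rel_def)
  qed
  then show ?thesis using that unfolding minus_groth_def by blast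
qed

definition groth_ext :: "('t::comm_monoid_add \<Rightarrow> int) \<Rightarrow> 't groth \<Rightarrow> int" where
  "groth_ext f x = (THE n. \<exists>s t. x = of_monoid s - of_monoid t \<and> n = f s - f t)"

lemma groth_ext_diff:
  assumes "monoid_map f"
  shows "groth_ext f (of_monoid s - of_monoid t) = f s - f t"
  unfolding groth_ext_def
proof (rule the_equality)
  fix n
  assume "\<exists>s' t'. of_monoid s - of_monoid t = of_monoid s' - of_monoid t' \<and> n = f s' - f t'"
  then obtain s' t' where eq: "of_monoid s - of_monoid t = of_monoid s' - of_monoid t'"
    and n: "n = f s' - f t'" by blast
  from eq have "of_monoid s + of_monoid t' = of_monoid s' + of_monoid t"
    by (metis diff_add_cancel add_diff_eq add.commute)
  then have "of_monoid (s + t') = of_monoid (s' + t)"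
    by (simp only: of_monoid_add)
  then obtain u where "s + t' + u = s' + t + u" by (auto simp: of_monoid_eq_iff)
  then have "f (s + t' + u) = f (s' + t + u)" by (rule arg_cong)
  moreover have "f (x + y) = f x + f y" for x y using assms by (simp only: monoid_map_def)
  ultimately have "f s + f t' + f u = f s' + f t + f u" by (simp only:)
  then show "n = f s - f t" using n by linarith
qed blast

lemma groth_ext_of_monoid: "monoid_map f \<Longrightarrow> groth_ext f (of_monoid t) = f t"
  using groth_ext_diff[of f t 0] by (simp add: of_monoid_0 monoid_map_def)

text \<open>The image of a monoid in its associated group.\<close>

typedef (overloaded) 't int_monoid = "range (of_monoid :: 't::comm_monoid_add \<Rightarrow> 't groth)"
  by blast

setup_lifting type_definition_int_monoid

instantiation int_monoid :: (comm_monoid_add) comm_monoid_add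
begin

lift_definition zero_int_monoid :: "'a int_monoid" is 0
  by (metis of_monoid_0 rangeI)

lift_definition plus_int_monoid :: "'a int_monoid \<Rightarrow> 'a int_monoid \<Rightarrow> 'a int_monoid" is "(+)"
  by (auto simp flip: of_monoid_add)

instance
  by (standard; transfer) (auto simp: ac_simps)

end

lift_definition to_int_monoid :: "'t::comm_monoid_add \<Rightarrow> 't int_monoid" is of_monoid
  by blast

definition dual_monoid :: "('t::comm_monoid_add \<Rightarrow> nat) set" where
  "dual_monoid = {E. monoid_map E}"

definition Supp :: "('t \<Rightarrow> nat) \<Rightarrow> 't set" where
  "Supp E = {v. E v > 0}"

definition generates_rational_cone :: "nat \<Rightarrow> (nat \<Rightarrow> 't::comm_monoid_add \<Rightarrow> nat) \<Rightarrow> bool" where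
  "generates_rational_cone s Es \<longleftrightarrow>
    (\<forall>E\<in>dual_monoid. \<exists>q::nat \<Rightarrow> rat. (\<forall>j<s. 0 \<le> q j) \<and>
      (\<forall>t. of_nat (E t) = (\<Sum>j<s. q j * of_nat (Es j t))))"

text \<open>\<open>\<int>[M]\<close> is \<open>'m \<Rightarrow>\<^sub>0 int\<close>, whose multiplication is convolution;
  \<open>monoid_ring_map f\<close> is the induced map \<open>\<int>[M] \<rightarrow> \<int>[N]\<close>.\<close>

definition monoid_ring_map :: "('m \<Rightarrow> 'n) \<Rightarrow> ('m \<Rightarrow>\<^sub>0 int) \<Rightarrow> ('n \<Rightarrow>\<^sub>0 int)" where
  "monoid_ring_map f p =
    (\<Sum>t\<in>Poly_Mapping.keys p. Poly_Mapping.single (f t) (Poly_Mapping.lookup p t))"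


section \<open>Lines over a field and their tensor powers\<close>

text \<open>Invertible sheaves on \<open>Spec K\<close> are free \<open>K\<close>-modules of rank one.\<close>

definition line :: "'k ring \<Rightarrow> ('k, 'v) module \<Rightarrow> bool" where
  "line K V \<longleftrightarrow> module K V \<and>
    (\<exists>e\<in>carrier V. \<forall>v\<in>carrier V. \<exists>!c. c \<in> carrier K \<and> v = c \<odot>\<^bsub>V\<^esub> e)"

text \<open>For \<open>h : K \<rightarrow> K'\<close>, an injective \<open>h\<close>-semilinear map \<open>V \<rightarrow> V'\<close> between lines is the same as an
  isomorphism \<open>V \<otimes>\<^sub>K K' \<cong> V'\<close>; for \<open>h = id\<close> it is an isomorphism of lines
  (lemma \<open>line_map_bij\<close>).\<close>

definition line_map ::
  "('k \<Rightarrow> 'l) \<Rightarrow> 'k ring \<Rightarrow> ('k, 'v) module \<Rightarrow> ('l, 'w) module \<Rightarrow> ('v \<Rightarrow> 'w) \<Rightarrow> bool" where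
  "line_map h K V V' \<beta> \<longleftrightarrow>
    \<beta> \<in> carrier V \<rightarrow> carrier V' \<and> inj_on \<beta> (carrier V) \<and>
    (\<forall>v\<in>carrier V. \<forall>w\<in>carrier V. \<beta> (v \<oplus>\<^bsub>V\<^esub> w) = \<beta> v \<oplus>\<^bsub>V'\<^esub> \<beta> w) \<and>
    (\<forall>c\<in>carrier K. \<forall>v\<in>carrier V. \<beta> (c \<odot>\<^bsub>V\<^esub> v) = h c \<odot>\<^bsub>V'\<^esub> \<beta> v)"

text \<open>A frame of \<open>V\<^sub>0, \<dots>, V\<^sub>r\<^sub>-\<^sub>1\<close> is a choice of a generator of every \<open>V\<^sub>i\<close>.
  The frames form the \<open>(K\<^sup>*)\<^sup>r\<close>-torsor, i.e. the \<open>D(\<int>\<^sup>r)\<close>-torsor, attached to the lines.\<close>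

definition frames :: "nat \<Rightarrow> (nat \<Rightarrow> ('k, 'v) module) \<Rightarrow> (nat \<Rightarrow> 'v) set" where
  "frames r V = (\<Pi>\<^sub>E i\<in>{..<r}. carrier (V i) - {\<zero>\<^bsub>V i\<^esub>})"

text \<open>The line \<open>V\<^sup>f = \<Otimes>\<^sub>i V\<^sub>i^f\<^sub>i\<close>. An element \<open>v\<close> is encoded by its coordinate function
  \<open>x : frames \<rightarrow> K\<close>, where \<open>v = x(e) (\<Otimes>\<^sub>i e\<^sub>i^f\<^sub>i)\<close>. The coordinate functions are exactly the functions
  with \<open>x(c e) = (\<Prod>\<^sub>i c\<^sub>i^(-f\<^sub>i)) x(e)\<close>. In this model the canonical isomorphisms
  \<open>V\<^sup>f \<otimes> V\<^sup>g \<cong> V\<^sup>f\<^sup>+\<^sup>g\<close> and \<open>V\<^sup>0 \<cong> K\<close> are pointwise multiplication and the constant functions.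
  The multiplicative components of the module record play no role.\<close>

definition tensor_power ::
  "'k ring \<Rightarrow> nat \<Rightarrow> (nat \<Rightarrow> ('k, 'v) module) \<Rightarrow> (nat \<Rightarrow> int) \<Rightarrow> ('k, (nat \<Rightarrow> 'v) \<Rightarrow> 'k) module"
where
  "tensor_power K r V f =
    \<lparr> carrier = {x \<in> frames r V \<rightarrow>\<^sub>E carrier K.
        \<forall>e\<in>frames r V. \<forall>c\<in>{..<r} \<rightarrow> Units K.
          x (\<lambda>i\<in>{..<r}. c i \<odot>\<^bsub>V i\<^esub> e i) =
            (\<Otimes>\<^bsub>K\<^esub>i\<in>{..<r}. c i [^]\<^bsub>K\<^esub> (- f i)) \<otimes>\<^bsub>K\<^esub> x e},
      monoid.mult = undefined,
      one = undefined,
      ring.zero = (\<lambda>e\<in>frames r V. \<zero>\<^bsub>K\<^esub>),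
      add = (\<lambda>x y. \<lambda>e\<in>frames r V. x e \<oplus>\<^bsub>K\<^esub> y e),
      module.smult = (\<lambda>c x. \<lambda>e\<in>frames r V. c \<otimes>\<^bsub>K\<^esub> x e) \<rparr>"

definition tensor_one :: "'k ring \<Rightarrow> nat \<Rightarrow> (nat \<Rightarrow> ('k, 'v) module) \<Rightarrow> (nat \<Rightarrow> 'v) \<Rightarrow> 'k" where
  "tensor_one K r V = (\<lambda>e\<in>frames r V. \<one>\<^bsub>K\<^esub>)"

definition tensor_mult ::
  "'k ring \<Rightarrow> nat \<Rightarrow> (nat \<Rightarrow> ('k, 'v) module) \<Rightarrow>
    ((nat \<Rightarrow> 'v) \<Rightarrow> 'k) \<Rightarrow> ((nat \<Rightarrow> 'v) \<Rightarrow> 'k) \<Rightarrow> (nat \<Rightarrow> 'v) \<Rightarrow> 'k" where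
  "tensor_mult K r V x y = (\<lambda>e\<in>frames r V. x e \<otimes>\<^bsub>K\<^esub> y e)"

text \<open>For line maps \<open>\<beta>\<^sub>i : V\<^sub>i \<rightarrow> V'\<^sub>i\<close> over \<open>h\<close>: \<open>x' \<in> V'\<^sup>f\<close> is the image of \<open>x \<in> V\<^sup>f\<close>
  under \<open>\<beta>\<^sup>f\<close>, that is, \<open>x'\<close> has the coordinates \<open>h (x(e))\<close> in the frame \<open>\<beta>(e)\<close>.\<close>

definition tensor_image ::
  "nat \<Rightarrow> ('k \<Rightarrow> 'l) \<Rightarrow> (nat \<Rightarrow> ('k, 'v) module) \<Rightarrow> (nat \<Rightarrow> 'v \<Rightarrow> 'w) \<Rightarrow>
    ((nat \<Rightarrow> 'v) \<Rightarrow> 'k) \<Rightarrow> ((nat \<Rightarrow> 'w) \<Rightarrow> 'l) \<Rightarrow> bool" where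
  "tensor_image r h V \<beta> x x' \<longleftrightarrow>
    (\<forall>e\<in>frames r V. x' (\<lambda>i\<in>{..<r}. \<beta> i (e i)) = h (x e))"

definition coordinate :: "'k ring \<Rightarrow> ('k, 'v) module \<Rightarrow> 'v \<Rightarrow> 'v \<Rightarrow> 'k" where
  "coordinate K V e v = (THE c. c \<in> carrier K \<and> v = c \<odot>\<^bsub>V\<^esub> e)"

text \<open>The element \<open>\<Otimes>\<^sub>j z\<^sub>j^n\<^sub>j\<close> of \<open>W\<^sup>n\<close>; here \<open>0^0 = 1\<close>.\<close>

definition tensor_monomial ::
  "'k ring \<Rightarrow> nat \<Rightarrow> (nat \<Rightarrow> ('k, 'v) module) \<Rightarrow> (nat \<Rightarrow> 'v) \<Rightarrow> (nat \<Rightarrow> nat) \<Rightarrow> (nat \<Rightarrow> 'v) \<Rightarrow> 'k"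
where
  "tensor_monomial K s W z n =
    (\<lambda>d\<in>frames s W. \<Otimes>\<^bsub>K\<^esub>j\<in>{..<s}. coordinate K (W j) (d j) (z j) [^]\<^bsub>K\<^esub> n j)"

lemma line_map_bij:
  assumes "field K" "line K V" "line K V'" "line_map (\<lambda>c. c) K V V' \<beta>"
  shows "bij_betw \<beta> (carrier V) (carrier V')"
proof -
  interpret K: field K by fact
  interpret V: module K V using assms(2) unfolding line_def by (rule conjunct1)
  interpret V': module K V' using assms(3) unfolding line_def by (rule conjunct1)
  have "\<exists>e\<in>carrier V. \<forall>v\<in>carrier V. \<exists>!c. c \<in> carrier K \<and> v = c \<odot>\<^bsub>V\<^esub> e"
    using assms(2) unfolding line_def by (rule conjunct2)
  then obtain e where e: "e \<in> carrier V"
    and eu: "\<forall>v\<in>carrier V. \<exists>!c. c \<in> carrier K \<and> v = c \<odot>\<^bsub>V\<^esub> e"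
    by (rule bexE)
  note eu = bspec[OF eu]
  have "\<exists>e\<in>carrier V'. \<forall>v\<in>carrier V'. \<exists>!c. c \<in> carrier K \<and> v = c \<odot>\<^bsub>V'\<^esub> e"
    using assms(3) unfolding line_def by (rule conjunct2)
  then obtain e' where e': "e' \<in> carrier V'"
    and eu': "\<forall>v\<in>carrier V'. \<exists>!c. c \<in> carrier K \<and> v = c \<odot>\<^bsub>V'\<^esub> e'"
    by (rule bexE)
  note eu' = bspec[OF eu']
  have \<beta>: "\<beta> \<in> carrier V \<rightarrow> carrier V'" "inj_on \<beta> (carrier V)"
    and lin': "\<forall>c\<in>carrier K. \<forall>v\<in>carrier V. \<beta> (c \<odot>\<^bsub>V\<^esub> v) = c \<odot>\<^bsub>V'\<^esub> \<beta> v"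
    using assms(4) unfolding line_map_def by blast+
  note lin = bspec[OF bspec[OF lin']]
  obtain b where b: "b \<in> carrier K" "\<beta> e = b \<odot>\<^bsub>V'\<^esub> e'"
    using eu'[OF funcset_mem[OF \<beta>(1) e]] by (elim ex1E conjE)
  have zV: "\<beta> (\<zero>\<^bsub>K\<^esub> \<odot>\<^bsub>V\<^esub> e) = (\<zero>\<^bsub>K\<^esub> \<otimes>\<^bsub>K\<^esub> b) \<odot>\<^bsub>V'\<^esub> e'"
    using lin[OF K.zero_closed e] V'.smult_assoc1[OF K.zero_closed b(1) e'] b(2) by (simp only:)
  have "b \<noteq> \<zero>\<^bsub>K\<^esub>"
  proof
    assume b0: "b = \<zero>\<^bsub>K\<^esub>"
    have z: "\<zero>\<^bsub>K\<^esub> \<otimes>\<^bsub>K\<^esub> b = b" unfolding b0 by (rule K.l_null[OF K.zero_closed])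
    have "\<beta> (\<zero>\<^bsub>K\<^esub> \<odot>\<^bsub>V\<^esub> e) = \<beta> e" by (simp only: zV z b(2))
    then have "\<zero>\<^bsub>K\<^esub> \<odot>\<^bsub>V\<^esub> e = e"
      by (rule inj_onD[OF \<beta>(2) _ V.smult_closed[OF K.zero_closed e] e])
    then have "e = \<zero>\<^bsub>K\<^esub> \<odot>\<^bsub>V\<^esub> e" by (rule sym)
    moreover have "e = \<one>\<^bsub>K\<^esub> \<odot>\<^bsub>V\<^esub> e" by (rule V.smult_one[OF e, symmetric])
    ultimately have "\<zero>\<^bsub>K\<^esub> = \<one>\<^bsub>K\<^esub>"
      using ex1E[OF eu[OF e]] K.zero_closed K.one_closed by metis
    from this[symmetric] show False by (rule notE[OF K.one_not_zero])
  qed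
  then have inv: "b \<in> Units K" using b(1) unfolding K.field_Units by blast
  have "w \<in> \<beta> ` carrier V" if w: "w \<in> carrier V'" for w
  proof -
    obtain c where c: "c \<in> carrier K" "w = c \<odot>\<^bsub>V'\<^esub> e'" using eu'[OF w] by (elim ex1E conjE)
    let ?d = "c \<otimes>\<^bsub>K\<^esub> inv\<^bsub>K\<^esub> b"
    have d: "?d \<in> carrier K" using c(1) inv by (intro K.m_closed K.Units_inv_closed)
    have db: "?d \<otimes>\<^bsub>K\<^esub> b = c"
      using c(1) b(1) inv by (simp only: K.m_assoc K.Units_inv_closed K.Units_l_inv K.r_one)
    have "\<beta> (?d \<odot>\<^bsub>V\<^esub> e) = w"
      using lin[OF d e] V'.smult_assoc1[OF d b(1) e'] by (simp only: b(2) db c(2))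
    then show ?thesis using V.smult_closed[OF d e] by blast
  qed
  then have "\<beta> ` carrier V = carrier V'" using \<beta>(1) by blast
  then show ?thesis using \<beta>(2) unfolding bij_betw_def by blast
qed


section \<open>The stacks over spectra of fields\<close>

text \<open>\<open>X_ob r \<phi> K\<close>, \<open>Z_ob r \<phi> K\<close>, \<open>F_ob r \<phi> s Es K\<close> are the objects over \<open>Spec K\<close> (with lines whose
  underlying set lies in the type of \<open>K\<close>), and \<open>X_arrow\<close>, \<open>F_arrow\<close> say that there is an arrow over
  \<open>Spec K' \<rightarrow> Spec K\<close> given by \<open>h : K \<rightarrow> K'\<close> in the fibred category, that is, an isomorphism
  between the pullback of the first object and the second one. Isomorphisms in the fibre over
  \<open>K\<close> are the arrows with \<open>h = id\<close>. The components of \<open>\<phi> t\<close> and of the families of lines with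
  index \<open>\<ge> r\<close> are irrelevant.\<close>

type_synonym ('t, 'k) X_obj = "(nat \<Rightarrow> ('k, 'k) module) \<times> ('t \<Rightarrow> (nat \<Rightarrow> 'k) \<Rightarrow> 'k)"

definition X_ob :: "nat \<Rightarrow> ('t::comm_monoid_add \<Rightarrow> nat \<Rightarrow> int) \<Rightarrow> 'k ring \<Rightarrow> ('t, 'k) X_obj set" where
  "X_ob r \<phi> K = {(V, a).
    (\<forall>i<r. line K (V i)) \<and>
    (\<forall>t. a t \<in> carrier (tensor_power K r V (\<phi> t))) \<and>
    a 0 = tensor_one K r V \<and>
    (\<forall>t t'. a (t + t') = tensor_mult K r V (a t) (a t'))}"

definition X_arrow ::
  "nat \<Rightarrow> ('k \<Rightarrow> 'l) \<Rightarrow> 'k ring \<Rightarrow> 'l ring \<Rightarrow> ('t, 'k) X_obj \<Rightarrow> ('t, 'l) X_obj \<Rightarrow> bool" where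
  "X_arrow r h K K' = (\<lambda>(V, a) (V', a').
    \<exists>\<sigma>. (\<forall>i<r. line_map h K (V i) (V' i) (\<sigma> i)) \<and> (\<forall>t. tensor_image r h V \<sigma> (a t) (a' t)))"

text \<open>The object with trivial lines defined by a monoid map \<open>a : T\<^sub>+ \<rightarrow> (K, \<cdot>)\<close>. The element \<open>a t\<close> of
  \<open>K = K\<^sup>f\<close>, \<open>f = \<phi> t\<close>, has the coordinate \<open>a t (\<Prod>\<^sub>i e\<^sub>i^(-f\<^sub>i))\<close> in the frame \<open>e\<close>.\<close>

definition trivial_line :: "'k ring \<Rightarrow> ('k, 'k) module" where
  "trivial_line K = \<lparr> carrier = carrier K, monoid.mult = monoid.mult K, one = one K,
    ring.zero = ring.zero K, add = add K, module.smult = monoid.mult K \<rparr>"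

definition mult_monoid_map :: "('t::comm_monoid_add \<Rightarrow> 'k) \<Rightarrow> 'k ring \<Rightarrow> bool" where
  "mult_monoid_map a K \<longleftrightarrow>
    (\<forall>t. a t \<in> carrier K) \<and> a 0 = \<one>\<^bsub>K\<^esub> \<and> (\<forall>t t'. a (t + t') = a t \<otimes>\<^bsub>K\<^esub> a t')"

definition trivial_X_obj ::
  "nat \<Rightarrow> ('t \<Rightarrow> nat \<Rightarrow> int) \<Rightarrow> 'k ring \<Rightarrow> ('t \<Rightarrow> 'k) \<Rightarrow> ('t, 'k) X_obj" where
  "trivial_X_obj r \<phi> K a =
    (\<lambda>i. trivial_line K,
     \<lambda>t. \<lambda>e\<in>frames r (\<lambda>i. trivial_line K). a t \<otimes>\<^bsub>K\<^esub> (\<Otimes>\<^bsub>K\<^esub>i\<in>{..<r}. e i [^]\<^bsub>K\<^esub> (- \<phi> t i)))"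

text \<open>Under \<open>X\<^sub>\<phi> \<simeq> [Spec \<int>[T\<^sub>+] / D(\<int>\<^sup>r)]\<close> the object \<open>(V, a)\<close> over \<open>K\<close> corresponds to
  the torsor of frames of \<open>V\<close> with the equivariant map to \<open>Spec \<int>[T\<^sub>+]\<close> sending the frame \<open>e\<close> to
  the ring homomorphism \<open>\<int>[T\<^sub>+] \<rightarrow> K\<close>, \<open>t \<mapsto> a t e\<close>. The object belongs to the closed substack
  \<open>[Spec \<int>[T\<^sub>+\<^sup>i\<^sup>n\<^sup>t] / D(\<int>\<^sup>r)]\<close> iff this map has values in \<open>Spec \<int>[T\<^sub>+\<^sup>i\<^sup>n\<^sup>t]\<close>, i.e. iff these
  homomorphisms factor through \<open>\<int>[T\<^sub>+] \<rightarrow> \<int>[T\<^sub>+\<^sup>i\<^sup>n\<^sup>t]\<close>.\<close>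

definition frame_point ::
  "'k ring \<Rightarrow> ('t \<Rightarrow> (nat \<Rightarrow> 'k) \<Rightarrow> 'k) \<Rightarrow> (nat \<Rightarrow> 'k) \<Rightarrow> ('t \<Rightarrow>\<^sub>0 int) \<Rightarrow> 'k" where
  "frame_point K a e p =
    (\<Oplus>\<^bsub>K\<^esub>t\<in>Poly_Mapping.keys p. [Poly_Mapping.lookup p t] \<cdot>\<^bsub>K\<^esub> a t e)"

definition Z_ob :: "nat \<Rightarrow> ('t::comm_monoid_add \<Rightarrow> nat \<Rightarrow> int) \<Rightarrow> 'k ring \<Rightarrow> ('t, 'k) X_obj set" where
  "Z_ob r \<phi> K = {(V, a) \<in> X_ob r \<phi> K.
    \<forall>e\<in>frames r V.
      \<exists>g\<in>ring_hom (ring_of_type_algebra :: ('t int_monoid \<Rightarrow>\<^sub>0 int) ring) K.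
        \<forall>p. frame_point K a e p = g (monoid_ring_map to_int_monoid p)}"

definition Z_iso ::
  "nat \<Rightarrow> ('t::comm_monoid_add \<Rightarrow> nat \<Rightarrow> int) \<Rightarrow> 'k ring \<Rightarrow> (('t, 'k) X_obj \<times> ('t, 'k) X_obj) set" where
  "Z_iso r \<phi> K = {(x, y). x \<in> Z_ob r \<phi> K \<and> y \<in> Z_ob r \<phi> K \<and> X_arrow r (\<lambda>c. c) K K x y}"

definition zero_set ::
  "nat \<Rightarrow> ('t \<Rightarrow> nat \<Rightarrow> int) \<Rightarrow> 'k ring \<Rightarrow> ('t, 'k) X_obj \<Rightarrow> 't set" where
  "zero_set r \<phi> K = (\<lambda>(V, a). {t. a t = \<zero>\<^bsub>tensor_power K r V (\<phi> t)\<^esub>})"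

text \<open>An object of \<open>F\<close> is \<open>(V, W, z, \<Lambda>)\<close>; \<open>ext \<phi>\<close> is the extension of \<open>\<phi>\<close> to \<open>T\<close>.\<close>

type_synonym ('t, 'k) F_obj =
  "(nat \<Rightarrow> ('k, 'k) module) \<times> (nat \<Rightarrow> ('k, 'k) module) \<times> (nat \<Rightarrow> 'k) \<times>
   ('t groth \<Rightarrow> ((nat \<Rightarrow> 'k) \<Rightarrow> 'k) \<Rightarrow> (nat \<Rightarrow> 'k) \<Rightarrow> 'k)"

definition ext :: "('t::comm_monoid_add \<Rightarrow> nat \<Rightarrow> int) \<Rightarrow> 't groth \<Rightarrow> nat \<Rightarrow> int" where
  "ext \<phi> x i = groth_ext (\<lambda>t. \<phi> t i) x"

definition ext_dual :: "(nat \<Rightarrow> 't::comm_monoid_add \<Rightarrow> nat) \<Rightarrow> 't groth \<Rightarrow> nat \<Rightarrow> int" where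
  "ext_dual Es = ext (\<lambda>t j. int (Es j t))"

definition F_ob ::
  "nat \<Rightarrow> ('t::comm_monoid_add \<Rightarrow> nat \<Rightarrow> int) \<Rightarrow> nat \<Rightarrow> (nat \<Rightarrow> 't \<Rightarrow> nat) \<Rightarrow> 'k ring \<Rightarrow> ('t, 'k) F_obj set"
where
  "F_ob r \<phi> s Es K = {(V, W, z, \<Lambda>).
    (\<forall>i<r. line K (V i)) \<and>
    (\<forall>j<s. line K (W j) \<and> z j \<in> carrier (W j)) \<and>
    (\<forall>t. line_map (\<lambda>c. c) K
      (tensor_power K r V (ext \<phi> t)) (tensor_power K s W (ext_dual Es t)) (\<Lambda> t)) \<and>
    (\<forall>t t'. \<forall>x\<in>carrier (tensor_power K r V (ext \<phi> t)).
      \<forall>x'\<in>carrier (tensor_power K r V (ext \<phi> t')).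
        \<Lambda> (t + t') (tensor_mult K r V x x') = tensor_mult K s W (\<Lambda> t x) (\<Lambda> t' x'))}"

definition F_arrow ::
  "nat \<Rightarrow> ('t::comm_monoid_add \<Rightarrow> nat \<Rightarrow> int) \<Rightarrow> nat \<Rightarrow>
    ('k \<Rightarrow> 'l) \<Rightarrow> 'k ring \<Rightarrow> 'l ring \<Rightarrow> ('t, 'k) F_obj \<Rightarrow> ('t, 'l) F_obj \<Rightarrow> bool" where
  "F_arrow r \<phi> s h K K' = (\<lambda>(V, W, z, \<Lambda>) (V', W', z', \<Lambda>').
    \<exists>\<sigma> \<tau>.
      (\<forall>i<r. line_map h K (V i) (V' i) (\<sigma> i)) \<and>
      (\<forall>j<s. line_map h K (W j) (W' j) (\<tau> j) \<and> \<tau> j (z j) = z' j) \<and>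
      (\<forall>t. \<forall>x\<in>carrier (tensor_power K r V (ext \<phi> t)).
        \<forall>x'\<in>carrier (tensor_power K' r V' (ext \<phi> t)).
          tensor_image r h V \<sigma> x x' \<longrightarrow> tensor_image s h W \<tau> (\<Lambda> t x) (\<Lambda>' t x')))"

definition F_pi ::
  "nat \<Rightarrow> ('t::comm_monoid_add \<Rightarrow> nat \<Rightarrow> int) \<Rightarrow> nat \<Rightarrow> (nat \<Rightarrow> 't \<Rightarrow> nat) \<Rightarrow> 'k ring \<Rightarrow>
    ('t, 'k) F_obj \<Rightarrow> ('t, 'k) X_obj" where
  "F_pi r \<phi> s Es K = (\<lambda>(V, W, z, \<Lambda>).
    (V, \<lambda>t. inv_into (carrier (tensor_power K r V (\<phi> t))) (\<Lambda> (of_monoid t))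
      (tensor_monomial K s W z (\<lambda>j. Es j t))))"


section \<open>Points of a stack\<close>

definition is_alg_closure :: "'k ring \<Rightarrow> 'l ring \<Rightarrow> ('k \<Rightarrow> 'l) \<Rightarrow> bool" where
  "is_alg_closure k kbar j \<longleftrightarrow>
    field k \<and> field kbar \<and> j \<in> ring_hom k kbar \<and> algebraic_closure kbar (j ` carrier k)"

text \<open>The set \<open>|\<X>|\<close> of points of a stack with objects \<open>ob\<close> and arrows \<open>arr\<close>: classes of objects over
  fields, two of them being equivalent if they become isomorphic over a common field extension.
  Fields range over those with underlying set in a type \<open>'u\<close>. If \<open>'u\<close> is infinite, it contains a
  common extension of any two of its fields that have one at all, and (a copy of) every finitely
  generated field, so nothing is lost for stacks of finite type over \<open>\<int>\<close>. Having a common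
  extension is already a transitive relation (two extensions of a field have a compositum);
  taking \<open>\<^sup>+\<close> does not enlarge it.\<close>

definition field_points :: "('u ring \<Rightarrow> 'x set) \<Rightarrow> ('u ring \<times> 'x) set" where
  "field_points ob = {(K, x). field K \<and> x \<in> ob K}"

definition point_equiv ::
  "('u ring \<Rightarrow> 'x set) \<Rightarrow> (('u \<Rightarrow> 'u) \<Rightarrow> 'u ring \<Rightarrow> 'u ring \<Rightarrow> 'x \<Rightarrow> 'x \<Rightarrow> bool) \<Rightarrow>
    (('u ring \<times> 'x) \<times> ('u ring \<times> 'x)) set" where
  "point_equiv ob arr =
    {((K, x), (K', x')). (K, x) \<in> field_points ob \<and> (K', x') \<in> field_points ob \<and>
      (\<exists>L y h h'. (L, y) \<in> field_points ob \<and> h \<in> ring_hom K L \<and> h' \<in> ring_hom K' L \<and>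
        arr h K L x y \<and> arr h' K' L x' y)}\<^sup>+"

definition stack_points ::
  "('u ring \<Rightarrow> 'x set) \<Rightarrow> (('u \<Rightarrow> 'u) \<Rightarrow> 'u ring \<Rightarrow> 'u ring \<Rightarrow> 'x \<Rightarrow> 'x \<Rightarrow> bool) \<Rightarrow>
    ('u ring \<times> 'x) set set" where
  "stack_points ob arr = field_points ob // point_equiv ob arr"

definition Z_point_equiv ::
  "nat \<Rightarrow> ('t::comm_monoid_add \<Rightarrow> nat \<Rightarrow> int) \<Rightarrow>
    (('u ring \<times> ('t, 'u) X_obj) \<times> ('u ring \<times> ('t, 'u) X_obj)) set" where
  "Z_point_equiv r \<phi> = point_equiv (Z_ob r \<phi>) (X_arrow r)"

definition Z_points ::
  "nat \<Rightarrow> ('t::comm_monoid_add \<Rightarrow> nat \<Rightarrow> int) \<Rightarrow> ('u ring \<times> ('t, 'u) X_obj) set set" where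
  "Z_points r \<phi> = stack_points (Z_ob r \<phi>) (X_arrow r)"

definition F_point_equiv ::
  "nat \<Rightarrow> ('t::comm_monoid_add \<Rightarrow> nat \<Rightarrow> int) \<Rightarrow> nat \<Rightarrow> (nat \<Rightarrow> 't \<Rightarrow> nat) \<Rightarrow>
    (('u ring \<times> ('t, 'u) F_obj) \<times> ('u ring \<times> ('t, 'u) F_obj)) set" where
  "F_point_equiv r \<phi> s Es = point_equiv (F_ob r \<phi> s Es) (F_arrow r \<phi> s)"

definition F_points ::
  "nat \<Rightarrow> ('t::comm_monoid_add \<Rightarrow> nat \<Rightarrow> int) \<Rightarrow> nat \<Rightarrow> (nat \<Rightarrow> 't \<Rightarrow> nat) \<Rightarrow>
    ('u ring \<times> ('t, 'u) F_obj) set set" where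
  "F_points r \<phi> s Es = stack_points (F_ob r \<phi> s Es) (F_arrow r \<phi> s)"

end

theory Submission imports Defs begin

text \<open>
  A frame \<open>e\<close> of the lines turns an object \<open>(V, a)\<close> over a field \<open>K\<close> into the monoid map
  \<open>t \<mapsto> a(t)(e)\<close> from \<open>T\<^sub>+\<close> to \<open>(K, \<cdot>)\<close>, and an arrow over \<open>h : K \<rightarrow> L\<close> from \<open>(V, a)\<close> to \<open>(V', a')\<close>
  into a point \<open>c\<close> of the torus \<open>(L\<^sup>*)\<^sup>r\<close> with \<open>h (a(t)(e)) = c\<^sup>-\<^sup>\<phi>\<^sup>t a'(t)(e')\<close>
  (\<open>X_arrow_coordinates\<close>). A homomorphism \<open>\<int>[T\<^sub>+] \<rightarrow> K\<close> factors through \<open>\<int>[T\<^sub>+\<^sup>i\<^sup>n\<^sup>t]\<close> iff it takes equal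
  values on elements of \<open>T\<^sub>+\<close> with the same image in \<open>T\<close>, so the object lies in \<open>Z\<^sub>\<phi>\<close> iff
  \<open>a\<close> respects this equivalence relation (\<open>Z_ob_iff\<close>). The theorem thus becomes a statement on
  monoid maps \<open>\<alpha> : T\<^sub>+ \<rightarrow> K\<close> up to the action of a torus.

  Let \<open>\<alpha>\<close> respect the relation and let \<open>U = {t. \<alpha> t \<noteq> 0}\<close>; a sum lies in \<open>U\<close> iff both summands do.
  Two facts decompose \<open>\<alpha>\<close>.

  \<^item> \<open>U\<close> is the zero locus of some \<open>E\<close> in the dual monoid (\<open>dual_with_zeros\<close>). It suffices to find,
    for every generator \<open>g\<close> outside \<open>U\<close>, a nonnegative functional that vanishes on \<open>U\<close> and is
    positive at \<open>g\<close>. By Farkas' lemma over the integers the only obstruction is an equation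
    \<open>f = N g + s\<close> in \<open>T\<close> with \<open>f \<in> U\<close>, \<open>s \<in> T\<^sub>+\<close> and \<open>N > 0\<close>, and then
    \<open>\<alpha>(f) = \<alpha>(g)\<^sup>N \<alpha>(s) = 0\<close>, which is absurd.
  \<^item> If \<open>K\<close> contains all roots of its elements, then every character of a subgroup of \<open>\<int>\<^sup>n\<close> extends to
    \<open>\<int>\<^sup>n\<close> (\<open>character_extends\<close>). So \<open>\<alpha>\<close> on \<open>U\<close> extends to a character of \<open>T\<close>.

  Together they give \<open>\<alpha>(t) = \<lambda>\<^sub>t 0^E(t)\<close> (\<open>integral_decomposition\<close>). If \<open>E = \<Sum>\<^sub>j q\<^sub>j E\<^sup>j\<close> with
  \<open>q\<^sub>j \<ge> 0\<close>, then the sections \<open>z\<^sub>j = 0\<close> for \<open>q\<^sub>j > 0\<close> and \<open>z\<^sub>j = 1\<close> for \<open>q\<^sub>j = 0\<close> of trivial lines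
  give an object over \<open>\<alpha>\<close> of the stack of the \<open>E\<^sup>j\<close> (\<open>F_pi_essentially_surjective\<close>). If \<open>\<phi>\<close> is
  injective, then \<open>T\<close> is a subgroup of \<open>\<int>\<^sup>r\<close>, the quotient of two maps with the same \<open>U\<close> extends to a
  character of \<open>\<int>\<^sup>r\<close>, and this is a point of the torus that connects them; so the isomorphism
  classes are classified by their zero sets (\<open>Z_iso_eq_zero_sets\<close>).

  For the statements on points, roots are adjoined to an arbitrary field \<open>K\<close>. The algebraic closure of
  \<open>K\<close> has at most as many elements as there are finite sequences in \<open>K\<close>, so it has a copy in
  every infinite type that contains \<open>K\<close> (\<open>root_closed_extension_exists\<close>). If \<open>\<phi>\<close> is injective, every
  object becomes isomorphic to the one of some \<open>t \<mapsto> 0^E(t)\<close> over such an extension. This object is defined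
  over the prime field, whence it connects \<open>K\<close> with the algebraic closure of the prime field
  (\<open>Z_point_over_prime_closure\<close>). Conversely, the characteristic and the zero set do not change along
  arrows (\<open>Z_point_invariants\<close>), so they separate the points.
\<close>

section \<open>Characters of a split torus\<close>

locale base_field = field K for K :: "'k ring" (structure)
begin

text \<open>Integer powers have their laws in groups; the group of units transports them to the units of the
  field.\<close>

lemma units_int_pow: "x \<in> Units K \<Longrightarrow> x [^] (i::int) = x [^]\<^bsub>units_of K\<^esub> i"
  unfolding int_pow_def2 by (simp only: units_of_inv units_of_pow Units_pow_closed)

lemma units_int_pow_closed [simp, intro]: "x \<in> Units K \<Longrightarrow> x [^] (i::int) \<in> Units K"
  using group.int_pow_closed[OF units_group] by (simp add: units_int_pow units_of_carrier)

lemma units_int_pow_carrier [simp, intro]: "x \<in> Units K \<Longrightarrow> x [^] (i::int) \<in> carrier K"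
  by (rule Units_closed) simp

lemma units_int_pow_add:
  "x \<in> Units K \<Longrightarrow> x [^] (i + j::int) = x [^] i \<otimes> x [^] j"
  using group.int_pow_mult[OF units_group, of x i j]
  by (simp add: units_int_pow units_of_carrier units_of_mult)

lemma units_int_pow_neg: "x \<in> Units K \<Longrightarrow> x [^] (- i::int) = inv (x [^] i)"
  using group.int_pow_neg[OF units_group, of x i] group.int_pow_closed[OF units_group, of x i]
  by (simp add: units_int_pow units_of_carrier units_of_inv)

lemma units_int_pow_distrib:
  "x \<in> Units K \<Longrightarrow> y \<in> Units K \<Longrightarrow> (x \<otimes> y) [^] (i::int) = x [^] i \<otimes> y [^] i"
  using comm_group.int_pow_distrib[OF units_comm_group, of x y i]
  by (simp add: units_int_pow units_of_carrier units_of_mult)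

lemma units_int_pow_pow:
  "x \<in> Units K \<Longrightarrow> (x [^] (i::int)) [^] (j::int) = x [^] (i * j)"
  using group.int_pow_pow[OF units_group, of x i j] units_int_pow_closed[of x i]
  by (simp add: units_int_pow units_of_carrier)

lemma one_int_pow [simp]: "\<one> [^] (i::int) = \<one>"
  using group.int_pow_one[OF units_group, of i]
  by (simp add: units_int_pow units_of_one)

lemma unit_iff: "x \<in> Units K \<longleftrightarrow> x \<in> carrier K \<and> x \<noteq> \<zero>"
  using field_Units by auto

lemma nonzero_mult_iff:
  "x \<in> carrier K \<Longrightarrow> y \<in> carrier K \<Longrightarrow> x \<otimes> y = \<zero> \<longleftrightarrow> x = \<zero> \<or> y = \<zero>"
  using integral_iff by blast

lemma finprod_units:
  assumes "u \<in> A \<rightarrow> Units K"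
  shows "(\<Otimes>i\<in>A. u i) \<in> Units K"
  using assms
proof (induction A rule: infinite_finite_induct)
  case (insert x A)
  then have "u \<in> A \<rightarrow> carrier K" "u x \<in> carrier K" by auto
  with insert show ?case by (simp add: finprod_insert)
qed auto

lemma inv_mult: "x \<in> Units K \<Longrightarrow> y \<in> Units K \<Longrightarrow> inv (x \<otimes> y) = inv x \<otimes> inv y"
  using comm_group.inv_mult[OF units_comm_group, of x y]
  by (simp add: units_of_carrier units_of_mult units_of_inv)

lemma finprod_inv:
  assumes "u \<in> A \<rightarrow> Units K"
  shows "(\<Otimes>i\<in>A. inv (u i)) = inv (\<Otimes>i\<in>A. u i)"
  using assms
proof (induction A rule: infinite_finite_induct)
  case (insert x A)
  then have "u \<in> A \<rightarrow> Units K" "u x \<in> Units K" "u \<in> A \<rightarrow> carrier K" "u x \<in> carrier K"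
     "(\<lambda>i. inv (u i)) \<in> A \<rightarrow> carrier K" by auto
  with insert show ?case by (simp add: finprod_insert inv_mult finprod_units)
qed auto

end

text \<open>The character \<open>f\<close> of the split torus \<open>(K\<^sup>*)\<^sup>r\<close> at the point \<open>u\<close>.\<close>

definition torus_char :: "'k ring \<Rightarrow> nat \<Rightarrow> (nat \<Rightarrow> 'k) \<Rightarrow> (nat \<Rightarrow> int) \<Rightarrow> 'k" where
  "torus_char K r u f = (\<Otimes>\<^bsub>K\<^esub>i\<in>{..<r}. u i [^]\<^bsub>K\<^esub> f i)"

context base_field
begin

lemma torus_char_unit [simp, intro]:
  "u \<in> {..<r} \<rightarrow> Units K \<Longrightarrow> torus_char K r u f \<in> Units K"
  unfolding torus_char_def by (intro finprod_units) auto

lemma torus_char_closed [simp, intro]: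
  "u \<in> {..<r} \<rightarrow> Units K \<Longrightarrow> torus_char K r u f \<in> carrier K"
  using torus_char_unit by blast

lemma torus_char_cong:
  assumes "u \<in> {..<r} \<rightarrow> Units K" "\<And>i. i < r \<Longrightarrow> u i = v i" "\<And>i. i < r \<Longrightarrow> f i = g i"
  shows "torus_char K r u f = torus_char K r v g"
proof -
  have "v i [^] g i \<in> carrier K" if "i < r" for i
    using assms(1) assms(2)[OF that] that by (metis PiE lessThan_iff units_int_pow_carrier)
  then show ?thesis
    unfolding torus_char_def by (intro finprod_cong') (use assms in auto)
qed

lemma torus_char_add:
  assumes "u \<in> {..<r} \<rightarrow> Units K"
  shows "torus_char K r u (\<lambda>i. f i + g i) = torus_char K r u f \<otimes> torus_char K r u g"
proof -
  have "torus_char K r u (\<lambda>i. f i + g i) = (\<Otimes>i\<in>{..<r}. u i [^] f i \<otimes> u i [^] g i)"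
    unfolding torus_char_def by (rule finprod_cong') (use assms in \<open>auto intro: units_int_pow_add\<close>)
  also have "\<dots> = torus_char K r u f \<otimes> torus_char K r u g"
    unfolding torus_char_def by (rule finprod_multf) (use assms in auto)
  finally show ?thesis .
qed

lemma torus_char_mult:
  assumes "u \<in> {..<r} \<rightarrow> Units K" "v \<in> {..<r} \<rightarrow> Units K"
  shows "torus_char K r (\<lambda>i. u i \<otimes> v i) f = torus_char K r u f \<otimes> torus_char K r v f"
proof -
  have "torus_char K r (\<lambda>i. u i \<otimes> v i) f = (\<Otimes>i\<in>{..<r}. u i [^] f i \<otimes> v i [^] f i)"
    unfolding torus_char_def
    by (rule finprod_cong') (use assms in \<open>auto intro!: units_int_pow_distrib\<close>)
  also have "\<dots> = torus_char K r u f \<otimes> torus_char K r v f"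
    unfolding torus_char_def by (rule finprod_multf) (use assms in auto)
  finally show ?thesis .
qed

lemma torus_char_neg:
  assumes "u \<in> {..<r} \<rightarrow> Units K"
  shows "torus_char K r u (\<lambda>i. - f i) = inv (torus_char K r u f)"
proof -
  have "torus_char K r u (\<lambda>i. - f i) = (\<Otimes>i\<in>{..<r}. inv (u i [^] f i))"
    unfolding torus_char_def
    by (rule finprod_cong') (use assms in \<open>auto intro!: units_int_pow_neg\<close>)
  also have "\<dots> = inv (torus_char K r u f)"
    unfolding torus_char_def by (rule finprod_inv) (use assms in auto)
  finally show ?thesis .
qed

lemma torus_char_zero [simp]: "torus_char K r u (\<lambda>i. 0) = \<one>"
  unfolding torus_char_def by simp

lemma torus_char_one [simp]: "torus_char K r (\<lambda>i. \<one>) f = \<one>"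
  unfolding torus_char_def by (rule finprod_one_eqI) simp

end

lemma hom_fields_ring_hom_cring:
  assumes "field K" "field L" "h \<in> ring_hom K L"
  shows "ring_hom_cring K L h"
proof -
  interpret K: field K by fact
  interpret L: field L by fact
  show ?thesis by unfold_locales (use assms in auto)
qed

lemma hom_fields_nat_pow:
  assumes "field K" "field L" "h \<in> ring_hom K L" "x \<in> carrier K"
  shows "h (x [^]\<^bsub>K\<^esub> (n::nat)) = h x [^]\<^bsub>L\<^esub> n"
  using ring_hom_ring.hom_nat_pow[OF ring_hom_ringI2, of K L h x n] assms
  by (simp add: field.is_ring)

lemma hom_units:
  assumes "field K" "field L" "h \<in> ring_hom K L" "x \<in> Units K"
  shows "h x \<in> Units L" "h (inv\<^bsub>K\<^esub> x) = inv\<^bsub>L\<^esub> (h x)"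
proof -
  interpret K: field K by fact
  interpret L: field L by fact
  have *: "h x \<otimes>\<^bsub>L\<^esub> h (inv\<^bsub>K\<^esub> x) = \<one>\<^bsub>L\<^esub>"
    using assms(3,4) by (metis K.Units_closed K.Units_inv_closed K.Units_r_inv ring_hom_mult ring_hom_one)
  have c: "h x \<in> carrier L" "h (inv\<^bsub>K\<^esub> x) \<in> carrier L"
    using assms(3,4) by (auto intro: ring_hom_closed)
  show "h x \<in> Units L" using * c L.m_comm[OF c] unfolding Units_def by auto
  show "h (inv\<^bsub>K\<^esub> x) = inv\<^bsub>L\<^esub> (h x)" using L.comm_inv_char[OF c *] by simp
qed

lemma hom_units_int_pow:
  assumes "field K" "field L" "h \<in> ring_hom K L" "x \<in> Units K"
  shows "h (x [^]\<^bsub>K\<^esub> (i::int)) = h x [^]\<^bsub>L\<^esub> i"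
proof -
  interpret K: field K by fact
  have "h (x [^]\<^bsub>K\<^esub> n) = h x [^]\<^bsub>L\<^esub> n" for n :: nat
    by (rule hom_fields_nat_pow[OF assms(1-3) K.Units_closed[OF assms(4)]])
  then show ?thesis
    using hom_units(2)[OF assms(1-3) K.Units_pow_closed[OF assms(4)]]
    unfolding int_pow_def2 by (cases "i < 0") (simp_all only: if_True if_False)
qed

lemma hom_torus_char:
  assumes "field K" "field L" "h \<in> ring_hom K L" "u \<in> {..<r} \<rightarrow> Units K"
  shows "h (torus_char K r u f) = torus_char L r (\<lambda>i. h (u i)) f"
proof -
  interpret K: base_field K using assms by (simp add: base_field_def)
  interpret L: base_field L using assms by (simp add: base_field_def)
  interpret h: ring_hom_cring K L h
    by (rule hom_fields_ring_hom_cring) (use assms in auto)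
  have "h (torus_char K r u f) = (\<Otimes>\<^bsub>L\<^esub>i\<in>{..<r}. h (u i [^]\<^bsub>K\<^esub> f i))"
    unfolding torus_char_def using h.hom_finprod[of "\<lambda>i. u i [^]\<^bsub>K\<^esub> f i" "{..<r}"] assms(4)
    by (auto simp: o_def)
  also have "\<dots> = torus_char L r (\<lambda>i. h (u i)) f"
    unfolding torus_char_def
    by (rule L.finprod_cong')
      (use assms(4) hom_units(1)[OF assms(1-3)] in \<open>auto intro!: hom_units_int_pow[OF assms(1-3)]\<close>)
  finally show ?thesis .
qed

section \<open>Lines, frames and tensor powers\<close>

context base_field
begin

lemma line_module: "line K V \<Longrightarrow> module K V"
  by (simp add: line_def)

lemma line_basis:
  assumes "line K V"
  obtains e where "e \<in> carrier V"
    and "\<And>v. v \<in> carrier V \<Longrightarrow> \<exists>c\<in>carrier K. v = c \<odot>\<^bsub>V\<^esub> e"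
    and "\<And>c d. c \<in> carrier K \<Longrightarrow> d \<in> carrier K \<Longrightarrow> c \<odot>\<^bsub>V\<^esub> e = d \<odot>\<^bsub>V\<^esub> e \<Longrightarrow> c = d"
proof -
  interpret V: module K V by (rule line_module[OF assms])
  obtain e where e: "e \<in> carrier V"
    and u: "\<forall>v\<in>carrier V. \<exists>!c. c \<in> carrier K \<and> v = c \<odot>\<^bsub>V\<^esub> e"
    using assms unfolding line_def by (elim conjE bexE)
  show ?thesis
  proof (rule that[OF e])
    show "\<exists>c\<in>carrier K. v = c \<odot>\<^bsub>V\<^esub> e" if "v \<in> carrier V" for v
      using ex1_implies_ex[OF bspec[OF u that]] by (elim exE) auto
    fix c d assume c: "c \<in> carrier K" and d: "d \<in> carrier K" and eq: "c \<odot>\<^bsub>V\<^esub> e = d \<odot>\<^bsub>V\<^esub> e"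
    have "c \<odot>\<^bsub>V\<^esub> e \<in> carrier V" using c e by simp
    from bspec[OF u this] show "c = d"
      by (rule ex1E) (use c d eq in metis)
  qed
qed

text \<open>The definition of a line names one generator; every nonzero vector is a unit multiple of it.\<close>

lemma line_generator:
  assumes V: "line K V" and e: "e \<in> carrier V" "e \<noteq> \<zero>\<^bsub>V\<^esub>" and v: "v \<in> carrier V"
  shows "\<exists>!c. c \<in> carrier K \<and> v = c \<odot>\<^bsub>V\<^esub> e"
proof -
  interpret V: module K V by (rule line_module[OF V])
  obtain e0 where e0: "e0 \<in> carrier V"
    and ex: "\<And>v. v \<in> carrier V \<Longrightarrow> \<exists>c\<in>carrier K. v = c \<odot>\<^bsub>V\<^esub> e0"
    and inj: "\<And>c d. c \<in> carrier K \<Longrightarrow> d \<in> carrier K \<Longrightarrow> c \<odot>\<^bsub>V\<^esub> e0 = d \<odot>\<^bsub>V\<^esub> e0 \<Longrightarrow> c = d"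
    using line_basis[OF V] by metis
  obtain b where b: "b \<in> carrier K" "e = b \<odot>\<^bsub>V\<^esub> e0" using ex[OF e(1)] ..
  obtain c where c: "c \<in> carrier K" "v = c \<odot>\<^bsub>V\<^esub> e0" using ex[OF v] ..
  have "b \<noteq> \<zero>" using b(2) e(2) e0 by auto
  then have bU: "b \<in> Units K" using b unit_iff by auto
  have mult: "d \<odot>\<^bsub>V\<^esub> e = (d \<otimes> b) \<odot>\<^bsub>V\<^esub> e0" if "d \<in> carrier K" for d
    using that b e0 by (simp add: V.smult_assoc1)
  have uniq: "d = c \<otimes> inv b" if d: "d \<in> carrier K" "v = d \<odot>\<^bsub>V\<^esub> e" for d
  proof -
    have "d \<otimes> b = c" using inj[of "d \<otimes> b" c] c d mult[OF d(1)] b(1) by simp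
    then have "c \<otimes> inv b = d \<otimes> b \<otimes> inv b" by simp
    also have "\<dots> = d" using d bU b by (simp add: m_assoc)
    finally show ?thesis ..
  qed
  have ex: "c \<otimes> inv b \<in> carrier K \<and> v = (c \<otimes> inv b) \<odot>\<^bsub>V\<^esub> e"
    using c bU mult[of "c \<otimes> inv b"] b by (simp add: m_assoc)
  show ?thesis by (rule ex1I[of _ "c \<otimes> inv b"]) (use ex uniq in blast)+
qed

lemma line_nonzero:
  assumes V: "line K V"
  obtains e where "e \<in> carrier V" "e \<noteq> \<zero>\<^bsub>V\<^esub>"
proof -
  interpret V: module K V by (rule line_module[OF V])
  obtain e where e: "e \<in> carrier V"
    and inj: "\<And>c d. c \<in> carrier K \<Longrightarrow> d \<in> carrier K \<Longrightarrow> c \<odot>\<^bsub>V\<^esub> e = d \<odot>\<^bsub>V\<^esub> e \<Longrightarrow> c = d"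
    using line_basis[OF V] by metis
  have "e \<noteq> \<zero>\<^bsub>V\<^esub>"
  proof
    assume "e = \<zero>\<^bsub>V\<^esub>"
    then have "\<zero> \<odot>\<^bsub>V\<^esub> e = \<one> \<odot>\<^bsub>V\<^esub> e" using e by simp
    then have "\<zero> = \<one>" by (rule inj[OF zero_closed one_closed])
    then show False by simp
  qed
  with e that show ?thesis by blast
qed

lemma
  assumes V: "line K V" and e: "e \<in> carrier V" "e \<noteq> \<zero>\<^bsub>V\<^esub>" and v: "v \<in> carrier V"
  shows coordinate_closed: "coordinate K V e v \<in> carrier K"
    and coordinate_smult: "coordinate K V e v \<odot>\<^bsub>V\<^esub> e = v"
  using theI'[OF line_generator[OF assms]] unfolding coordinate_def by auto

lemma coordinate_unique:
  assumes V: "line K V" and e: "e \<in> carrier V" "e \<noteq> \<zero>\<^bsub>V\<^esub>" and c: "c \<in> carrier K"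
  shows "coordinate K V e (c \<odot>\<^bsub>V\<^esub> e) = c"
proof -
  interpret V: module K V by (rule line_module[OF V])
  have "c \<odot>\<^bsub>V\<^esub> e \<in> carrier V" using c e by simp
  from line_generator[OF V e this] show ?thesis
    unfolding coordinate_def using c by (intro the1_equality) auto
qed

lemma coordinate_zero_iff:
  assumes V: "line K V" and e: "e \<in> carrier V" "e \<noteq> \<zero>\<^bsub>V\<^esub>" and v: "v \<in> carrier V"
  shows "coordinate K V e v = \<zero> \<longleftrightarrow> v = \<zero>\<^bsub>V\<^esub>"
proof -
  interpret V: module K V by (rule line_module[OF V])
  show ?thesis
    using coordinate_smult[OF assms] coordinate_unique[OF V e, of \<zero>] e by auto
qed

lemma coordinate_linear:
  assumes V: "line K V" and e: "e \<in> carrier V" "e \<noteq> \<zero>\<^bsub>V\<^esub>"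
    and v: "v \<in> carrier V" "w \<in> carrier V" "c \<in> carrier K"
  shows "coordinate K V e (v \<oplus>\<^bsub>V\<^esub> w) = coordinate K V e v \<oplus> coordinate K V e w"
    and "coordinate K V e (c \<odot>\<^bsub>V\<^esub> v) = c \<otimes> coordinate K V e v"
proof -
  interpret V: module K V by (rule line_module[OF V])
  define x y where "x = coordinate K V e v" and "y = coordinate K V e w"
  have xy: "x \<in> carrier K" "y \<in> carrier K" "v = x \<odot>\<^bsub>V\<^esub> e" "w = y \<odot>\<^bsub>V\<^esub> e"
    using coordinate_closed[OF V e] coordinate_smult[OF V e] v by (auto simp: x_def y_def)
  have "v \<oplus>\<^bsub>V\<^esub> w = (x \<oplus> y) \<odot>\<^bsub>V\<^esub> e" "c \<odot>\<^bsub>V\<^esub> v = (c \<otimes> x) \<odot>\<^bsub>V\<^esub> e"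
    using xy v e by (simp_all add: V.smult_l_distr V.smult_assoc1)
  then show "coordinate K V e (v \<oplus>\<^bsub>V\<^esub> w) = coordinate K V e v \<oplus> coordinate K V e w"
    "coordinate K V e (c \<odot>\<^bsub>V\<^esub> v) = c \<otimes> coordinate K V e v"
    unfolding x_def[symmetric] y_def[symmetric]
    using coordinate_unique[OF V e] xy v by simp_all
qed

lemma smult_unit_nonzero:
  assumes V: "line K V" and e: "e \<in> carrier V" "e \<noteq> \<zero>\<^bsub>V\<^esub>" and c: "c \<in> Units K"
  shows "c \<odot>\<^bsub>V\<^esub> e \<in> carrier V" "c \<odot>\<^bsub>V\<^esub> e \<noteq> \<zero>\<^bsub>V\<^esub>"
proof -
  interpret V: module K V by (rule line_module[OF V])
  show cl: "c \<odot>\<^bsub>V\<^esub> e \<in> carrier V" using c e by auto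
  show "c \<odot>\<^bsub>V\<^esub> e \<noteq> \<zero>\<^bsub>V\<^esub>"
    using coordinate_zero_iff[OF V e cl] coordinate_unique[OF V e, of c] c by (auto simp: unit_iff)
qed

end

definition scale_frame ::
  "nat \<Rightarrow> (nat \<Rightarrow> ('k, 'v) module) \<Rightarrow> (nat \<Rightarrow> 'k) \<Rightarrow> (nat \<Rightarrow> 'v) \<Rightarrow> nat \<Rightarrow> 'v" where
  "scale_frame r V u e = (\<lambda>i\<in>{..<r}. u i \<odot>\<^bsub>V i\<^esub> e i)"

locale line_family = base_field K for K :: "'k ring" (structure) +
  fixes r :: nat and V :: "nat \<Rightarrow> ('k, 'v) module"
  assumes lines: "i < r \<Longrightarrow> line K (V i)"
begin

abbreviation "tp \<equiv> tensor_power K r V"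

lemma frame_nth:
  assumes "e \<in> frames r V" "i < r"
  shows "e i \<in> carrier (V i)" "e i \<noteq> \<zero>\<^bsub>V i\<^esub>"
  using assms by (auto simp: frames_def PiE_iff)

lemma frame_undefined: "e \<in> frames r V \<Longrightarrow> \<not> i < r \<Longrightarrow> e i = undefined"
  by (auto simp: frames_def PiE_iff extensional_def)

lemma frames_nonempty: obtains e where "e \<in> frames r V"
proof -
  have "\<exists>e. e \<in> carrier (V i) - {\<zero>\<^bsub>V i\<^esub>}" if "i < r" for i
    by (rule line_nonzero[OF lines[OF that]]) auto
  then have "frames r V \<noteq> {}" unfolding frames_def by (simp add: PiE_eq_empty_iff) blast
  with that show ?thesis by blast
qed

lemma scale_frame_closed:
  assumes "u \<in> {..<r} \<rightarrow> Units K" "e \<in> frames r V"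
  shows "scale_frame r V u e \<in> frames r V"
  using assms smult_unit_nonzero[OF lines frame_nth(1,2)[OF assms(2)]]
  by (auto simp: frames_def scale_frame_def Pi_iff)

text \<open>The frames form a torsor under the torus: this and \<open>scale_frame_closed\<close> reduce every statement on
  all frames to a single one.\<close>

lemma frame_ratio:
  assumes "e \<in> frames r V" "e' \<in> frames r V"
  shows "(\<lambda>i. coordinate K (V i) (e i) (e' i)) \<in> {..<r} \<rightarrow> Units K" (is "?u \<in> _")
    and "scale_frame r V (\<lambda>i. coordinate K (V i) (e i) (e' i)) e = e'"
proof -
  note e = frame_nth[OF assms(1)] and e' = frame_nth[OF assms(2)]
  show "?u \<in> {..<r} \<rightarrow> Units K"
    using coordinate_closed[OF lines e e'(1)] coordinate_zero_iff[OF lines e e'(1)] e'(2)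
    by (auto simp: unit_iff)
  show "scale_frame r V ?u e = e'"
    using coordinate_smult[OF lines e e'(1)] frame_undefined[OF assms(2)]
    by (auto simp: scale_frame_def fun_eq_iff restrict_def)
qed

lemma frame_coordinate_scale:
  assumes "e \<in> frames r V" "b \<in> frames r V" "u \<in> {..<r} \<rightarrow> Units K" "i < r"
  shows "coordinate K (V i) (e i) (scale_frame r V u b i) = u i \<otimes> coordinate K (V i) (e i) (b i)"
  using coordinate_linear(2)[OF lines frame_nth[OF assms(1)] _ frame_nth(1)[OF assms(2)], of i "b i" "u i"]
    frame_nth(1)[OF assms(2)] assms by (auto simp: scale_frame_def Pi_iff)

lemma tensor_power_iff:
  "x \<in> carrier (tp f) \<longleftrightarrow>
    x \<in> frames r V \<rightarrow>\<^sub>E carrier K \<and>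
    (\<forall>e\<in>frames r V. \<forall>u\<in>{..<r} \<rightarrow> Units K.
      x (scale_frame r V u e) = torus_char K r u (\<lambda>i. - f i) \<otimes> x e)"
  by (simp add: tensor_power_def scale_frame_def torus_char_def)

lemma tensor_power_closed: "x \<in> carrier (tp f) \<Longrightarrow> e \<in> frames r V \<Longrightarrow> x e \<in> carrier K"
  by (auto simp: tensor_power_iff)

lemma tensor_power_scale:
  "x \<in> carrier (tp f) \<Longrightarrow> e \<in> frames r V \<Longrightarrow> u \<in> {..<r} \<rightarrow> Units K \<Longrightarrow>
    x (scale_frame r V u e) = torus_char K r u (\<lambda>i. - f i) \<otimes> x e"
  by (simp add: tensor_power_iff)

lemma tensor_power_cong:
  assumes "\<And>i. i < r \<Longrightarrow> f i = g i"
  shows "carrier (tp f) = carrier (tp g)"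
proof -
  have "torus_char K r u (\<lambda>i. - f i) = torus_char K r u (\<lambda>i. - g i)" if "u \<in> {..<r} \<rightarrow> Units K" for u
    using that assms by (intro torus_char_cong) auto
  then show ?thesis by (auto simp: set_eq_iff tensor_power_iff)
qed

text \<open>A coordinate function is determined by its value at one frame, since the torus acts transitively on
  the frames.\<close>

lemma tensor_power_eqI:
  assumes x: "x \<in> carrier (tp f)" and y: "y \<in> carrier (tp f)" and e: "e \<in> frames r V"
    and eq: "x e = y e"
  shows "x = y"
proof (rule PiE_ext)
  show "x \<in> frames r V \<rightarrow>\<^sub>E carrier K" "y \<in> frames r V \<rightarrow>\<^sub>E carrier K"
    using x y by (auto simp: tensor_power_iff)
  fix b assume b: "b \<in> frames r V"
  note u = frame_ratio[OF e b]
  from tensor_power_scale[OF x e u(1)] tensor_power_scale[OF y e u(1)]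
  show "x b = y b" unfolding u(2) eq by simp
qed

text \<open>Together with \<open>tensor_power_eqI\<close>: evaluation at a frame identifies the tensor power with the field.
  The witness is the equivariant extension of the value \<open>c\<close>; it is well defined because the torus
  acts freely on the frames.\<close>

lemma tensor_power_exists:
  assumes e: "e \<in> frames r V" and c: "c \<in> carrier K"
  obtains x where "x \<in> carrier (tp f)" "x e = c"
proof -
  let ?q = "\<lambda>b i. coordinate K (V i) (e i) (b i)"
  define x where "x = (\<lambda>b\<in>frames r V. torus_char K r (?q b) (\<lambda>i. - f i) \<otimes> c)"
  note q = frame_ratio(1)[OF e]
  have "x \<in> carrier (tp f)"
    unfolding tensor_power_iff
  proof (intro conjI ballI)
    show "x \<in> frames r V \<rightarrow>\<^sub>E carrier K" unfolding x_def using q c by auto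
    fix b u assume b: "b \<in> frames r V" and u: "u \<in> {..<r} \<rightarrow> Units K"
    have "torus_char K r (?q (scale_frame r V u b)) (\<lambda>i. - f i)
        = torus_char K r (\<lambda>i. u i \<otimes> ?q b i) (\<lambda>i. - f i)"
      by (rule torus_char_cong)
        (use q[OF scale_frame_closed[OF u b]] frame_coordinate_scale[OF e b u] in auto)
    also have "\<dots> = torus_char K r u (\<lambda>i. - f i) \<otimes> torus_char K r (?q b) (\<lambda>i. - f i)"
      by (rule torus_char_mult[OF u q[OF b]])
    finally show "x (scale_frame r V u b) = torus_char K r u (\<lambda>i. - f i) \<otimes> x b"
      using b u q[OF b] c scale_frame_closed[OF u b] by (simp add: x_def m_assoc)
  qed
  moreover have "x e = c"
  proof -
    have "torus_char K r (?q e) (\<lambda>i. - f i) = torus_char K r (\<lambda>i. \<one>) (\<lambda>i. - f i)"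
    proof (rule torus_char_cong[OF q[OF e]])
      fix i assume i: "i < r"
      interpret W: module K "V i" by (rule line_module[OF lines[OF i]])
      show "?q e i = \<one>"
        using coordinate_unique[OF lines[OF i] frame_nth[OF e i], of \<one>] frame_nth(1)[OF e i] by simp
    qed simp
    then show ?thesis using e c by (simp add: x_def)
  qed
  ultimately show ?thesis using that by blast
qed

lemma tensor_mult_apply [simp]: "e \<in> frames r V \<Longrightarrow> tensor_mult K r V x y e = x e \<otimes> y e"
  by (simp add: tensor_mult_def)

lemma tensor_mult_closed:
  assumes x: "x \<in> carrier (tp f)" and y: "y \<in> carrier (tp g)"
  shows "tensor_mult K r V x y \<in> carrier (tp (\<lambda>i. f i + g i))"
  unfolding tensor_power_iff
proof (intro conjI ballI)
  show "tensor_mult K r V x y \<in> frames r V \<rightarrow>\<^sub>E carrier K"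
    using tensor_power_closed[OF x] tensor_power_closed[OF y] by (auto simp: tensor_mult_def)
  fix e u assume e: "e \<in> frames r V" and u: "u \<in> {..<r} \<rightarrow> Units K"
  have "torus_char K r u (\<lambda>i. - (f i + g i)) = torus_char K r u (\<lambda>i. - f i) \<otimes> torus_char K r u (\<lambda>i. - g i)"
    using torus_char_add[OF u, of "\<lambda>i. - f i" "\<lambda>i. - g i"] by (simp add: algebra_simps)
  then show "tensor_mult K r V x y (scale_frame r V u e) =
      torus_char K r u (\<lambda>i. - (f i + g i)) \<otimes> tensor_mult K r V x y e"
    using e u scale_frame_closed[OF u e] tensor_power_closed[OF x e] tensor_power_closed[OF y e]
    by (simp add: tensor_power_scale[OF x e u] tensor_power_scale[OF y e u] torus_char_closed m_ac)
qed

lemma tensor_one_closed: "tensor_one K r V \<in> carrier (tp (\<lambda>i. 0))"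
  unfolding tensor_power_iff tensor_one_def by (auto simp: scale_frame_closed)

lemma tensor_one_apply [simp]: "e \<in> frames r V \<Longrightarrow> tensor_one K r V e = \<one>"
  by (simp add: tensor_one_def)

lemma tensor_smult:
  assumes x: "x \<in> carrier (tp f)" and c: "c \<in> carrier K"
  shows "c \<odot>\<^bsub>tp f\<^esub> x \<in> carrier (tp f)"
    and "e \<in> frames r V \<Longrightarrow> (c \<odot>\<^bsub>tp f\<^esub> x) e = c \<otimes> x e"
proof -
  have *: "c \<odot>\<^bsub>tp f\<^esub> x = (\<lambda>e\<in>frames r V. c \<otimes> x e)" by (simp add: tensor_power_def)
  show "c \<odot>\<^bsub>tp f\<^esub> x \<in> carrier (tp f)"
    unfolding tensor_power_iff *
    using tensor_power_closed[OF x] c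
    by (auto simp: scale_frame_closed tensor_power_scale[OF x] m_lcomm)
  show "e \<in> frames r V \<Longrightarrow> (c \<odot>\<^bsub>tp f\<^esub> x) e = c \<otimes> x e" by (simp add: *)
qed

lemma tensor_add:
  assumes x: "x \<in> carrier (tp f)" and y: "y \<in> carrier (tp f)"
  shows "x \<oplus>\<^bsub>tp f\<^esub> y \<in> carrier (tp f)"
    and "e \<in> frames r V \<Longrightarrow> (x \<oplus>\<^bsub>tp f\<^esub> y) e = x e \<oplus> y e"
proof -
  have *: "x \<oplus>\<^bsub>tp f\<^esub> y = (\<lambda>e\<in>frames r V. x e \<oplus> y e)" by (simp add: tensor_power_def)
  show "x \<oplus>\<^bsub>tp f\<^esub> y \<in> carrier (tp f)"
    unfolding tensor_power_iff *
    using tensor_power_closed[OF x] tensor_power_closed[OF y]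
    by (auto simp: scale_frame_closed tensor_power_scale[OF x] tensor_power_scale[OF y] r_distr)
  show "e \<in> frames r V \<Longrightarrow> (x \<oplus>\<^bsub>tp f\<^esub> y) e = x e \<oplus> y e" by (simp add: *)
qed

lemma tensor_zero_iff:
  assumes x: "x \<in> carrier (tp f)" and e: "e \<in> frames r V"
  shows "x = \<zero>\<^bsub>tp f\<^esub> \<longleftrightarrow> x e = \<zero>"
proof -
  have z: "\<zero>\<^bsub>tp f\<^esub> = (\<lambda>e\<in>frames r V. \<zero>)" by (simp add: tensor_power_def)
  have "(\<lambda>e\<in>frames r V. \<zero>) \<in> carrier (tp f)"
    unfolding tensor_power_iff by (auto simp: scale_frame_closed)
  from tensor_power_eqI[OF x this e] e show ?thesis by (auto simp: z)
qed

end

section \<open>Maps between families of lines\<close>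

lemma line_map_nonzero:
  assumes "field K" "field L" "h \<in> ring_hom K L" "line K V" "line L V'"
    and \<beta>: "line_map h K V V' \<beta>" and v: "v \<in> carrier V" "v \<noteq> \<zero>\<^bsub>V\<^esub>"
  shows "\<beta> v \<in> carrier V'" "\<beta> v \<noteq> \<zero>\<^bsub>V'\<^esub>"
proof -
  interpret K: base_field K using assms by (simp add: base_field_def)
  interpret L: base_field L using assms by (simp add: base_field_def)
  interpret h: ring_hom_cring K L h by (rule hom_fields_ring_hom_cring) fact+
  interpret V: module K V by (rule K.line_module) fact
  interpret V': module L V' by (rule L.line_module) fact
  have \<beta>c: "\<And>v. v \<in> carrier V \<Longrightarrow> \<beta> v \<in> carrier V'" and inj: "inj_on \<beta> (carrier V)"
    and lin: "\<And>c v. c \<in> carrier K \<Longrightarrow> v \<in> carrier V \<Longrightarrow> \<beta> (c \<odot>\<^bsub>V\<^esub> v) = h c \<odot>\<^bsub>V'\<^esub> \<beta> v"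
    using \<beta> unfolding line_map_def by auto
  show "\<beta> v \<in> carrier V'" by (rule \<beta>c[OF v(1)])
  have "\<beta> (\<zero>\<^bsub>K\<^esub> \<odot>\<^bsub>V\<^esub> v) = h \<zero>\<^bsub>K\<^esub> \<odot>\<^bsub>V'\<^esub> \<beta> v" by (rule lin) (use v in simp_all)
  then have "\<beta> \<zero>\<^bsub>V\<^esub> = \<zero>\<^bsub>V'\<^esub>" using v \<beta>c by simp
  then show "\<beta> v \<noteq> \<zero>\<^bsub>V'\<^esub>" using inj_onD[OF inj _ v(1), of "\<zero>\<^bsub>V\<^esub>"] v by auto
qed

lemma hom_fields_inj:
  assumes "field K" "field L" "h \<in> ring_hom K L"
  shows "inj_on h (carrier K)"
proof (rule ring_hom_ring.non_trivial_field_hom_imp_inj[of K L])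
  interpret K: field K by fact
  interpret L: field L by fact
  show "ring_hom_ring K L h"
    using K.ring_axioms L.ring_axioms assms(3) by (rule ring_hom_ringI2)
  have "h \<one>\<^bsub>K\<^esub> \<noteq> \<zero>\<^bsub>L\<^esub>" using ring_hom_one[OF assms(3)] by simp
  then show "h ` carrier K \<noteq> {\<zero>\<^bsub>L\<^esub>}" using K.one_closed by blast
qed fact

text \<open>The semilinear map with \<open>e \<mapsto> e'\<close>.\<close>

lemma line_mapI:
  assumes "field K" "field L" and h: "h \<in> ring_hom K L" and V: "line K V" and V': "line L V'"
    and e: "e \<in> carrier V" "e \<noteq> \<zero>\<^bsub>V\<^esub>" and e': "e' \<in> carrier V'" "e' \<noteq> \<zero>\<^bsub>V'\<^esub>"
  shows "line_map h K V V' (\<lambda>v. h (coordinate K V e v) \<odot>\<^bsub>V'\<^esub> e')"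
proof -
  interpret K: base_field K using assms by (simp add: base_field_def)
  interpret L: base_field L using assms by (simp add: base_field_def)
  interpret h: ring_hom_cring K L h by (rule hom_fields_ring_hom_cring) fact+
  interpret V: module K V by (rule K.line_module) fact
  interpret V': module L V' by (rule L.line_module) fact
  note co = K.coordinate_closed[OF V e]
  have inj: "inj_on (\<lambda>v. h (coordinate K V e v) \<odot>\<^bsub>V'\<^esub> e') (carrier V)"
  proof (rule inj_onI)
    fix v w assume vw: "v \<in> carrier V" "w \<in> carrier V"
      and eq: "h (coordinate K V e v) \<odot>\<^bsub>V'\<^esub> e' = h (coordinate K V e w) \<odot>\<^bsub>V'\<^esub> e'"
    have "h (coordinate K V e v) = h (coordinate K V e w)"
      using arg_cong[OF eq, of "coordinate L V' e'"] co vw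
      by (simp add: L.coordinate_unique[OF V' e'])
    moreover have "inj_on h (carrier K)" by (rule hom_fields_inj) fact+
    ultimately have "coordinate K V e v = coordinate K V e w"
      using co vw by (auto dest: inj_onD)
    then show "v = w" using K.coordinate_smult[OF V e] vw by metis
  qed
  show ?thesis
    unfolding line_map_def
    using inj co e' K.coordinate_linear(1)[OF V e _ _ K.zero_closed] K.coordinate_linear(2)[OF V e]
    by (auto simp: V'.smult_l_distr V'.smult_assoc1)
qed

definition frame_image :: "nat \<Rightarrow> (nat \<Rightarrow> 'v \<Rightarrow> 'w) \<Rightarrow> (nat \<Rightarrow> 'v) \<Rightarrow> nat \<Rightarrow> 'w" where
  "frame_image r \<sigma> e = (\<lambda>i\<in>{..<r}. \<sigma> i (e i))"

text \<open>The image of a frame under line maps is a frame again and the maps are equivariant along \<open>h\<close>, so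
  images in tensor powers can be tested at one frame (\<open>tensor_image_iff\<close>).\<close>

locale line_families_over =
  A: line_family K r V + B: line_family L r V'
  for K :: "'k ring" and L :: "'l ring" and r :: nat
    and V :: "nat \<Rightarrow> ('k, 'k) module" and V' :: "nat \<Rightarrow> ('l, 'l) module" +
  fixes h :: "'k \<Rightarrow> 'l"
  assumes hom: "h \<in> ring_hom K L"
begin

lemma h_unit: "u \<in> {..<r} \<rightarrow> Units K \<Longrightarrow> (\<lambda>i. h (u i)) \<in> {..<r} \<rightarrow> Units L"
  using hom_units(1)[OF A.field_axioms B.field_axioms hom] by auto

lemma h_torus_char:
  "u \<in> {..<r} \<rightarrow> Units K \<Longrightarrow> h (torus_char K r u f) = torus_char L r (\<lambda>i. h (u i)) f"
  by (rule hom_torus_char[OF A.field_axioms B.field_axioms hom])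

lemma frame_image_closed:
  assumes "\<forall>i<r. line_map h K (V i) (V' i) (\<sigma> i)" "e \<in> frames r V"
  shows "frame_image r \<sigma> e \<in> frames r V'"
  unfolding frames_def frame_image_def
  using line_map_nonzero[OF A.field_axioms B.field_axioms hom A.lines B.lines _ A.frame_nth[OF assms(2)]]
    assms(1) by auto

lemma frame_image_scale:
  assumes "\<forall>i<r. line_map h K (V i) (V' i) (\<sigma> i)" "e \<in> frames r V" "u \<in> {..<r} \<rightarrow> Units K"
  shows "frame_image r \<sigma> (scale_frame r V u e) = scale_frame r V' (\<lambda>i. h (u i)) (frame_image r \<sigma> e)"
proof
  fix i
  show "frame_image r \<sigma> (scale_frame r V u e) i =
      scale_frame r V' (\<lambda>i. h (u i)) (frame_image r \<sigma> e) i"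
    using assms(1,3) A.frame_nth(1)[OF assms(2)]
    by (cases "i < r") (auto simp: frame_image_def scale_frame_def line_map_def Pi_iff A.Units_closed)
qed

lemma tensor_image_iff:
  assumes \<sigma>: "\<forall>i<r. line_map h K (V i) (V' i) (\<sigma> i)" and e: "e \<in> frames r V"
    and x: "x \<in> carrier (tensor_power K r V f)" and x': "x' \<in> carrier (tensor_power L r V' f)"
  shows "tensor_image r h V \<sigma> x x' \<longleftrightarrow> x' (frame_image r \<sigma> e) = h (x e)"
proof
  show "tensor_image r h V \<sigma> x x' \<Longrightarrow> x' (frame_image r \<sigma> e) = h (x e)"
    using e by (simp add: tensor_image_def frame_image_def)
  assume eq: "x' (frame_image r \<sigma> e) = h (x e)"
  have "x' (frame_image r \<sigma> b) = h (x b)" if b: "b \<in> frames r V" for b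
  proof -
    obtain u where u: "u \<in> {..<r} \<rightarrow> Units K" "scale_frame r V u e = b"
      using A.frame_ratio[OF e b] by blast
    have "x' (frame_image r \<sigma> b) =
        torus_char L r (\<lambda>i. h (u i)) (\<lambda>i. - f i) \<otimes>\<^bsub>L\<^esub> x' (frame_image r \<sigma> e)"
      unfolding u(2)[symmetric] frame_image_scale[OF \<sigma> e u(1)]
      by (rule B.tensor_power_scale[OF x' frame_image_closed[OF \<sigma> e] h_unit[OF u(1)]])
    also have "\<dots> = h (torus_char K r u (\<lambda>i. - f i) \<otimes>\<^bsub>K\<^esub> x e)"
      unfolding eq h_torus_char[OF u(1), symmetric]
      using u(1) A.tensor_power_closed[OF x e] by (simp add: ring_hom_mult[OF hom] A.torus_char_closed)
    also have "\<dots> = h (x b)" using A.tensor_power_scale[OF x e u(1)] u(2) by simp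
    finally show ?thesis .
  qed
  then show "tensor_image r h V \<sigma> x x'" by (simp add: tensor_image_def frame_image_def)
qed

lemma line_maps_exist:
  assumes e: "e \<in> frames r V" and e': "e' \<in> frames r V'"
  obtains \<sigma> where "\<forall>i<r. line_map h K (V i) (V' i) (\<sigma> i)" "frame_image r \<sigma> e = e'"
proof -
  define \<sigma> where "\<sigma> i v = h (coordinate K (V i) (e i) v) \<odot>\<^bsub>V' i\<^esub> e' i" for i v
  have "line_map h K (V i) (V' i) (\<sigma> i)" if "i < r" for i
    unfolding \<sigma>_def
    by (rule line_mapI[OF A.field_axioms B.field_axioms hom A.lines[OF that] B.lines[OF that]])
      (use A.frame_nth[OF e that] B.frame_nth[OF e' that] in auto)
  moreover have "frame_image r \<sigma> e = e'"
  proof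
    fix i show "frame_image r \<sigma> e i = e' i"
    proof (cases "i < r")
      case True
      interpret M: module K "V i" by (rule A.line_module[OF A.lines[OF True]])
      interpret M': module L "V' i" by (rule B.line_module[OF B.lines[OF True]])
      have "coordinate K (V i) (e i) (e i) = \<one>\<^bsub>K\<^esub>"
        using A.coordinate_unique[OF A.lines[OF True] A.frame_nth[OF e True], of "\<one>\<^bsub>K\<^esub>"]
          A.frame_nth[OF e True] by simp
      then show ?thesis
        using True B.frame_nth[OF e' True]
        by (simp add: frame_image_def \<sigma>_def ring_hom_one[OF hom])
    qed (simp add: frame_image_def B.frame_undefined[OF e'])
  qed
  ultimately show ?thesis using that by blast
qed

text \<open>Families of line maps correspond to the frames that are images of \<open>e\<close>, hence to the points \<open>c\<close> of
  the torus that move \<open>e'\<close> to such an image.\<close>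

lemma X_arrow_iff:
  assumes a: "\<And>t. a t \<in> carrier (tensor_power K r V (\<phi> t))"
    and a': "\<And>t. a' t \<in> carrier (tensor_power L r V' (\<phi> t))"
    and e: "e \<in> frames r V" and e': "e' \<in> frames r V'"
  shows "X_arrow r h K L (V, a) (V', a') \<longleftrightarrow>
    (\<exists>c\<in>{..<r} \<rightarrow> Units L. \<forall>t. h (a t e) = torus_char L r c (\<lambda>i. - \<phi> t i) \<otimes>\<^bsub>L\<^esub> a' t e')"
    (is "?l \<longleftrightarrow> ?r")
proof
  assume ?l
  then obtain \<sigma> where \<sigma>: "\<forall>i<r. line_map h K (V i) (V' i) (\<sigma> i)"
    and im: "\<And>t. tensor_image r h V \<sigma> (a t) (a' t)"
    unfolding X_arrow_def by blast
  obtain c where c: "c \<in> {..<r} \<rightarrow> Units L" "scale_frame r V' c e' = frame_image r \<sigma> e"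
    using B.frame_ratio[OF e' frame_image_closed[OF \<sigma> e]] by blast
  have "h (a t e) = torus_char L r c (\<lambda>i. - \<phi> t i) \<otimes>\<^bsub>L\<^esub> a' t e'" for t
    using im[of t] B.tensor_power_scale[OF a' e' c(1)] unfolding tensor_image_iff[OF \<sigma> e a a'] c(2) by simp
  with c(1) show ?r by blast
next
  assume ?r
  then obtain c where c: "c \<in> {..<r} \<rightarrow> Units L"
    and eq: "\<And>t. h (a t e) = torus_char L r c (\<lambda>i. - \<phi> t i) \<otimes>\<^bsub>L\<^esub> a' t e'" by blast
  obtain \<sigma> where \<sigma>: "\<forall>i<r. line_map h K (V i) (V' i) (\<sigma> i)" "frame_image r \<sigma> e = scale_frame r V' c e'"
    by (rule line_maps_exist[OF e B.scale_frame_closed[OF c e']])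
  have "tensor_image r h V \<sigma> (a t) (a' t)" for t
    unfolding tensor_image_iff[OF \<sigma>(1) e a a'] \<sigma>(2) eq by (rule B.tensor_power_scale[OF a' e' c])
  with \<sigma>(1) show ?l unfolding X_arrow_def by blast
qed

end

section \<open>Trivial lines\<close>

lemma trivial_line_line: 
  assumes "field K"
  shows "line K (trivial_line K)"
proof -
  interpret K: base_field K using assms by (simp add: base_field_def)
  have "module K (trivial_line K)"
    by (rule moduleI)
      (auto simp: trivial_line_def K.is_cring K.l_distr K.r_distr K.m_assoc K.a_ac
        intro!: abelian_groupI bexI[of _ "\<ominus>\<^bsub>K\<^esub> x" for x] K.l_neg)
  moreover have "\<exists>e\<in>carrier (trivial_line K). \<forall>v\<in>carrier (trivial_line K).
      \<exists>!c. c \<in> carrier K \<and> v = c \<odot>\<^bsub>trivial_line K\<^esub> e"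
    by (rule bexI[of _ "\<one>\<^bsub>K\<^esub>"]) (auto simp: trivial_line_def)
  ultimately show ?thesis by (simp add: line_def)
qed

lemma (in base_field) trivial_line_family: "line_family K r (\<lambda>i. trivial_line K)"
  by unfold_locales (rule trivial_line_line[OF field_axioms])

definition unit_frame :: "'k ring \<Rightarrow> nat \<Rightarrow> nat \<Rightarrow> 'k" where
  "unit_frame K r = (\<lambda>i\<in>{..<r}. \<one>\<^bsub>K\<^esub>)"

context base_field
begin

lemma frames_trivial: "frames r (\<lambda>i. trivial_line K) = {..<r} \<rightarrow>\<^sub>E Units K"
  by (simp add: frames_def trivial_line_def field_Units)

lemma unit_frame: "unit_frame K r \<in> frames r (\<lambda>i. trivial_line K)"
  by (simp add: frames_trivial unit_frame_def)

lemma scale_trivial: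
  "scale_frame r (\<lambda>i. trivial_line K) u e = (\<lambda>i\<in>{..<r}. u i \<otimes> e i)"
  by (simp add: scale_frame_def trivial_line_def)

text \<open>The element of the tensor power whose coordinate in the frame \<open>(1, \<dots>, 1)\<close> is \<open>c\<close>.\<close>

definition trivial_section :: "nat \<Rightarrow> (nat \<Rightarrow> int) \<Rightarrow> 'k \<Rightarrow> (nat \<Rightarrow> 'k) \<Rightarrow> 'k" where
  "trivial_section r f c =
    (\<lambda>e\<in>frames r (\<lambda>i. trivial_line K). c \<otimes> torus_char K r e (\<lambda>i. - f i))"

lemma trivial_section_closed:
  assumes "c \<in> carrier K"
  shows "trivial_section r f c \<in> carrier (tensor_power K r (\<lambda>i. trivial_line K) f)"
proof -
  interpret T: line_family K r "\<lambda>i. trivial_line K" by (rule trivial_line_family)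
  show ?thesis
    unfolding T.tensor_power_iff
  proof (intro conjI ballI)
    show "trivial_section r f c \<in> frames r (\<lambda>i. trivial_line K) \<rightarrow>\<^sub>E carrier K"
      using assms unfolding trivial_section_def frames_trivial by (auto intro!: m_closed torus_char_closed)
    fix e u assume e: "e \<in> frames r (\<lambda>i. trivial_line K)" and u: "u \<in> {..<r} \<rightarrow> Units K"
    have e': "e \<in> {..<r} \<rightarrow> Units K" using e by (auto simp: frames_trivial)
    have "torus_char K r (scale_frame r (\<lambda>i. trivial_line K) u e) (\<lambda>i. - f i) =
        torus_char K r (\<lambda>i. u i \<otimes> e i) (\<lambda>i. - f i)"
      unfolding scale_trivial by (rule torus_char_cong) (use u e' in auto)
    also have "\<dots> = torus_char K r u (\<lambda>i. - f i) \<otimes> torus_char K r e (\<lambda>i. - f i)"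
      by (rule torus_char_mult[OF u e'])
    finally show "trivial_section r f c (scale_frame r (\<lambda>i. trivial_line K) u e) =
        torus_char K r u (\<lambda>i. - f i) \<otimes> trivial_section r f c e"
      using e u e' assms T.scale_frame_closed[OF u e]
      by (simp add: trivial_section_def torus_char_closed m_lcomm)
  qed
qed

lemma trivial_section_unit:
  assumes "c \<in> carrier K"
  shows "trivial_section r f c (unit_frame K r) = c"
proof -
  have "torus_char K r (unit_frame K r) (\<lambda>i. - f i) = torus_char K r (\<lambda>i. \<one>) (\<lambda>i. - f i)"
    by (rule torus_char_cong) (auto simp: unit_frame_def)
  then show ?thesis using unit_frame assms by (simp add: trivial_section_def)
qed

lemma trivial_X_obj_eq:
  "trivial_X_obj r \<phi> K a = (\<lambda>i. trivial_line K, \<lambda>t. trivial_section r (\<phi> t) (a t))"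
  by (simp add: trivial_X_obj_def trivial_section_def torus_char_def)

end

section \<open>Homomorphisms from monoid rings\<close>

lemma poly_mapping_single_induct [case_names zero single add]:
  fixes p :: "'m \<Rightarrow>\<^sub>0 int"
  assumes "P 0" "\<And>t c. P (Poly_Mapping.single t c)" "\<And>p q. P p \<Longrightarrow> P q \<Longrightarrow> P (p + q)"
  shows "P p"
proof (induction p rule: update_induct)
  case const
  show ?case by (rule assms(1))
next
  case (update p t c)
  have "Poly_Mapping.update t c p = p + Poly_Mapping.single t c"
    using update(1)
    by (intro poly_mapping_eqI)
      (auto simp: lookup_update lookup_add lookup_single in_keys_iff when_def)
  then show ?case using assms(2,3) update by simp
qed

lemma to_int_monoid_eq_iff: "to_int_monoid s = to_int_monoid t \<longleftrightarrow> of_monoid s = of_monoid t"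
  by transfer simp

lemma to_int_monoid_surj: obtains t where "x = to_int_monoid t"
  by (atomize_elim, transfer) auto

lemma to_int_monoid_add: "to_int_monoid (s + t) = to_int_monoid s + to_int_monoid t"
  by transfer (rule of_monoid_add)

lemma to_int_monoid_0: "to_int_monoid 0 = 0"
  by transfer (rule of_monoid_0)

text \<open>The maps on \<open>T\<^sub>+\<close> that factor through \<open>T\<^sub>+\<^sup>i\<^sup>n\<^sup>t\<close>.\<close>

definition respects_int :: "('t::comm_monoid_add \<Rightarrow> 'k) \<Rightarrow> bool" where
  "respects_int \<alpha> \<longleftrightarrow> (\<forall>s t. of_monoid s = of_monoid t \<longrightarrow> \<alpha> s = \<alpha> t)"

lemma respects_intD: "respects_int \<alpha> \<Longrightarrow> of_monoid s = of_monoid t \<Longrightarrow> \<alpha> s = \<alpha> t"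
  unfolding respects_int_def by blast

text \<open>The homomorphism \<open>\<int>[M] \<rightarrow> K\<close> that extends a monoid map \<open>\<alpha> : M \<rightarrow> (K, \<cdot>)\<close>.\<close>

definition monoid_ring_eval :: "'k ring \<Rightarrow> ('m \<Rightarrow> 'k) \<Rightarrow> ('m \<Rightarrow>\<^sub>0 int) \<Rightarrow> 'k" where
  "monoid_ring_eval K \<alpha> p =
    (\<Oplus>\<^bsub>K\<^esub>t\<in>Poly_Mapping.keys p. [Poly_Mapping.lookup p t] \<cdot>\<^bsub>K\<^esub> \<alpha> t)"

lemma frame_point_eq: "frame_point K a e p = monoid_ring_eval K (\<lambda>t. a t e) p"
  by (simp add: frame_point_def monoid_ring_eval_def)

context base_field
begin

lemma monoid_ring_eval_superset:
  assumes "\<And>t. \<alpha> t \<in> carrier K" "finite S" "Poly_Mapping.keys p \<subseteq> S"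
  shows "monoid_ring_eval K \<alpha> p = (\<Oplus>t\<in>S. [Poly_Mapping.lookup p t] \<cdot>\<^bsub>K\<^esub> \<alpha> t)"
proof -
  have "[(0::int)] \<cdot>\<^bsub>K\<^esub> x = \<zero>" for x by (simp add: add_pow_def)
  then show ?thesis
    unfolding monoid_ring_eval_def
    by (intro add.finprod_mono_neutral_cong_left) (use assms in \<open>auto simp: in_keys_iff\<close>)
qed

lemma monoid_ring_eval_closed:
  assumes "\<And>t. \<alpha> t \<in> carrier K"
  shows "monoid_ring_eval K \<alpha> p \<in> carrier K"
  unfolding monoid_ring_eval_def by (intro finsum_closed) (use assms in auto)

lemma monoid_ring_eval_add:
  assumes "\<And>t. \<alpha> t \<in> carrier K"
  shows "monoid_ring_eval K \<alpha> (p + q) = monoid_ring_eval K \<alpha> p \<oplus> monoid_ring_eval K \<alpha> q"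
proof -
  let ?S = "Poly_Mapping.keys p \<union> Poly_Mapping.keys q"
  have "monoid_ring_eval K \<alpha> (p + q) = (\<Oplus>t\<in>?S. [Poly_Mapping.lookup (p + q) t] \<cdot>\<^bsub>K\<^esub> \<alpha> t)"
    by (rule monoid_ring_eval_superset[OF assms]) (auto dest: subsetD[OF Poly_Mapping.keys_add])
  also have "\<dots> = (\<Oplus>t\<in>?S. [Poly_Mapping.lookup p t] \<cdot>\<^bsub>K\<^esub> \<alpha> t \<oplus> [Poly_Mapping.lookup q t] \<cdot>\<^bsub>K\<^esub> \<alpha> t)"
    by (rule add.finprod_cong') (use assms in \<open>auto simp: lookup_add add.int_pow_mult\<close>)
  also have "\<dots> = (\<Oplus>t\<in>?S. [Poly_Mapping.lookup p t] \<cdot>\<^bsub>K\<^esub> \<alpha> t) \<oplus> (\<Oplus>t\<in>?S. [Poly_Mapping.lookup q t] \<cdot>\<^bsub>K\<^esub> \<alpha> t)"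
    by (rule add.finprod_multf) (use assms in auto)
  also have "\<dots> = monoid_ring_eval K \<alpha> p \<oplus> monoid_ring_eval K \<alpha> q"
    using monoid_ring_eval_superset[OF assms, of ?S p] monoid_ring_eval_superset[OF assms, of ?S q] by simp
  finally show ?thesis .
qed

lemma monoid_ring_eval_zero [simp]: "monoid_ring_eval K \<alpha> 0 = \<zero>"
  by (simp add: monoid_ring_eval_def)

lemma monoid_ring_eval_single:
  assumes "\<And>t. \<alpha> t \<in> carrier K"
  shows "monoid_ring_eval K \<alpha> (Poly_Mapping.single t c) = [c] \<cdot>\<^bsub>K\<^esub> \<alpha> t"
  using monoid_ring_eval_superset[OF assms, of "{t}" "Poly_Mapping.single t c"] assms
  by (simp add: lookup_single)

lemma mult_monoid_map_closed: "mult_monoid_map \<alpha> K \<Longrightarrow> \<alpha> t \<in> carrier K"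
  by (simp add: mult_monoid_map_def)

text \<open>Both sides are biadditive in \<open>p\<close> and \<open>q\<close>, so it suffices to compare them on monomials.\<close>

lemma monoid_ring_eval_mult:
  assumes "mult_monoid_map \<alpha> K"
  shows "monoid_ring_eval K \<alpha> (p * q) = monoid_ring_eval K \<alpha> p \<otimes> monoid_ring_eval K \<alpha> q"
proof -
  note c = mult_monoid_map_closed[OF assms]
  note ev = monoid_ring_eval_closed[OF c]
  show ?thesis
  proof (induction p rule: poly_mapping_single_induct)
    case zero
    show ?case by (simp add: ev)
  next
    case (add p p')
    then show ?case by (simp add: ring_distribs(2) monoid_ring_eval_add[OF c] ev l_distr)
  next
    case (single t x)
    show ?case
    proof (induction q rule: poly_mapping_single_induct)
      case zero
      show ?case by (simp add: ev)
    next
      case (add q q')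
      then show ?case by (simp add: ring_distribs(1) monoid_ring_eval_add[OF c] ev r_distr)
    next
      case (single s y)
      have "\<alpha> (t + s) = \<alpha> t \<otimes> \<alpha> s" using assms by (simp add: mult_monoid_map_def)
      then have "[(x * y)] \<cdot>\<^bsub>K\<^esub> \<alpha> (t + s) = ([x] \<cdot>\<^bsub>K\<^esub> \<alpha> t) \<otimes> ([y] \<cdot>\<^bsub>K\<^esub> \<alpha> s)"
        using c[of t] c[of s]
        by (simp add: add_pow_ldistr_int add_pow_rdistr_int add.int_pow_pow mult.commute)
      then show ?case by (simp add: mult_single monoid_ring_eval_single[OF c])
    qed
  qed
qed

lemma monoid_ring_eval_map:
  fixes f :: "'m \<Rightarrow> 'n"
  assumes "\<And>t. \<beta> t \<in> carrier K"
  shows "monoid_ring_eval K \<beta> (monoid_ring_map f p) = monoid_ring_eval K (\<lambda>t. \<beta> (f t)) p"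
proof -
  have sum: "monoid_ring_eval K \<beta> (\<Sum>t\<in>S. g t) = (\<Oplus>t\<in>S. monoid_ring_eval K \<beta> (g t))"
    if "finite S" for S and g :: "'m \<Rightarrow> 'n \<Rightarrow>\<^sub>0 int"
    using that
    by (induction S) (auto simp: monoid_ring_eval_add[OF assms] monoid_ring_eval_closed[OF assms])
  show ?thesis
    unfolding monoid_ring_map_def sum[OF finite_keys] monoid_ring_eval_single[OF assms]
    by (simp add: monoid_ring_eval_def)
qed

lemma monoid_ring_eval_hom:
  assumes "mult_monoid_map \<beta> K"
  shows "monoid_ring_eval K \<beta> \<in> ring_hom ring_of_type_algebra K"
proof (rule ring_hom_memI)
  note c = mult_monoid_map_closed[OF assms]
  have "monoid_ring_eval K \<beta> (Poly_Mapping.single 0 1) = \<one>"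
    using assms unfolding monoid_ring_eval_single[OF c] by (simp add: mult_monoid_map_def)
  then show "monoid_ring_eval K \<beta> \<one>\<^bsub>ring_of_type_algebra\<^esub> = \<one>"
    by (simp add: ring_of_type_algebra_def)
qed (use assms mult_monoid_map_closed[OF assms] in
    \<open>auto simp: ring_of_type_algebra_def monoid_ring_eval_closed monoid_ring_eval_add monoid_ring_eval_mult\<close>)

text \<open>A homomorphism on \<open>\<int>[T\<^sub>+]\<close> is determined by its values on monomials, and \<open>\<int>[T\<^sub>+] \<rightarrow> \<int>[T\<^sub>+\<^sup>i\<^sup>n\<^sup>t]\<close>
  is induced by a surjection of monoids: it factors iff the map on monomials factors.\<close>

lemma factors_through_int_monoid_iff:
  fixes \<alpha> :: "'t::comm_monoid_add \<Rightarrow> 'k"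
  assumes \<alpha>: "mult_monoid_map \<alpha> K"
  shows "(\<exists>g\<in>ring_hom (ring_of_type_algebra :: ('t int_monoid \<Rightarrow>\<^sub>0 int) ring) K.
      \<forall>p. monoid_ring_eval K \<alpha> p = g (monoid_ring_map to_int_monoid p)) \<longleftrightarrow> respects_int \<alpha>"
    (is "?l \<longleftrightarrow> ?r")
proof
  note c = mult_monoid_map_closed[OF \<alpha>]
  assume ?l
  then obtain g where g: "\<And>p. monoid_ring_eval K \<alpha> p = g (monoid_ring_map to_int_monoid p)" by blast
  have "\<alpha> t = g (Poly_Mapping.single (to_int_monoid t) 1)" for t
    using g[of "Poly_Mapping.single t 1"] c[of t]
    by (simp add: monoid_ring_eval_single[OF c] monoid_ring_map_def)
  then show ?r unfolding respects_int_def using to_int_monoid_eq_iff by metis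
next
  assume r: ?r
  define \<beta> where "\<beta> x = \<alpha> (SOME t. x = to_int_monoid t)" for x
  have \<beta>: "\<beta> (to_int_monoid t) = \<alpha> t" for t
  proof -
    have "to_int_monoid t = to_int_monoid (SOME s. to_int_monoid t = to_int_monoid s)"
      by (rule someI) (rule refl)
    then show ?thesis unfolding \<beta>_def to_int_monoid_eq_iff by (rule respects_intD[OF r, symmetric])
  qed
  have "mult_monoid_map \<beta> K"
    unfolding mult_monoid_map_def
  proof (intro conjI allI)
    show "\<beta> x \<in> carrier K" for x unfolding \<beta>_def by (rule mult_monoid_map_closed[OF \<alpha>])
    show "\<beta> 0 = \<one>" using \<beta>[of 0] \<alpha> by (simp add: to_int_monoid_0 mult_monoid_map_def)
    fix x y :: "'t int_monoid"
    obtain s t where "x = to_int_monoid s" "y = to_int_monoid t" using to_int_monoid_surj by metis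
    then show "\<beta> (x + y) = \<beta> x \<otimes> \<beta> y"
      using \<alpha> by (simp add: \<beta> mult_monoid_map_def flip: to_int_monoid_add)
  qed
  from monoid_ring_eval_hom[OF this] show ?l
    by (rule bexI[rotated])
      (simp add: monoid_ring_eval_map[OF mult_monoid_map_closed[OF \<open>mult_monoid_map \<beta> K\<close>]] \<beta>)
qed

end

lemma int_monoid_int_map:
  assumes "monoid_map (f :: 't::comm_monoid_add \<Rightarrow> 'a::cancel_comm_monoid_add)" "of_monoid s = of_monoid t"
  shows "f s = f t"
  using assms by (auto simp: of_monoid_eq_iff monoid_map_def) (metis add_right_cancel)

section \<open>Objects in coordinates\<close>

locale graded_field = base_field K for K :: "'k ring" (structure) +
  fixes r :: nat and \<phi> :: "'t::comm_monoid_add \<Rightarrow> nat \<Rightarrow> int"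
  assumes phi: "i < r \<Longrightarrow> monoid_map (\<lambda>t. \<phi> t i)"
begin

lemma phi_0: "i < r \<Longrightarrow> \<phi> 0 i = 0" and phi_add: "i < r \<Longrightarrow> \<phi> (s + t) i = \<phi> s i + \<phi> t i"
  using phi by (auto simp: monoid_map_def)

lemma phi_eq: "of_monoid s = of_monoid t \<Longrightarrow> i < r \<Longrightarrow> \<phi> s i = \<phi> t i"
  using int_monoid_int_map[OF phi] by blast

lemma X_ob_lines: "(V, a) \<in> X_ob r \<phi> K \<Longrightarrow> line_family K r V"
  by unfold_locales (simp add: X_ob_def)

lemma X_ob_section: "(V, a) \<in> X_ob r \<phi> K \<Longrightarrow> a t \<in> carrier (tensor_power K r V (\<phi> t))"
  by (simp add: X_ob_def)

lemma X_ob_coordinates: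
  assumes "(V, a) \<in> X_ob r \<phi> K" "e \<in> frames r V"
  shows "mult_monoid_map (\<lambda>t. a t e) K"
proof -
  interpret V: line_family K r V by (rule X_ob_lines) fact
  show ?thesis
    using assms V.tensor_power_closed[OF X_ob_section[OF assms(1)] assms(2)]
    by (auto simp: X_ob_def mult_monoid_map_def)
qed

lemma torus_char_phi_0:
  "torus_char K r u (\<lambda>i. - \<phi> 0 i) = \<one>" if "u \<in> {..<r} \<rightarrow> Units K"
  using torus_char_cong[OF that, of u "\<lambda>i. - \<phi> 0 i" "\<lambda>i. 0"] phi_0 by simp

lemma torus_char_phi_add:
  assumes "u \<in> {..<r} \<rightarrow> Units K"
  shows "torus_char K r u (\<lambda>i. - \<phi> (s + t) i) =
    torus_char K r u (\<lambda>i. - \<phi> s i) \<otimes> torus_char K r u (\<lambda>i. - \<phi> t i)"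
  using torus_char_cong[OF assms, of u "\<lambda>i. - \<phi> (s + t) i" "\<lambda>i. - \<phi> s i + - \<phi> t i"] phi_add
    torus_char_add[OF assms, of "\<lambda>i. - \<phi> s i" "\<lambda>i. - \<phi> t i"] by simp

text \<open>Elements with the same image in \<open>T\<close> have the same degree, so their sections lie in the same tensor
  power and can be compared at one frame.\<close>

lemma Z_ob_iff:
  "(V, a) \<in> Z_ob r \<phi> K \<longleftrightarrow>
    (V, a) \<in> X_ob r \<phi> K \<and> respects_int a"
proof (cases "(V, a) \<in> X_ob r \<phi> K")
  case True
  interpret V: line_family K r V by (rule X_ob_lines) fact
  have "(V, a) \<in> Z_ob r \<phi> K \<longleftrightarrow> (\<forall>e\<in>frames r V. respects_int (\<lambda>t. a t e))"
    using True factors_through_int_monoid_iff[OF X_ob_coordinates[OF True]]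
    unfolding Z_ob_def frame_point_eq by simp
  also have "\<dots> \<longleftrightarrow> respects_int a"
  proof
    assume eq: "\<forall>e\<in>frames r V. respects_int (\<lambda>t. a t e)"
    obtain e where e: "e \<in> frames r V" by (rule V.frames_nonempty)
    show "respects_int a"
      unfolding respects_int_def
    proof (intro allI impI)
      fix s t :: 't assume st: "of_monoid s = of_monoid t"
      have "carrier (V.tp (\<phi> s)) = carrier (V.tp (\<phi> t))"
        by (rule V.tensor_power_cong) (rule phi_eq[OF st])
      then show "a s = a t"
        using X_ob_section[OF True, of s] X_ob_section[OF True, of t] respects_intD[OF bspec[OF eq e] st]
        by (intro V.tensor_power_eqI[OF _ _ e]) (simp_all only:)
    qed
  qed (metis respects_int_def)
  finally show ?thesis using True by blast
qed (auto simp: Z_ob_def)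

lemma trivial_X_ob:
  assumes \<alpha>: "mult_monoid_map \<alpha> K"
  shows "trivial_X_obj r \<phi> K \<alpha> \<in> X_ob r \<phi> K"
proof -
  interpret T: line_family K r "\<lambda>i. trivial_line K" by (rule trivial_line_family)
  note c = mult_monoid_map_closed[OF \<alpha>]
  have "trivial_section r (\<phi> 0) (\<alpha> 0) = tensor_one K r (\<lambda>i. trivial_line K)"
    using \<alpha> torus_char_phi_0
    by (auto simp: trivial_section_def tensor_one_def frames_trivial mult_monoid_map_def fun_eq_iff restrict_def PiE_def)
  moreover have "trivial_section r (\<phi> (s + t)) (\<alpha> (s + t)) = tensor_mult K r (\<lambda>i. trivial_line K)
      (trivial_section r (\<phi> s) (\<alpha> s)) (trivial_section r (\<phi> t) (\<alpha> t))" for s t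
  proof -
    have "\<alpha> (s + t) = \<alpha> s \<otimes> \<alpha> t" using \<alpha> by (simp add: mult_monoid_map_def)
    then show ?thesis
      using c[of s] c[of t] torus_char_closed
      by (auto simp: trivial_section_def tensor_mult_def frames_trivial fun_eq_iff restrict_def PiE_def
          torus_char_phi_add m_ac)
  qed
  ultimately show ?thesis
    unfolding trivial_X_obj_eq X_ob_def
    using T.lines trivial_section_closed[OF c] by auto
qed

lemma trivial_Z_ob_iff:
  assumes \<alpha>: "mult_monoid_map \<alpha> K"
  shows "trivial_X_obj r \<phi> K \<alpha> \<in> Z_ob r \<phi> K \<longleftrightarrow> respects_int \<alpha>"
    (is "?l \<longleftrightarrow> ?r")
proof -
  note c = mult_monoid_map_closed[OF \<alpha>]
  have "?l \<longleftrightarrow> respects_int (\<lambda>t. trivial_section r (\<phi> t) (\<alpha> t))"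
    using trivial_X_ob[OF \<alpha>] unfolding trivial_X_obj_eq Z_ob_iff by simp
  also have "\<dots> \<longleftrightarrow> ?r"
  proof
    assume l: "respects_int (\<lambda>t. trivial_section r (\<phi> t) (\<alpha> t))"
    have "\<alpha> s = \<alpha> t" if "of_monoid s = of_monoid t" for s t
      using fun_cong[OF respects_intD[OF l that], of "unit_frame K r"] c by (simp add: trivial_section_unit)
    then show ?r unfolding respects_int_def by blast
  next
    assume r: ?r
    have "trivial_section r (\<phi> s) (\<alpha> s) = trivial_section r (\<phi> t) (\<alpha> t)"
      if st: "of_monoid s = of_monoid t" for s t
    proof -
      have "torus_char K r e (\<lambda>i. - \<phi> s i) = torus_char K r e (\<lambda>i. - \<phi> t i)"
        if "e \<in> {..<r} \<rightarrow>\<^sub>E Units K" for e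
        by (rule torus_char_cong) (use that phi_eq[OF st] in auto)
      then show ?thesis
        using respects_intD[OF r st] by (auto simp: trivial_section_def frames_trivial fun_eq_iff restrict_def)
    qed
    then show "respects_int (\<lambda>t. trivial_section r (\<phi> t) (\<alpha> t))" unfolding respects_int_def by blast
  qed
  finally show ?thesis .
qed

end

text \<open>After a choice of frames an object is a monoid map and an arrow is a point of the torus.\<close>

lemma X_arrow_coordinates:
  assumes "graded_field K r \<phi>" "graded_field L r \<phi>" "h \<in> ring_hom K L"
    and x: "(V, a) \<in> X_ob r \<phi> K" and x': "(V', a') \<in> X_ob r \<phi> L"
    and e: "e \<in> frames r V" and e': "e' \<in> frames r V'"
  shows "X_arrow r h K L (V, a) (V', a') \<longleftrightarrow>
    (\<exists>c\<in>{..<r} \<rightarrow> Units L. \<forall>t. h (a t e) = torus_char L r c (\<lambda>i. - \<phi> t i) \<otimes>\<^bsub>L\<^esub> a' t e')"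
proof -
  interpret K: graded_field K r \<phi> by fact
  interpret L: graded_field L r \<phi> by fact
  interpret line_families_over K L r V V' h
    using K.X_ob_lines[OF x] L.X_ob_lines[OF x'] assms(3)
    by (simp add: line_families_over_def line_families_over_axioms_def)
  show ?thesis
    by (rule X_arrow_iff[OF K.X_ob_section[OF x] L.X_ob_section[OF x'] e e'])
qed

section \<open>Extension of characters\<close>

definition roots_exist :: "'k ring \<Rightarrow> bool" where
  "roots_exist K \<longleftrightarrow> (\<forall>n>0. \<forall>c\<in>carrier K. \<exists>b\<in>carrier K. b [^]\<^bsub>K\<^esub> (n::nat) = c)"

context base_field
begin

lemma torus_char_multiple:
  assumes u: "u \<in> {..<r} \<rightarrow> Units K"
  shows "torus_char K r u (\<lambda>i. m * f i) = torus_char K r u f [^] (m::int)"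
proof (induction m rule: int_induct[where k = 0])
  case base
  then show ?case by simp
next
  case (step1 m)
  have "torus_char K r u (\<lambda>i. (m + 1) * f i) = torus_char K r u (\<lambda>i. m * f i) \<otimes> torus_char K r u f"
    using torus_char_add[OF u, of "\<lambda>i. m * f i" f] by (simp add: algebra_simps)
  then show ?case
    using step1 units_int_pow_add[OF torus_char_unit[OF u], of f m 1] torus_char_closed[OF u, of f]
      int_pow_int[of K _ 1] by simp
next
  case (step2 m)
  have "torus_char K r u (\<lambda>i. (m - 1) * f i) = torus_char K r u (\<lambda>i. m * f i) \<otimes> inv (torus_char K r u f)"
    using torus_char_add[OF u, of "\<lambda>i. m * f i" "\<lambda>i. - f i"]
    by (simp add: algebra_simps torus_char_neg[OF u])
  moreover have "torus_char K r u f [^] (-1::int) = inv (torus_char K r u f)"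
    using units_int_pow_neg[OF torus_char_unit[OF u], of f 1] torus_char_closed[OF u, of f]
      int_pow_int[of K _ 1] by simp
  ultimately show ?case
    using step2 units_int_pow_add[OF torus_char_unit[OF u], of f m "-1"] by simp
qed

lemma torus_char_Suc:
  assumes "u \<in> {..<Suc r} \<rightarrow> Units K"
  shows "torus_char K (Suc r) u f = torus_char K r u f \<otimes> u r [^] f r"
proof -
  have u: "(\<lambda>i. u i [^] f i) \<in> {..<r} \<rightarrow> carrier K" "u r [^] f r \<in> carrier K" using assms by auto
  then show ?thesis
    unfolding torus_char_def lessThan_Suc by (simp add: finprod_insert m_comm finprod_closed)
qed

lemma character_extends_step:
  assumes diff: "\<And>v x w y. (v, x) \<in> S \<Longrightarrow> (w, y) \<in> S \<Longrightarrow> (\<lambda>i. v i - w i, x \<otimes> inv y) \<in> S"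
    and unit: "\<And>v x. (v, x) \<in> S \<Longrightarrow> x \<in> Units K"
    and vx: "(v, x) \<in> S" and wy: "(w, y) \<in> S"
  shows "(\<lambda>i. v i - m * w i, x \<otimes> y [^] (- m :: int)) \<in> S"
proof -
  have x: "x \<in> Units K" "x \<in> carrier K" and y: "y \<in> Units K" "y \<in> carrier K"
    using unit vx wy by auto
  have pow1: "y [^] (1::int) = y" using int_pow_int[of K y 1] y by simp
  have "(\<lambda>i. w i - w i, y \<otimes> inv y) \<in> S" by (rule diff[OF wy wy])
  then have "(\<lambda>i. 0 - w i, \<one> \<otimes> inv y) \<in> S" using diff[OF _ wy, of "\<lambda>i. w i - w i" "y \<otimes> inv y"] y by simp
  then have neg: "(\<lambda>i. - w i, inv y) \<in> S" using y by simp
  show ?thesis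
  proof (induction m rule: int_induct[where k = 0])
    case base
    show ?case using vx x by simp
  next
    case (step1 m)
    have "y [^] (- (m + 1)) = y [^] (- m) \<otimes> inv y"
      using units_int_pow_add[OF y(1), of "- m" "- 1"] units_int_pow_neg[OF y(1), of 1] pow1 by simp
    then show ?case using diff[OF step1(2) wy] x y by (simp add: algebra_simps m_assoc)
  next
    case (step2 m)
    have "y [^] (- (m - 1)) = y [^] (- m) \<otimes> y"
      using units_int_pow_add[OF y(1), of "- m" 1] pow1 by simp
    then show ?case using diff[OF step2(2) neg] x y by (simp add: algebra_simps m_assoc)
  qed
qed

text \<open>Characters are given by their graphs \<open>S \<subseteq> \<int>\<^sup>r \<times> K\<^sup>*\<close>. The proof is by induction on \<open>r\<close>. The
  elements of the domain with last coordinate \<open>0\<close> are covered by the induction hypothesis. If not all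
  have last coordinate \<open>0\<close>, choose \<open>w\<close> whose last coordinate \<open>d > 0\<close> is minimal; the domain is
  generated by \<open>w\<close> and the elements with last coordinate \<open>0\<close>, and the last component \<open>b\<close> of the
  point sought must satisfy \<open>b\<^sup>d = y / c\<^sup>w\<close>, where \<open>y\<close> is the value at \<open>w\<close>. This is where roots are needed.\<close>

lemma character_extends:
  assumes roots: "roots_exist K"
    and "\<And>v x w y. (v, x) \<in> S \<Longrightarrow> (w, y) \<in> S \<Longrightarrow> (\<lambda>i. v i - w i, x \<otimes> inv y) \<in> S"
    and "\<And>v x. (v, x) \<in> S \<Longrightarrow> x \<in> Units K"
    and "\<And>v x. (v, x) \<in> S \<Longrightarrow> (\<forall>i<r. v i = 0) \<Longrightarrow> x = \<one>"
  shows "\<exists>c\<in>{..<r} \<rightarrow> Units K. \<forall>(v, x)\<in>S. x = torus_char K r c v"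
  using assms(2-4)
proof (induction r arbitrary: S)
  case 0
  then have "x = torus_char K 0 (\<lambda>_. \<one>) v" if "(v, x) \<in> S" for v x
    using that by (simp add: torus_char_def)
  then show ?case by (intro bexI[of _ "\<lambda>_. \<one>"]) auto
next
  case (Suc r)
  note diff = Suc.prems(1) and unit = Suc.prems(2) and triv = Suc.prems(3)
  define S0 where "S0 = {(v, x) \<in> S. v r = 0}"
  have "\<exists>c\<in>{..<r} \<rightarrow> Units K. \<forall>(v, x)\<in>S0. x = torus_char K r c v"
  proof (rule Suc.IH)
    fix v x w y
    show "(v, x) \<in> S0 \<Longrightarrow> (w, y) \<in> S0 \<Longrightarrow> (\<lambda>i. v i - w i, x \<otimes> inv y) \<in> S0"
      using diff by (auto simp: S0_def)
    show "(v, x) \<in> S0 \<Longrightarrow> x \<in> Units K" using unit by (auto simp: S0_def)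
    show "(v, x) \<in> S0 \<Longrightarrow> \<forall>i<r. v i = 0 \<Longrightarrow> x = \<one>"
      using triv by (auto simp: S0_def less_Suc_eq)
  qed
  then obtain c where c: "c \<in> {..<r} \<rightarrow> Units K"
    and S0: "\<And>v x. (v, x) \<in> S \<Longrightarrow> v r = 0 \<Longrightarrow> x = torus_char K r c v"
    by (auto simp: S0_def)
  have upd: "c(r := b) \<in> {..<Suc r} \<rightarrow> Units K"
    "torus_char K (Suc r) (c(r := b)) v = torus_char K r c v \<otimes> b [^] v r" if b: "b \<in> Units K" for b v
  proof -
    show u: "c(r := b) \<in> {..<Suc r} \<rightarrow> Units K" using c b by (auto simp: less_Suc_eq)
    have "torus_char K r (c(r := b)) v = torus_char K r c v"
      by (rule torus_char_cong[symmetric]) (use c in auto)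
    then show "torus_char K (Suc r) (c(r := b)) v = torus_char K r c v \<otimes> b [^] v r"
      by (simp add: torus_char_Suc[OF u])
  qed
  show ?case
  proof (cases "\<forall>(v, x)\<in>S. v r = 0")
    case True
    have "\<forall>(v, x)\<in>S. x = torus_char K (Suc r) (c(r := \<one>)) v"
      using True S0 c unfolding upd(2)[OF Units_one_closed] by (fastforce simp: torus_char_closed)
    with upd(1)[OF Units_one_closed] show ?thesis by blast
  next
    case False
    then obtain v0 x0 where v0: "(v0, x0) \<in> S" "v0 r \<noteq> 0" by auto
    have "\<exists>d>0. \<exists>v x. (v, x) \<in> S \<and> v r = int d"
    proof (cases "v0 r > 0")
      case True
      then show ?thesis using v0 by (intro exI[of _ "nat (v0 r)"]) auto
    next
      case neg: False
      have "(\<lambda>i. v0 i - 2 * v0 i, x0 \<otimes> x0 [^] (- 2 :: int)) \<in> S"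
        by (rule character_extends_step[OF diff unit v0(1) v0(1)])
      then show ?thesis using v0 neg by (intro exI[of _ "nat (- v0 r)"]) auto
    qed
    define d where "d = (LEAST d. d > 0 \<and> (\<exists>v x. (v, x) \<in> S \<and> v r = int d))"
    have d: "d > 0 \<and> (\<exists>v x. (v, x) \<in> S \<and> v r = int d)"
      unfolding d_def by (rule LeastI_ex) fact
    have least: "d \<le> d'" if "d' > 0" "(v, x) \<in> S" "v r = int d'" for d' v x
      unfolding d_def by (rule Least_le) (use that in auto)
    from d obtain w y where wy: "(w, y) \<in> S" "w r = int d" by blast
    have y: "y \<in> Units K" by (rule unit[OF wy(1)])
    note cw = torus_char_unit[OF c, of w]
    obtain b where b: "b \<in> carrier K" "b [^] d = y \<otimes> inv (torus_char K r c w)"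
      using roots d y cw unfolding roots_exist_def by (metis Units_closed Units_inv_closed m_closed)
    have "b \<noteq> \<zero>"
    proof
      assume "b = \<zero>"
      then have "y \<otimes> inv (torus_char K r c w) = \<zero>" using b(2) d by (simp add: nat_pow_zero)
      moreover have "y \<otimes> inv (torus_char K r c w) \<in> Units K" using y cw by auto
      ultimately show False by (simp add: unit_iff)
    qed
    then have bU: "b \<in> Units K" using b(1) unit_iff by auto
    have "x = torus_char K (Suc r) (c(r := b)) v" if vx: "(v, x) \<in> S" for v x
    proof -
      define m where "m = v r div int d"
      have mem: "(\<lambda>i. v i - m * w i, x \<otimes> y [^] (- m)) \<in> S"
        by (rule character_extends_step[OF diff unit vx wy(1)])
      have mod: "v r - m * w r = v r mod int d"
        unfolding m_def wy(2) by (simp add: minus_div_mult_eq_mod)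
      have "v r mod int d = 0"
      proof (rule ccontr)
        assume "v r mod int d \<noteq> 0"
        then have "0 < nat (v r mod int d)" "nat (v r mod int d) < d"
          using d pos_mod_bound[of "int d" "v r"] pos_mod_sign[of "int d" "v r"] by linarith+
        with least[OF _ mem, of "nat (v r mod int d)"] mod show False by auto
      qed
      then have vr: "v r = m * int d" using mod wy(2) by simp
      have x: "x \<in> Units K" by (rule unit[OF vx])
      have "x \<otimes> y [^] (- m) = torus_char K r c (\<lambda>i. v i - m * w i)"
        by (rule S0[OF mem]) (simp add: vr wy(2))
      also have "\<dots> = torus_char K r c v \<otimes> torus_char K r c w [^] (- m)"
        using torus_char_add[OF c, of v "\<lambda>i. - m * w i"] torus_char_multiple[OF c, of "- m" w] by simp
      finally have eq: "x \<otimes> y [^] (- m) = torus_char K r c v \<otimes> torus_char K r c w [^] (- m)" .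
      have "b [^] v r = (b [^] int d) [^] m" using units_int_pow_pow[OF bU, of "int d" m]
        by (simp add: vr mult.commute)
      also have "\<dots> = (y \<otimes> inv (torus_char K r c w)) [^] m" by (simp add: int_pow_int b(2))
      also have "\<dots> = y [^] m \<otimes> inv (torus_char K r c w) [^] m"
        using y cw by (simp add: units_int_pow_distrib)
      also have "inv (torus_char K r c w) [^] m = torus_char K r c w [^] (- m)"
        using units_int_pow_pow[OF cw, of "- 1" m] units_int_pow_neg[OF cw, of 1] cw
          int_pow_int[of K "torus_char K r c w" 1] by (simp add: Units_closed)
      finally have bv: "b [^] v r = y [^] m \<otimes> torus_char K r c w [^] (- m)" .
      have "y [^] (- m) \<otimes> y [^] m = \<one>"
        using units_int_pow_add[OF y, of "- m" m] by simp
      then have "x = x \<otimes> (y [^] (- m) \<otimes> y [^] m)" using x by (simp add: Units_closed)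
      also have "\<dots> = x \<otimes> y [^] (- m) \<otimes> y [^] m" using x y by (simp add: m_assoc Units_closed)
      also have "\<dots> = torus_char K r c v \<otimes> b [^] v r"
        unfolding eq bv using torus_char_closed[OF c] y cw by (simp add: m_ac)
      also have "\<dots> = torus_char K (Suc r) (c(r := b)) v" by (rule upd(2)[OF bU, symmetric])
      finally show ?thesis .
    qed
    with upd(1)[OF bU] show ?thesis by blast
  qed
qed

end

section \<open>Functionals that vanish exactly on a face\<close>

definition dot :: "nat \<Rightarrow> (nat \<Rightarrow> int) \<Rightarrow> (nat \<Rightarrow> int) \<Rightarrow> int" where
  "dot n v w = (\<Sum>k<n. v k * w k)"

lemma dot_linear_left: "dot n (\<lambda>k. c * v k + d * v' k) w = c * dot n v w + d * dot n v' w"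
  by (simp add: dot_def sum_distrib_left sum.distrib algebra_simps)

lemma dot_linear_right: "dot n v (\<lambda>k. c * w k + d * w' k) = c * dot n v w + d * dot n v w'"
  by (simp add: dot_def sum_distrib_left sum.distrib algebra_simps)

text \<open>Farkas' lemma with integral coefficients. The proof is by induction on the number of forms. If \<open>a p\<close>
  cannot be dropped, there is an \<open>x\<close> at which the other forms are nonnegative and \<open>b\<close> and \<open>a p\<close> are
  negative. Projecting along \<open>x\<close> to the kernel of \<open>a p\<close> removes this form; multiplication by
  \<open>c = - a p(x)\<close> keeps the projection integral.\<close>

lemma integral_farkas:
  fixes a :: "'i \<Rightarrow> nat \<Rightarrow> int" and b :: "nat \<Rightarrow> int"
  assumes "finite I"
    and "\<And>w. (\<forall>i\<in>I. 0 \<le> dot n (a i) w) \<Longrightarrow> 0 \<le> dot n b w"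
  shows "\<exists>N>0. \<exists>l. (\<forall>i\<in>I. (0::int) \<le> l i) \<and> (\<forall>k<n. N * b k = (\<Sum>i\<in>I. l i * a i k))"
  using assms
proof (induction I arbitrary: a b rule: finite_induct)
  case empty
  have "0 \<le> dot n b (\<lambda>k. - b k)" by (rule empty) simp
  then have "(\<Sum>k<n. b k * b k) \<le> 0" by (simp add: dot_def sum_negf)
  moreover have "0 \<le> b k * b k" for k by simp
  ultimately have "\<forall>k<n. b k * b k = 0"
    using sum_nonneg_eq_0_iff[of "{..<n}" "\<lambda>k. b k * b k"] sum_nonneg[of "{..<n}" "\<lambda>k. b k * b k"]
    by force
  then show ?case by (intro exI[of _ 1]) auto
next
  case (insert p I)
  show ?case
  proof (cases "\<forall>w. (\<forall>i\<in>I. 0 \<le> dot n (a i) w) \<longrightarrow> 0 \<le> dot n b w")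
    case True
    then obtain N l where N: "N > 0" and l: "\<forall>i\<in>I. 0 \<le> l i"
      and eq: "\<forall>k<n. N * b k = (\<Sum>i\<in>I. l i * a i k)"
      using insert.IH[of a b] by blast
    have "(\<Sum>i\<in>insert p I. (l(p := 0)) i * a i k) = (\<Sum>i\<in>I. l i * a i k)" for k
      using insert.hyps by (auto intro!: sum.cong)
    then show ?thesis using N l eq by (intro exI[of _ N] conjI exI[of _ "l(p := 0)"]) auto
  next
    case False
    then obtain x where x: "\<forall>i\<in>I. 0 \<le> dot n (a i) x" "dot n b x < 0" by fastforce
    have px: "dot n (a p) x < 0"
      using insert.prems[of x] x by (cases "0 \<le> dot n (a p) x") auto
    define c where "c = - dot n (a p) x"
    have c: "c > 0" using px by (simp add: c_def)
    \<comment> \<open>The forms composed with \<open>c\<close> times the projection along \<open>x\<close> to the kernel of \<open>a p\<close>.\<close>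
    define a' where "a' i k = c * a i k + dot n (a i) x * a p k" for i k
    define b' where "b' k = c * b k + dot n b x * a p k" for k
    have "0 \<le> dot n b' w" if w: "\<forall>i\<in>I. 0 \<le> dot n (a' i) w" for w
    proof -
      define y where "y k = c * w k + dot n (a p) w * x k" for k
      have y: "dot n v y = dot n (\<lambda>k. c * v k + dot n v x * a p k) w" for v
        unfolding y_def dot_linear_left dot_linear_right by simp
      have "dot n (a p) y = 0" unfolding y_def dot_linear_right by (simp add: c_def)
      moreover have "\<forall>i\<in>I. 0 \<le> dot n (a i) y" using w unfolding y a'_def .
      ultimately have "0 \<le> dot n b y" by (intro insert.prems) auto
      then show ?thesis unfolding y b'_def .
    qed
    from insert.IH[OF this] obtain N l where N: "N > 0" and l: "\<forall>i\<in>I. 0 \<le> l i"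
      and eq: "\<forall>k<n. N * b' k = (\<Sum>i\<in>I. l i * a' i k)" by blast
    define l' where "l' = (\<lambda>i. c * l i)(p := (\<Sum>i\<in>I. l i * dot n (a i) x) - N * dot n b x)"
    have "\<forall>i\<in>insert p I. 0 \<le> l' i"
    proof -
      have "N * dot n b x \<le> 0" using N x(2) by (simp add: mult_nonneg_nonpos)
      moreover have "0 \<le> (\<Sum>i\<in>I. l i * dot n (a i) x)" using l x(1) by (intro sum_nonneg) auto
      ultimately show ?thesis using l c by (auto simp: l'_def)
    qed
    moreover have "N * c * b k = (\<Sum>i\<in>insert p I. l' i * a i k)" if k: "k < n" for k
    proof -
      have "N * c * b k = N * b' k - N * dot n b x * a p k" by (simp add: b'_def algebra_simps)
      also have "N * b' k = (\<Sum>i\<in>I. c * l i * a i k) + (\<Sum>i\<in>I. l i * dot n (a i) x) * a p k"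
        using eq k by (simp add: a'_def sum.distrib sum_distrib_right sum_distrib_left algebra_simps)
      also have "(\<Sum>i\<in>I. c * l i * a i k) = (\<Sum>i\<in>I. l' i * a i k)"
        using insert.hyps by (intro sum.cong) (auto simp: l'_def)
      finally show ?thesis using insert.hyps by (simp add: l'_def algebra_simps)
    qed
    ultimately show ?thesis using N c by (intro exI[of _ "N * c"] conjI exI[of _ l']) auto
  qed
qed

lemma free_of_finite_rankE:
  assumes "free_of_finite_rank TYPE('g::ab_group_add)"
  obtains n and f :: "'g::ab_group_add \<Rightarrow> nat \<Rightarrow> int"
  where "\<forall>x y. \<forall>i<n. f (x + y) i = f x i + f y i"
    and "\<forall>x y. (\<forall>i<n. f x i = f y i) \<longrightarrow> x = y"
proof -
  obtain n and f :: "'g \<Rightarrow> nat \<Rightarrow> int" where f: "bij_betw f UNIV (\<Pi>\<^sub>E i\<in>{..<n}. UNIV)"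
    and add: "\<forall>x y. \<forall>i<n. f (x + y) i = f x i + f y i"
    using assms unfolding free_of_finite_rank_def by blast
  have "x = y" if "\<forall>i<n. f x i = f y i" for x y
  proof -
    have "f x \<in> (\<Pi>\<^sub>E i\<in>{..<n}. UNIV)" "f y \<in> (\<Pi>\<^sub>E i\<in>{..<n}. UNIV)" using f by (auto simp: bij_betw_def)
    then have "f x = f y" by (rule PiE_ext) (use that in auto)
    then show ?thesis using f by (auto simp: bij_betw_def inj_on_def)
  qed
  with add that show ?thesis by blast
qed

lemma finitely_generated_monoidE:
  assumes "finitely_generated_monoid TYPE('t::comm_monoid_add)"
  obtains S :: "'t::comm_monoid_add set" where "finite S"
    and "\<And>P t. P 0 \<Longrightarrow> (\<And>x. x \<in> S \<Longrightarrow> P x) \<Longrightarrow> (\<And>x y. P x \<Longrightarrow> P y \<Longrightarrow> P (x + y)) \<Longrightarrow> P t"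
proof -
  obtain S :: "'t set" where S: "finite S"
    "\<forall>M. S \<subseteq> M \<and> 0 \<in> M \<and> (\<forall>x\<in>M. \<forall>y\<in>M. x + y \<in> M) \<longrightarrow> M = UNIV"
    using assms unfolding finitely_generated_monoid_def by blast
  have "P t" if "P 0" "\<And>x. x \<in> S \<Longrightarrow> P x" "\<And>x y. P x \<Longrightarrow> P y \<Longrightarrow> P (x + y)" for P t
  proof -
    have "{t. P t} = UNIV" by (rule S(2)[rule_format]) (use that in auto)
    then show ?thesis by blast
  qed
  with S(1) that show ?thesis by blast
qed

text \<open>The nonnegative combinations that Farkas' lemma yields come from elements of the monoid, and the face \<open>P\<close>
  contains such an element only if it contains the generators that occur in it.\<close>

lemma nonneg_combination:
  fixes \<psi> :: "'t::comm_monoid_add \<Rightarrow> nat \<Rightarrow> int" and P :: "'t \<Rightarrow> bool"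
  assumes "finite G" and l: "\<forall>g\<in>G. 0 \<le> l g"
    and add: "\<And>s t k. k < n \<Longrightarrow> \<psi> (s + t) k = \<psi> s k + \<psi> t k"
    and P: "P 0" "\<And>s t. P (s + t) \<longleftrightarrow> P s \<and> P t"
  shows "\<exists>s. (\<forall>k<n. \<psi> s k = (\<Sum>g\<in>G. l g * \<psi> g k)) \<and> ((\<forall>g\<in>G. P g) \<longrightarrow> P s) \<and>
    (P s \<longrightarrow> (\<forall>g\<in>G. 0 < l g \<longrightarrow> P g))"
  using assms(1) l
proof (induction G rule: finite_induct)
  case empty
  have "\<psi> 0 k = 0" if "k < n" for k using add[OF that, of 0 0] by simp
  then show ?case using P(1) by auto
next
  case (insert g G)
  then obtain s where s: "\<forall>k<n. \<psi> s k = (\<Sum>g\<in>G. l g * \<psi> g k)" "(\<forall>g\<in>G. P g) \<longrightarrow> P s"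
    "P s \<longrightarrow> (\<forall>g\<in>G. 0 < l g \<longrightarrow> P g)" by auto
  have mult: "\<exists>u. (\<forall>k<n. \<psi> u k = int m * \<psi> g k) \<and> (P g \<longrightarrow> P u) \<and> (P u \<longrightarrow> 0 < m \<longrightarrow> P g)" for m
  proof (induction m)
    case 0
    have "\<psi> 0 k = 0" if "k < n" for k using add[OF that, of 0 0] by simp
    then show ?case using P(1) by auto
  next
    case (Suc m)
    then obtain u where "(\<forall>k<n. \<psi> u k = int m * \<psi> g k)" "P g \<longrightarrow> P u" by blast
    then show ?case using P(2) add by (intro exI[of _ "u + g"]) (auto simp: algebra_simps)
  qed
  obtain u where u: "\<forall>k<n. \<psi> u k = int (nat (l g)) * \<psi> g k" "P g \<longrightarrow> P u" "P u \<longrightarrow> 0 < nat (l g) \<longrightarrow> P g"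
    using mult by blast
  have "\<forall>k<n. \<psi> (s + u) k = (\<Sum>g\<in>insert g G. l g * \<psi> g k)"
    using s(1) u(1) insert.hyps insert.prems by (simp add: add)
  moreover have "(\<forall>g\<in>insert g G. P g) \<longrightarrow> P (s + u)" using s(2) u(2) P(2) by blast
  moreover have "P (s + u) \<longrightarrow> (\<forall>g\<in>insert g G. 0 < l g \<longrightarrow> P g)" using s(3) u(3) P(2) by auto
  ultimately show ?case by blast
qed

text \<open>\<open>P\<close> describes a face of \<open>T\<^sub>+\<close> that is saturated under \<open>T\<^sub>+ \<rightarrow> T\<close>. The functional is the sum of the
  functionals \<open>W g\<close> that Farkas' lemma provides for the generators \<open>g\<close> outside the face, with
  conditions \<open>\<ge> 0\<close> at all generators (\<open>Inl\<close>) and \<open>\<le> 0\<close> at those in the face (\<open>Inr\<close>).\<close>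

lemma dual_with_zeros:
  fixes P :: "'t::comm_monoid_add \<Rightarrow> bool"
  assumes fg: "finitely_generated_monoid TYPE('t)" and free: "free_of_finite_rank TYPE('t groth)"
    and P0: "P 0" and P_add: "\<And>s t. P (s + t) \<longleftrightarrow> P s \<and> P t"
    and P_int: "\<And>s t. of_monoid s = of_monoid t \<Longrightarrow> P s \<Longrightarrow> P t"
  obtains E where "E \<in> dual_monoid" "\<And>t. E t = 0 \<longleftrightarrow> P t"
proof -
  obtain n and f :: "'t groth \<Rightarrow> nat \<Rightarrow> int"
    where f_add: "\<forall>x y. \<forall>i<n. f (x + y) i = f x i + f y i"
    and f_inj: "\<forall>x y. (\<forall>i<n. f x i = f y i) \<longrightarrow> x = y"
    by (rule free_of_finite_rankE[OF free])
  define \<psi> :: "'t \<Rightarrow> nat \<Rightarrow> int" where "\<psi> t = f (of_monoid t)" for t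
  have \<psi>_add: "\<psi> (s + t) k = \<psi> s k + \<psi> t k" if "k < n" for s t k
    using f_add that by (simp add: \<psi>_def of_monoid_add)
  have \<psi>_0: "\<psi> 0 k = 0" if "k < n" for k using \<psi>_add[OF that, of 0 0] by simp
  have \<psi>_P: "P t" if "P s" "\<And>k. k < n \<Longrightarrow> \<psi> s k = \<psi> t k" for s t
  proof -
    have "of_monoid s = of_monoid t" using f_inj that(2) by (simp add: \<psi>_def)
    then show "P t" using that(1) by (rule P_int)
  qed
  obtain G :: "'t set" where G: "finite G"
    and gen: "\<And>P t. P 0 \<Longrightarrow> (\<And>x. x \<in> G \<Longrightarrow> P x) \<Longrightarrow> (\<And>x y. P x \<Longrightarrow> P y \<Longrightarrow> P (x + y)) \<Longrightarrow> P t"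
    by (rule finitely_generated_monoidE[OF fg]) blast
  define F where "F = {g \<in> G. P g}"
  have F: "finite F" using G by (simp add: F_def)
  have "\<exists>w. (\<forall>g\<in>G. 0 \<le> dot n (\<psi> g) w) \<and> (\<forall>g\<in>F. dot n (\<psi> g) w = 0) \<and> 0 < dot n (\<psi> g0) w"
    if g0: "g0 \<in> G" "\<not> P g0" for g0
  proof (rule ccontr)
    assume none: "\<not> ?thesis"
    define a where "a = case_sum \<psi> (\<lambda>g k. - \<psi> g k)"
    have neg: "dot n (\<lambda>k. - v k) w = - dot n v w" for v w by (simp add: dot_def sum_negf)
    have "\<exists>N>0. \<exists>l. (\<forall>i\<in>G <+> F. (0::int) \<le> l i) \<and>
        (\<forall>k<n. N * (- \<psi> g0 k) = (\<Sum>i\<in>G <+> F. l i * a i k))"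
    proof (rule integral_farkas)
      show "finite (G <+> F)" using G F by simp
      fix w assume w: "\<forall>i\<in>G <+> F. 0 \<le> dot n (a i) w"
      have "\<forall>g\<in>G. 0 \<le> dot n (\<psi> g) w" using w[rule_format, OF InlI] by (simp add: a_def)
      moreover have "\<forall>g\<in>F. 0 \<le> - dot n (\<psi> g) w"
        using w[rule_format, OF InrI] by (simp add: a_def flip: neg)
      ultimately show "0 \<le> dot n (\<lambda>k. - \<psi> g0 k) w"
        using none unfolding neg F_def by force
    qed
    then obtain N l where N: "N > 0" and l: "\<forall>i\<in>G <+> F. (0::int) \<le> l i"
      and eq: "\<forall>k<n. N * (- \<psi> g0 k) = (\<Sum>i\<in>G <+> F. l i * a i k)" by blast
    obtain s where s: "\<forall>k<n. \<psi> s k = (\<Sum>g\<in>G. l (Inl g) * \<psi> g k)"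
      using nonneg_combination[of G "\<lambda>g. l (Inl g)" n \<psi> P] G l \<psi>_add P0 P_add by auto
    obtain t where t: "\<forall>k<n. \<psi> t k = (\<Sum>g\<in>F. l (Inr g) * \<psi> g k)" "P t"
      using nonneg_combination[of F "\<lambda>g. l (Inr g)" n \<psi> P] F l \<psi>_add P0 P_add by (auto simp: F_def)
    obtain u where u: "\<forall>k<n. \<psi> u k = N * \<psi> g0 k" "P u \<longrightarrow> P g0"
      using nonneg_combination[of "{g0}" "\<lambda>_. N" n \<psi> P] N \<psi>_add P0 P_add by auto
    have "\<psi> t k = \<psi> (s + u) k" if k: "k < n" for k
    proof -
      have "N * (- \<psi> g0 k) = \<psi> s k - \<psi> t k"
        using eq k s t(1) G F by (simp add: a_def sum.Plus sum_negf)
      then show ?thesis using u(1) k by (simp add: \<psi>_add)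
    qed
    with t(2) have "P (s + u)" by (rule \<psi>_P)
    then show False using P_add u(2) g0(2) by blast
  qed
  then obtain W where W: "\<And>g0. g0 \<in> G \<Longrightarrow> \<not> P g0 \<Longrightarrow>
      (\<forall>g\<in>G. 0 \<le> dot n (\<psi> g) (W g0)) \<and> (\<forall>g\<in>F. dot n (\<psi> g) (W g0) = 0) \<and> 0 < dot n (\<psi> g0) (W g0)"
    by metis
  define L where "L t = (\<Sum>g\<in>G - F. dot n (\<psi> t) (W g))" for t
  have L_add: "L (s + t) = L s + L t" for s t
  proof -
    have "dot n (\<psi> (s + t)) w = dot n (\<psi> s) w + dot n (\<psi> t) w" for w
      by (simp add: dot_def \<psi>_add algebra_simps sum.distrib)
    then show ?thesis by (simp add: L_def sum.distrib)
  qed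
  have L0: "L 0 = 0" using L_add[of 0 0] by simp
  have L: "0 \<le> L t \<and> (L t = 0 \<longleftrightarrow> P t)" for t
  proof (rule gen[of "\<lambda>t. 0 \<le> L t \<and> (L t = 0 \<longleftrightarrow> P t)"])
    show "0 \<le> L 0 \<and> (L 0 = 0 \<longleftrightarrow> P 0)" using L0 P0 by simp
    show "0 \<le> L (x + y) \<and> (L (x + y) = 0 \<longleftrightarrow> P (x + y))"
      if "0 \<le> L x \<and> (L x = 0 \<longleftrightarrow> P x)" "0 \<le> L y \<and> (L y = 0 \<longleftrightarrow> P y)" for x y
      using that by (auto simp: L_add P_add)
    fix g assume g: "g \<in> G"
    have nonneg: "0 \<le> dot n (\<psi> g) (W g')" if "g' \<in> G - F" for g'
      using W[of g'] that g by (auto simp: F_def)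
    show "0 \<le> L g \<and> (L g = 0 \<longleftrightarrow> P g)"
    proof (cases "P g")
      case True
      then have "L g = 0"
        unfolding L_def using W g by (intro sum.neutral) (auto simp: F_def)
      with True show ?thesis by simp
    next
      case False
      then have "0 < L g"
        unfolding L_def using W[OF g] g G nonneg by (intro sum_pos2[of _ g]) (auto simp: F_def)
      with False show ?thesis by simp
    qed
  qed
  show ?thesis
  proof (rule that)
    show "(\<lambda>t. nat (L t)) \<in> dual_monoid"
      using L L0 by (auto simp: dual_monoid_def monoid_map_def L_add nat_add_distrib)
    show "nat (L t) = 0 \<longleftrightarrow> P t" for t using L[of t] by auto
  qed
qed

section \<open>The decomposition of integral monoid maps\<close>

text \<open>The polynomial \<open>X\<^sup>n - c\<close> splits.\<close>

lemma algebraically_closed_roots_exist: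
  assumes "algebraically_closed K"
  shows "roots_exist K"
  unfolding roots_exist_def
proof (intro allI impI ballI)
  interpret algebraically_closed K by fact
  fix n :: nat and c assume n: "n > 0" and c: "c \<in> carrier K"
  define p where "p = monom \<one>\<^bsub>K\<^esub> (n - 1) @ [\<ominus>\<^bsub>K\<^esub> c]"
  have p: "p \<in> carrier (poly_ring K)" "length p - 1 = n"
    using c n unfolding sym[OF univ_poly_carrier] polynomial_def by (auto simp: p_def monom_def)
  from roots_over_carrier[OF p(1)] have "roots p \<noteq> {#}" using p(2) n by (auto simp: splitted_def)
  then obtain b where "b \<in># roots p" by auto
  then have b: "b \<in> carrier K" "eval p b = \<zero>\<^bsub>K\<^esub>"
    using roots_mem_iff_is_root[OF p(1)] by (auto simp: is_root_def)
  have "set (monom \<one>\<^bsub>K\<^esub> (n - 1)) \<subseteq> carrier K" by (auto simp: monom_def)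
  from eval_append_aux[OF this, of "\<ominus>\<^bsub>K\<^esub> c" b] b c
  have "b [^]\<^bsub>K\<^esub> (n - 1) \<otimes>\<^bsub>K\<^esub> b \<oplus>\<^bsub>K\<^esub> \<ominus>\<^bsub>K\<^esub> c = \<zero>\<^bsub>K\<^esub>"
    by (simp add: p_def eval_monom)
  moreover have "b [^]\<^bsub>K\<^esub> (n - 1) \<otimes>\<^bsub>K\<^esub> b = b [^]\<^bsub>K\<^esub> n" using n by (cases n) auto
  ultimately have "b [^]\<^bsub>K\<^esub> n \<oplus>\<^bsub>K\<^esub> \<ominus>\<^bsub>K\<^esub> c = \<zero>\<^bsub>K\<^esub>" by simp
  then have "b [^]\<^bsub>K\<^esub> n = c" using b(1) c r_right_minus_eq[of "b [^]\<^bsub>K\<^esub> n" c] by (simp add: a_minus_def)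
  with b(1) show "\<exists>b\<in>carrier K. b [^]\<^bsub>K\<^esub> n = c" by blast
qed

lemma alg_closure_roots_exist:
  assumes "is_alg_closure k K j"
  shows "roots_exist K"
proof -
  interpret algebraic_closure K "j ` carrier k" using assms by (simp add: is_alg_closure_def)
  show ?thesis by (rule algebraically_closed_roots_exist) (rule algebraically_closed_axioms)
qed

context base_field
begin

lemma mult_monoid_map_0: "mult_monoid_map \<alpha> K \<Longrightarrow> \<alpha> 0 = \<one>"
  and mult_monoid_map_add: "mult_monoid_map \<alpha> K \<Longrightarrow> \<alpha> (s + t) = \<alpha> s \<otimes> \<alpha> t"
  by (simp_all add: mult_monoid_map_def)

lemma mult_monoid_map_nonzero_add:
  assumes "mult_monoid_map \<alpha> K"
  shows "\<alpha> (s + t) \<noteq> \<zero> \<longleftrightarrow> \<alpha> s \<noteq> \<zero> \<and> \<alpha> t \<noteq> \<zero>"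
  using assms mult_monoid_map_closed[OF assms]
  by (simp add: mult_monoid_map_add nonzero_mult_iff)

text \<open>The differences of elements of the face form a subgroup of \<open>\<int>\<^sup>n\<close>, and \<open>\<rho>\<close> defines a character of it,
  to which \<open>character_extends\<close> applies. Coordinates from \<open>n\<close> on are set to \<open>0\<close> in the graph.\<close>

lemma character_on_face:
  fixes \<rho> :: "'t::comm_monoid_add \<Rightarrow> 'k"
  assumes roots: "roots_exist K"
    and \<psi>_add: "\<And>s t i. i < n \<Longrightarrow> \<psi> (s + t) i = \<psi> s i + \<psi> t i"
    and P: "P 0" "\<And>s t. P s \<Longrightarrow> P t \<Longrightarrow> P (s + t)"
    and \<rho>: "\<And>t. P t \<Longrightarrow> \<rho> t \<in> Units K" "\<And>s t. P s \<Longrightarrow> P t \<Longrightarrow> \<rho> (s + t) = \<rho> s \<otimes> \<rho> t"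
    and ker: "\<And>s t. P s \<Longrightarrow> P t \<Longrightarrow> (\<forall>i<n. \<psi> s i = \<psi> t i) \<Longrightarrow> \<rho> s = \<rho> t"
  obtains c where "c \<in> {..<n} \<rightarrow> Units K" "\<And>t. P t \<Longrightarrow> \<rho> t = torus_char K n c (\<psi> t)"
proof -
  define \<psi>' where "\<psi>' t i = (if i < n then \<psi> t i else 0)" for t i
  have \<psi>'_add: "\<psi>' (s + t) i = \<psi>' s i + \<psi>' t i" for s t i using \<psi>_add by (simp add: \<psi>'_def)
  have \<rho>0: "\<rho> 0 = \<one>"
  proof -
    have "\<rho> 0 = \<rho> 0 \<otimes> \<rho> 0" using \<rho>(2)[OF P(1) P(1)] by simp
    then have "\<rho> 0 \<otimes> inv (\<rho> 0) = \<rho> 0 \<otimes> \<rho> 0 \<otimes> inv (\<rho> 0)" by simp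
    then show ?thesis using \<rho>(1)[OF P(1)] by (simp add: m_assoc Units_closed)
  qed
  define S where "S = {(\<lambda>i. \<psi>' s i - \<psi>' t i, \<rho> s \<otimes> inv (\<rho> t)) | s t. P s \<and> P t}"
  have "\<exists>c\<in>{..<n} \<rightarrow> Units K. \<forall>(v, x)\<in>S. x = torus_char K n c v"
  proof (rule character_extends[OF roots])
    fix v x w y assume "(v, x) \<in> S" and "(w, y) \<in> S"
    then obtain s t s' t' where st: "P s" "P t" "P s'" "P t'"
      and v: "v = (\<lambda>i. \<psi>' s i - \<psi>' t i)" "x = \<rho> s \<otimes> inv (\<rho> t)"
      and w: "w = (\<lambda>i. \<psi>' s' i - \<psi>' t' i)" "y = \<rho> s' \<otimes> inv (\<rho> t')"
      by (auto simp: S_def)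
    note U = \<rho>(1)[OF st(1)] \<rho>(1)[OF st(2)] \<rho>(1)[OF st(3)] \<rho>(1)[OF st(4)]
    have "x \<otimes> inv y = \<rho> (s + t') \<otimes> inv (\<rho> (t + s'))"
      using U by (simp add: v w \<rho>(2) st inv_mult m_ac Units_closed)
    then show "(\<lambda>i. v i - w i, x \<otimes> inv y) \<in> S"
      unfolding S_def using st P(2)
      by (intro CollectI exI[of _ "s + t'"] exI[of _ "t + s'"]) (auto simp: v w \<psi>'_add)
  next
    fix v x assume "(v, x) \<in> S"
    then obtain s t where st: "P s" "P t" and v: "v = (\<lambda>i. \<psi>' s i - \<psi>' t i)" "x = \<rho> s \<otimes> inv (\<rho> t)"
      by (auto simp: S_def)
    show "x \<in> Units K" using \<rho>(1) st by (auto simp: v)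
    assume "\<forall>i<n. v i = 0"
    then have "\<rho> s = \<rho> t" by (intro ker st) (auto simp: v \<psi>'_def)
    then show "x = \<one>" using \<rho>(1)[OF st(2)] by (simp add: v)
  qed
  then obtain c where c: "c \<in> {..<n} \<rightarrow> Units K" and S': "\<forall>(v, x)\<in>S. x = torus_char K n c v" ..
  have S: "x = torus_char K n c v" if "(v, x) \<in> S" for v x using S' that by auto
  have "\<rho> t = torus_char K n c (\<psi> t)" if t: "P t" for t
  proof -
    have "(\<lambda>i. \<psi>' t i - \<psi>' 0 i, \<rho> t \<otimes> inv (\<rho> 0)) \<in> S" unfolding S_def using t P(1) by blast
    from S[OF this] have "\<rho> t = torus_char K n c (\<lambda>i. \<psi>' t i - \<psi>' 0 i)"
      using \<rho>(1)[OF t] by (simp add: \<rho>0 Units_closed)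
    also have "\<dots> = torus_char K n c (\<psi> t)"
      by (rule torus_char_cong) (use c \<psi>_add[of _ 0 0] in \<open>auto simp: \<psi>'_def\<close>)
    finally show ?thesis .
  qed
  with c that show ?thesis by blast
qed

lemma dual_of_zeros:
  fixes \<alpha> :: "'t::comm_monoid_add \<Rightarrow> 'k"
  assumes fg: "finitely_generated_monoid TYPE('t)" and free: "free_of_finite_rank TYPE('t groth)"
    and \<alpha>: "mult_monoid_map \<alpha> K" and int: "respects_int \<alpha>"
  obtains E where "E \<in> dual_monoid" "\<And>t. E t = 0 \<longleftrightarrow> \<alpha> t \<noteq> \<zero>"
proof (rule dual_with_zeros[OF fg free, of "\<lambda>t. \<alpha> t \<noteq> \<zero>"])
  show "\<alpha> 0 \<noteq> \<zero>" by (simp add: mult_monoid_map_0[OF \<alpha>])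
  show "\<alpha> (s + t) \<noteq> \<zero> \<longleftrightarrow> \<alpha> s \<noteq> \<zero> \<and> \<alpha> t \<noteq> \<zero>" for s t
    by (rule mult_monoid_map_nonzero_add[OF \<alpha>])
  show "\<alpha> t \<noteq> \<zero>" if "of_monoid s = of_monoid t" "\<alpha> s \<noteq> \<zero>" for s t
    using respects_intD[OF int that(1)] that(2) by simp
qed (rule that)

text \<open>\<open>E\<close> accounts for the zeros of \<open>\<alpha>\<close>, and off the zeros \<open>\<alpha>\<close> is the restriction of a character of \<open>T\<close>,
  obtained from an embedding \<open>T \<subseteq> \<int>\<^sup>n\<close>.\<close>

lemma integral_decomposition:
  fixes \<alpha> :: "'t::comm_monoid_add \<Rightarrow> 'k"
  assumes roots: "roots_exist K"
    and fg: "finitely_generated_monoid TYPE('t)" and free: "free_of_finite_rank TYPE('t groth)"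
    and \<alpha>: "mult_monoid_map \<alpha> K" and int: "respects_int \<alpha>"
  obtains l :: "'t groth \<Rightarrow> 'k" and E where "\<And>x. l x \<in> Units K" "\<And>x y. l (x + y) = l x \<otimes> l y"
    "E \<in> dual_monoid" "\<And>t. \<alpha> t = l (of_monoid t) \<otimes> \<zero> [^] E t" "\<And>t. E t = 0 \<longleftrightarrow> \<alpha> t \<noteq> \<zero>"
proof -
  note c = mult_monoid_map_closed[OF \<alpha>]
  obtain n and f :: "'t groth \<Rightarrow> nat \<Rightarrow> int"
    where f_add: "\<forall>x y. \<forall>i<n. f (x + y) i = f x i + f y i"
    and f_inj: "\<forall>x y. (\<forall>i<n. f x i = f y i) \<longrightarrow> x = y"
    by (rule free_of_finite_rankE[OF free])
  obtain E where E: "E \<in> dual_monoid" "\<And>t. E t = 0 \<longleftrightarrow> \<alpha> t \<noteq> \<zero>"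
    by (rule dual_of_zeros[OF fg free \<alpha> int]) blast
  obtain u where u: "u \<in> {..<n} \<rightarrow> Units K"
    and \<alpha>u: "\<And>t. \<alpha> t \<noteq> \<zero> \<Longrightarrow> \<alpha> t = torus_char K n u (f (of_monoid t))"
  proof (rule character_on_face[OF roots, of n "\<lambda>t. f (of_monoid t)" "\<lambda>t. \<alpha> t \<noteq> \<zero>" \<alpha>])
    show "f (of_monoid (s + t)) i = f (of_monoid s) i + f (of_monoid t) i" if "i < n" for s t i
      using f_add that by (simp add: of_monoid_add)
    show "\<alpha> 0 \<noteq> \<zero>" by (simp add: mult_monoid_map_0[OF \<alpha>])
    show "\<alpha> (s + t) \<noteq> \<zero>" if "\<alpha> s \<noteq> \<zero>" "\<alpha> t \<noteq> \<zero>" for s t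
      using that mult_monoid_map_nonzero_add[OF \<alpha>] by blast
    show "\<alpha> t \<in> Units K" if "\<alpha> t \<noteq> \<zero>" for t using that c by (simp add: unit_iff)
    show "\<alpha> (s + t) = \<alpha> s \<otimes> \<alpha> t" for s t by (rule mult_monoid_map_add[OF \<alpha>])
    show "\<alpha> s = \<alpha> t" if "\<forall>i<n. f (of_monoid s) i = f (of_monoid t) i" for s t
      by (rule respects_intD[OF int]) (use f_inj that in blast)
  qed blast
  define l where "l x = torus_char K n u (f x)" for x
  show ?thesis
  proof (rule that[OF _ _ E(1) _ E(2)])
    show "l x \<in> Units K" for x unfolding l_def by (rule torus_char_unit[OF u])
    show "l (x + y) = l x \<otimes> l y" for x y
    proof -
      have "l (x + y) = torus_char K n u (\<lambda>i. f x i + f y i)"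
        unfolding l_def by (rule torus_char_cong[OF u]) (use f_add in auto)
      then show ?thesis by (simp add: torus_char_add[OF u] l_def)
    qed
    fix t
    have lc: "l (of_monoid t) \<in> carrier K" unfolding l_def by (rule torus_char_closed[OF u])
    show "\<alpha> t = l (of_monoid t) \<otimes> \<zero> [^] E t"
    proof (cases "\<alpha> t = \<zero>")
      case True
      then have "E t \<noteq> 0" using E(2) by simp
      then show ?thesis using True lc by (simp add: nat_pow_zero)
    next
      case False
      then have "E t = 0" using E(2) by simp
      then show ?thesis using \<alpha>u[OF False] lc by (simp add: l_def)
    qed
  qed
qed

end

lemma dual_monoid_int: "E \<in> dual_monoid \<Longrightarrow> of_monoid s = of_monoid t \<Longrightarrow> E s = E t"
  by (rule int_monoid_int_map) (simp_all add: dual_monoid_def)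

lemma mult_monoid_map_hom:
  assumes "mult_monoid_map a k" "j \<in> ring_hom k K"
  shows "mult_monoid_map (\<lambda>t. j (a t)) K"
  using assms by (auto simp: mult_monoid_map_def ring_hom_closed ring_hom_one ring_hom_mult)

text \<open>Homomorphisms of fields are injective, so the condition may be tested after \<open>j\<close>.\<close>

lemma respects_int_iff_decomposition:
  fixes a :: "'t::comm_monoid_add \<Rightarrow> 'k" and K :: "'l ring"
  assumes "field k" "field K" "j \<in> ring_hom k K" "roots_exist K"
    and fg: "finitely_generated_monoid TYPE('t)" and free: "free_of_finite_rank TYPE('t groth)"
    and a: "mult_monoid_map a k"
  shows "respects_int a \<longleftrightarrow>
    (\<exists>(l :: 't groth \<Rightarrow> 'l) E.
      (\<forall>x. l x \<in> Units K) \<and> (\<forall>x y. l (x + y) = l x \<otimes>\<^bsub>K\<^esub> l y) \<and> E \<in> dual_monoid \<and>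
      (\<forall>t. j (a t) = l (of_monoid t) \<otimes>\<^bsub>K\<^esub> \<zero>\<^bsub>K\<^esub> [^]\<^bsub>K\<^esub> E t))" (is "?l \<longleftrightarrow> ?r")
proof
  interpret K: base_field K using assms by (simp add: base_field_def)
  assume ?l
  then have "respects_int (\<lambda>t. j (a t))" unfolding respects_int_def by metis
  with K.integral_decomposition[OF assms(4) fg free mult_monoid_map_hom[OF a assms(3)]]
  show ?r by metis
next
  assume ?r
  then obtain l E where E: "E \<in> dual_monoid"
    and eq: "\<And>t. j (a t) = l (of_monoid t) \<otimes>\<^bsub>K\<^esub> \<zero>\<^bsub>K\<^esub> [^]\<^bsub>K\<^esub> E t" by blast
  have "a s = a t" if st: "of_monoid s = of_monoid t" for s t
  proof -
    have "j (a s) = j (a t)" unfolding eq st dual_monoid_int[OF E st] ..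
    moreover have "a s \<in> carrier k" "a t \<in> carrier k" using a by (simp_all add: mult_monoid_map_def)
    ultimately show ?thesis using hom_fields_inj[OF assms(1-3)] by (auto dest: inj_onD)
  qed
  then show ?l unfolding respects_int_def by blast
qed

section \<open>Zero sets and isomorphism classes\<close>

context graded_field
begin

lemma zero_set_eq:
  assumes "(V, a) \<in> X_ob r \<phi> K" "e \<in> frames r V"
  shows "zero_set r \<phi> K (V, a) = {t. a t e = \<zero>}"
proof -
  interpret V: line_family K r V by (rule X_ob_lines) fact
  show ?thesis
    using V.tensor_zero_iff[OF X_ob_section[OF assms(1)] assms(2)] by (simp add: zero_set_def)
qed

lemma Z_ob_X_ob: "x \<in> Z_ob r \<phi> K \<Longrightarrow> x \<in> X_ob r \<phi> K"
  by (auto simp: Z_ob_def)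

lemma X_ob_frame:
  assumes "(V, a) \<in> X_ob r \<phi> K"
  obtains e where "e \<in> frames r V"
proof -
  interpret V: line_family K r V by (rule X_ob_lines) fact
  from V.frames_nonempty that show ?thesis .
qed

lemma Z_ob_respects_int: "(V, a) \<in> Z_ob r \<phi> K \<Longrightarrow> respects_int (\<lambda>t. a t e)"
  unfolding Z_ob_iff respects_int_def by metis

lemma trivial_Z_ob: "mult_monoid_map \<alpha> K \<Longrightarrow> respects_int \<alpha> \<Longrightarrow> trivial_X_obj r \<phi> K \<alpha> \<in> Z_ob r \<phi> K"
  by (simp add: trivial_Z_ob_iff)

lemma trivial_zero_set:
  assumes "mult_monoid_map \<alpha> K"
  shows "zero_set r \<phi> K (trivial_X_obj r \<phi> K \<alpha>) = {t. \<alpha> t = \<zero>}"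
proof -
  have "zero_set r \<phi> K (trivial_X_obj r \<phi> K \<alpha>) = {t. trivial_section r (\<phi> t) (\<alpha> t) (unit_frame K r) = \<zero>}"
    using zero_set_eq[OF trivial_X_ob[OF assms, unfolded trivial_X_obj_eq] unit_frame]
    by (simp add: trivial_X_obj_eq)
  then show ?thesis by (simp add: trivial_section_unit mult_monoid_map_closed[OF assms])
qed

text \<open>The monoid map whose zero set is the support of \<open>E\<close>, with \<open>0\<^sup>0 = 1\<close>.\<close>

lemma power_zero_map:
  assumes "E \<in> dual_monoid"
  shows "mult_monoid_map (\<lambda>t. \<zero> [^] E t) K" "respects_int (\<lambda>t. \<zero> [^] E t)"
    "{t. \<zero> [^] E t = \<zero>} = Supp E"
proof -
  have pow: "\<zero> [^] (n::nat) = (if n = 0 then \<one> else \<zero>)" for n by (simp add: nat_pow_zero)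
  show "mult_monoid_map (\<lambda>t. \<zero> [^] E t) K"
    using assms by (auto simp: mult_monoid_map_def dual_monoid_def monoid_map_def pow)
  show "respects_int (\<lambda>t. \<zero> [^] E t)"
    unfolding respects_int_def using dual_monoid_int[OF assms] by metis
  show "{t. \<zero> [^] E t = \<zero>} = Supp E" by (auto simp: Supp_def pow)
qed

lemma zero_set_Supp:
  assumes fg: "finitely_generated_monoid TYPE('t)" and free: "free_of_finite_rank TYPE('t groth)"
    and x: "x \<in> Z_ob r \<phi> K"
  obtains E where "E \<in> dual_monoid" "zero_set r \<phi> K x = Supp E"
proof -
  obtain V a where xe: "x = (V, a)" by (cases x)
  have X: "(V, a) \<in> X_ob r \<phi> K" using Z_ob_X_ob x xe by blast
  obtain e where e: "e \<in> frames r V" by (rule X_ob_frame[OF X])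
  obtain E where E: "E \<in> dual_monoid" "\<And>t. E t = 0 \<longleftrightarrow> a t e \<noteq> \<zero>"
    by (rule dual_of_zeros[OF fg free X_ob_coordinates[OF X e] Z_ob_respects_int[OF x[unfolded xe]]]) blast
  have "a t e = \<zero> \<longleftrightarrow> 0 < E t" for t using E(2)[of t] by auto
  then have "zero_set r \<phi> K x = Supp E" unfolding xe zero_set_eq[OF X e] Supp_def by simp
  with E(1) that show ?thesis by blast
qed

end

text \<open>Homomorphisms of fields are injective, and a point of the torus acts by units.\<close>

lemma X_arrow_zero_set:
  assumes "graded_field K r \<phi>" "graded_field L r \<phi>" "h \<in> ring_hom K L"
    and x: "x \<in> X_ob r \<phi> K" and y: "y \<in> X_ob r \<phi> L" and arr: "X_arrow r h K L x y"
  shows "zero_set r \<phi> K x = zero_set r \<phi> L y"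
proof -
  interpret K: graded_field K r \<phi> by fact
  interpret L: graded_field L r \<phi> by fact
  obtain V a V' a' where xy: "x = (V, a)" "y = (V', a')" by (cases x, cases y)
  note X = x[unfolded xy] and Y = y[unfolded xy]
  obtain e where e: "e \<in> frames r V" by (rule K.X_ob_frame[OF X])
  obtain e' where e': "e' \<in> frames r V'" by (rule L.X_ob_frame[OF Y])
  obtain c where c: "c \<in> {..<r} \<rightarrow> Units L"
    and eq: "\<And>t. h (a t e) = torus_char L r c (\<lambda>i. - \<phi> t i) \<otimes>\<^bsub>L\<^esub> a' t e'"
    using X_arrow_coordinates[OF assms(1-3) X Y e e'] arr xy by blast
  have "a t e = \<zero>\<^bsub>K\<^esub> \<longleftrightarrow> a' t e' = \<zero>\<^bsub>L\<^esub>" for t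
  proof -
    have ac: "a t e \<in> carrier K" "a' t e' \<in> carrier L"
      using K.mult_monoid_map_closed[OF K.X_ob_coordinates[OF X e]]
        L.mult_monoid_map_closed[OF L.X_ob_coordinates[OF Y e']] by auto
    have "h \<zero>\<^bsub>K\<^esub> = \<zero>\<^bsub>L\<^esub>"
      using ring_hom_zero[OF assms(3)] K.ring_axioms L.ring_axioms by blast
    then have "a t e = \<zero>\<^bsub>K\<^esub> \<longleftrightarrow> h (a t e) = \<zero>\<^bsub>L\<^esub>"
      using inj_onD[OF hom_fields_inj[OF K.field_axioms L.field_axioms assms(3)], of "a t e" "\<zero>\<^bsub>K\<^esub>"] ac
      by auto
    also have "\<dots> \<longleftrightarrow> a' t e' = \<zero>\<^bsub>L\<^esub>"
      unfolding eq using ac L.torus_char_unit[OF c, of "\<lambda>i. - \<phi> t i"]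
      by (simp add: L.nonzero_mult_iff L.unit_iff)
    finally show ?thesis .
  qed
  then show ?thesis unfolding xy K.zero_set_eq[OF X e] L.zero_set_eq[OF Y e'] by blast
qed

context graded_field
begin

lemma ext_of_monoid: "i < r \<Longrightarrow> ext \<phi> (of_monoid t) i = \<phi> t i"
  unfolding ext_def by (rule groth_ext_of_monoid[OF phi])

lemma X_arrow_id_coordinates:
  assumes "(V, a) \<in> X_ob r \<phi> K" "(V', a') \<in> X_ob r \<phi> K" "e \<in> frames r V" "e' \<in> frames r V'"
  shows "X_arrow r (\<lambda>c. c) K K (V, a) (V', a') \<longleftrightarrow>
    (\<exists>c\<in>{..<r} \<rightarrow> Units K. \<forall>t. a t e = torus_char K r c (\<lambda>i. - \<phi> t i) \<otimes> a' t e')"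
  by (rule X_arrow_coordinates[OF graded_field_axioms graded_field_axioms _ assms]) (rule id_ring_hom[unfolded id_def])

lemma X_arrow_refl:
  assumes "x \<in> X_ob r \<phi> K"
  shows "X_arrow r (\<lambda>c. c) K K x x"
proof -
  obtain V a where xe: "x = (V, a)" by (cases x)
  note X = assms[unfolded xe]
  obtain e where e: "e \<in> frames r V" by (rule X_ob_frame[OF X])
  have "a t e = torus_char K r (\<lambda>i. \<one>) (\<lambda>i. - \<phi> t i) \<otimes> a t e" for t
    using mult_monoid_map_closed[OF X_ob_coordinates[OF X e]] by simp
  then show ?thesis
    unfolding xe X_arrow_id_coordinates[OF X X e e]
    by (intro bexI[of _ "\<lambda>_. \<one>"]) auto
qed

text \<open>The quotient of the two monoid maps is a character on the common complement of the zero sets. As \<open>\<phi>\<close>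
  embeds \<open>T\<close> into \<open>\<int>\<^sup>r\<close>, it extends to a character of \<open>\<int>\<^sup>r\<close>, i.e. a point of the torus.\<close>

lemma X_arrow_of_zero_sets:
  assumes roots: "roots_exist K" and inj: "inj (\<lambda>x. restrict (ext \<phi> x) {..<r})"
    and x: "x \<in> Z_ob r \<phi> K" and y: "y \<in> Z_ob r \<phi> K" and z: "zero_set r \<phi> K x = zero_set r \<phi> K y"
  shows "X_arrow r (\<lambda>c. c) K K x y"
proof -
  obtain V a V' a' where xy: "x = (V, a)" "y = (V', a')" by (cases x, cases y)
  note X = Z_ob_X_ob[OF x, unfolded xy] and Y = Z_ob_X_ob[OF y, unfolded xy]
  obtain e where e: "e \<in> frames r V" by (rule X_ob_frame[OF X])
  obtain e' where e': "e' \<in> frames r V'" by (rule X_ob_frame[OF Y])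
  note \<alpha> = X_ob_coordinates[OF X e] and \<alpha>' = X_ob_coordinates[OF Y e']
  note \<alpha>c = mult_monoid_map_closed[OF \<alpha>] and \<alpha>'c = mult_monoid_map_closed[OF \<alpha>']
  have z0: "a t e = \<zero> \<longleftrightarrow> a' t e' = \<zero>" for t
    using z unfolding xy zero_set_eq[OF X e] zero_set_eq[OF Y e'] by blast
  define \<rho> where "\<rho> t = a t e \<otimes> inv (a' t e')" for t
  have U: "a t e \<in> Units K" "a' t e' \<in> Units K" if "a t e \<noteq> \<zero>" for t
    using that z0 \<alpha>c \<alpha>'c by (auto simp: unit_iff)
  obtain c where c: "c \<in> {..<r} \<rightarrow> Units K"
    and \<rho>c: "\<And>t. a t e \<noteq> \<zero> \<Longrightarrow> \<rho> t = torus_char K r c (\<lambda>i. - \<phi> t i)"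
  proof (rule character_on_face[OF roots, of r "\<lambda>t i. - \<phi> t i" "\<lambda>t. a t e \<noteq> \<zero>" \<rho>])
    show "- \<phi> (s + t) i = - \<phi> s i + - \<phi> t i" if "i < r" for s t i by (simp add: phi_add[OF that])
    show "a 0 e \<noteq> \<zero>" by (simp add: mult_monoid_map_0[OF \<alpha>])
    show "a (s + t) e \<noteq> \<zero>" if "a s e \<noteq> \<zero>" "a t e \<noteq> \<zero>" for s t
      using that mult_monoid_map_nonzero_add[OF \<alpha>] by blast
    show "\<rho> t \<in> Units K" if "a t e \<noteq> \<zero>" for t using U[OF that] by (simp add: \<rho>_def)
    show "\<rho> (s + t) = \<rho> s \<otimes> \<rho> t" if "a s e \<noteq> \<zero>" "a t e \<noteq> \<zero>" for s t
      using U[OF that(1)] U[OF that(2)]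
      by (simp add: \<rho>_def mult_monoid_map_add[OF \<alpha>] mult_monoid_map_add[OF \<alpha>'] inv_mult m_ac Units_closed)
    show "\<rho> s = \<rho> t" if "\<forall>i<r. - \<phi> s i = - \<phi> t i" for s t
    proof -
      have "restrict (ext \<phi> (of_monoid s)) {..<r} = restrict (ext \<phi> (of_monoid t)) {..<r}"
        using that ext_of_monoid by (auto simp: fun_eq_iff restrict_def)
      then have st: "of_monoid s = of_monoid t" using inj by (auto dest: injD)
      then show ?thesis
        using Z_ob_respects_int[of V a e] Z_ob_respects_int[of V' a' e'] x y
        unfolding \<rho>_def xy respects_int_def by metis
    qed
  qed blast
  have "a t e = torus_char K r c (\<lambda>i. - \<phi> t i) \<otimes> a' t e'" for t
  proof (cases "a t e = \<zero>")
    case True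
    then show ?thesis using z0 torus_char_closed[OF c] by simp
  next
    case False
    then show ?thesis
      using U[OF False] unfolding \<rho>c[OF False, symmetric] by (simp add: \<rho>_def m_assoc Units_closed)
  qed
  then show ?thesis unfolding xy X_arrow_id_coordinates[OF X Y e e'] using c by blast
qed

lemma Z_iso_eq_zero_sets:
  assumes "roots_exist K" "inj (\<lambda>x. restrict (ext \<phi> x) {..<r})"
  shows "Z_iso r \<phi> K = {(x, y). x \<in> Z_ob r \<phi> K \<and> y \<in> Z_ob r \<phi> K \<and> zero_set r \<phi> K x = zero_set r \<phi> K y}"
  unfolding Z_iso_def
  using X_arrow_of_zero_sets[OF assms]
    X_arrow_zero_set[OF graded_field_axioms graded_field_axioms id_ring_hom[unfolded id_def]] Z_ob_X_ob
  by blast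

lemma zero_set_image:
  assumes "finitely_generated_monoid TYPE('t)" "free_of_finite_rank TYPE('t groth)"
  shows "zero_set r \<phi> K ` Z_ob r \<phi> K = {Supp E | E. E \<in> dual_monoid}"
proof (intro equalityI subsetI)
  fix A assume "A \<in> zero_set r \<phi> K ` Z_ob r \<phi> K"
  then obtain x where "x \<in> Z_ob r \<phi> K" "A = zero_set r \<phi> K x" by blast
  then show "A \<in> {Supp E | E. E \<in> dual_monoid}"
    using zero_set_Supp[OF assms, of x "\<exists>E. A = Supp E \<and> E \<in> dual_monoid"] by blast
next
  fix A :: "'t set" assume "A \<in> {Supp E | E. E \<in> dual_monoid}"
  then obtain E where E: "E \<in> dual_monoid" "A = Supp E" by blast
  have "zero_set r \<phi> K (trivial_X_obj r \<phi> K (\<lambda>t. \<zero> [^] E t)) = A"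
    unfolding trivial_zero_set[OF power_zero_map(1)[OF E(1)]] power_zero_map(3)[OF E(1)] E(2) ..
  then show "A \<in> zero_set r \<phi> K ` Z_ob r \<phi> K"
    using trivial_Z_ob[OF power_zero_map(1,2)[OF E(1)]] by blast
qed

end

lemma bij_betw_quotient:
  assumes "R = {(x, y). x \<in> A \<and> y \<in> A \<and> f x = f y}"
  shows "\<exists>g. bij_betw g (A // R) (f ` A) \<and> (\<forall>x\<in>A. g (R `` {x}) = f x)"
proof -
  define g where "g C = f (SOME x. x \<in> C)" for C
  have g: "g (R `` {x}) = f x" if "x \<in> A" for x
  proof -
    have "x \<in> R `` {x}" using that by (simp add: assms)
    then have "(SOME y. y \<in> R `` {x}) \<in> R `` {x}" by (rule someI)
    then show ?thesis unfolding g_def by (auto simp: assms)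
  qed
  have "inj_on g (A // R)"
  proof (rule inj_onI)
    fix C D assume "C \<in> A // R" "D \<in> A // R" and eq: "g C = g D"
    then obtain x y where xy: "x \<in> A" "y \<in> A" "C = R `` {x}" "D = R `` {y}" by (auto elim!: quotientE)
    then have "f x = f y" using eq g by simp
    then show "C = D" using xy by (auto simp: assms)
  qed
  moreover have "g ` (A // R) = f ` A"
  proof -
    have "A // R = (\<lambda>x. R `` {x}) ` A" by (auto simp: quotient_def)
    then show ?thesis using g by (simp add: image_image)
  qed
  ultimately have "bij_betw g (A // R) (f ` A)" by (rule bij_betw_imageI)
  with g show ?thesis by blast
qed

section \<open>The map \<open>\<pi>\<close>\<close>

lemma X_arrow_base_change:
  assumes "graded_field K r \<phi>" "graded_field L r \<phi>" "h \<in> ring_hom K L"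
    and x: "(V, a) \<in> X_ob r \<phi> K" and e: "e \<in> frames r V"
  shows "X_arrow r h K L (V, a) (trivial_X_obj r \<phi> L (\<lambda>t. h (a t e)))"
proof -
  interpret K: graded_field K r \<phi> by fact
  interpret L: graded_field L r \<phi> by fact
  note \<alpha> = mult_monoid_map_hom[OF K.X_ob_coordinates[OF x e] assms(3)]
  note c = L.mult_monoid_map_closed[OF \<alpha>]
  note Y = L.trivial_X_ob[OF \<alpha>, unfolded L.trivial_X_obj_eq]
  have "h (a t e) = torus_char L r (\<lambda>i. \<one>\<^bsub>L\<^esub>) (\<lambda>i. - \<phi> t i) \<otimes>\<^bsub>L\<^esub>
      L.trivial_section r (\<phi> t) (h (a t e)) (unit_frame L r)" for t
    using c by (simp add: L.trivial_section_unit)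
  then show ?thesis
    unfolding L.trivial_X_obj_eq X_arrow_coordinates[OF assms(1-3) x Y e L.unit_frame]
    by (intro bexI[of _ "\<lambda>_. \<one>\<^bsub>L\<^esub>"]) auto
qed

lemma (in graded_field) X_arrow_from_trivial:
  assumes x: "(V, a) \<in> X_ob r \<phi> K" and e: "e \<in> frames r V"
  shows "X_arrow r (\<lambda>c. c) K K (trivial_X_obj r \<phi> K (\<lambda>t. a t e)) (V, a)"
proof -
  note \<alpha> = X_ob_coordinates[OF x e]
  note c = mult_monoid_map_closed[OF \<alpha>]
  note Y = trivial_X_ob[OF \<alpha>, unfolded trivial_X_obj_eq]
  have "trivial_section r (\<phi> t) (a t e) (unit_frame K r) =
      torus_char K r (\<lambda>i. \<one>) (\<lambda>i. - \<phi> t i) \<otimes> a t e" for t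
    using c by (simp add: trivial_section_unit)
  then show ?thesis
    unfolding trivial_X_obj_eq X_arrow_id_coordinates[OF Y x unit_frame e]
    by (intro bexI[of _ "\<lambda>_. \<one>"]) auto
qed

lemma groth_ext_add:
  assumes "monoid_map f"
  shows "groth_ext f (x + y) = groth_ext f x + groth_ext f y"
proof -
  obtain s t where x: "x = of_monoid s - of_monoid t" by (rule groth_cases)
  obtain s' t' where y: "y = of_monoid s' - of_monoid t'" by (rule groth_cases)
  have xy: "x + y = of_monoid (s + s') - of_monoid (t + t')"
    unfolding x y of_monoid_add by (simp add: algebra_simps)
  show ?thesis
    unfolding xy groth_ext_diff[OF assms] unfolding x y groth_ext_diff[OF assms]
    using assms by (simp add: monoid_map_def)
qed

lemma (in graded_field) ext_add: "i < r \<Longrightarrow> ext \<phi> (x + y) i = ext \<phi> x i + ext \<phi> y i"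
  unfolding ext_def by (rule groth_ext_add[OF phi])

context line_family
begin

lemma tensor_monomial_apply:
  "d \<in> frames r V \<Longrightarrow>
    tensor_monomial K r V z n d = (\<Otimes>j\<in>{..<r}. coordinate K (V j) (d j) (z j) [^] n j)"
  by (simp add: tensor_monomial_def)

lemma coordinate_section_closed:
  assumes "d \<in> frames r V" "\<And>j. j < r \<Longrightarrow> z j \<in> carrier (V j)" "j < r"
  shows "coordinate K (V j) (d j) (z j) \<in> carrier K"
  by (rule coordinate_closed[OF lines frame_nth[OF assms(1)]]) (use assms in auto)

text \<open>The inverse shows that monomials of degree \<open>n\<close> transform as elements of the tensor power with
  exponents \<open>n\<close> must.\<close>

lemma coordinate_scale_left:
  assumes d: "d \<in> frames r V" and u: "u \<in> {..<r} \<rightarrow> Units K" and j: "j < r" and v: "v \<in> carrier (V j)"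
  shows "coordinate K (V j) (scale_frame r V u d j) v = inv (u j) \<otimes> coordinate K (V j) (d j) v"
proof -
  interpret M: module K "V j" by (rule line_module[OF lines[OF j]])
  note dj = frame_nth[OF d j]
  have uj: "u j \<in> Units K" using u j by auto
  define c where "c = coordinate K (V j) (d j) v"
  have c: "c \<in> carrier K" "v = c \<odot>\<^bsub>V j\<^esub> d j"
    using coordinate_closed[OF lines[OF j] dj v] coordinate_smult[OF lines[OF j] dj v] by (auto simp: c_def)
  have "(inv (u j) \<otimes> c) \<odot>\<^bsub>V j\<^esub> (u j \<odot>\<^bsub>V j\<^esub> d j) = (inv (u j) \<otimes> c \<otimes> u j) \<odot>\<^bsub>V j\<^esub> d j"
    using uj c(1) dj(1) by (simp add: M.smult_assoc1 Units_closed)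
  also have "inv (u j) \<otimes> c \<otimes> u j = c" using uj c(1) by (simp add: m_ac Units_closed)
  finally have "v = (inv (u j) \<otimes> c) \<odot>\<^bsub>V j\<^esub> scale_frame r V u d j"
    using c(2) j by (simp add: scale_frame_def)
  then show ?thesis
    using coordinate_unique[OF lines[OF j] frame_nth[OF scale_frame_closed[OF u d] j], of "inv (u j) \<otimes> c"]
      uj c(1) by (simp add: c_def)
qed

lemma tensor_monomial_closed:
  assumes z: "\<And>j. j < r \<Longrightarrow> z j \<in> carrier (V j)"
  shows "tensor_monomial K r V z n \<in> carrier (tp (\<lambda>j. int (n j)))"
  unfolding tensor_power_iff
proof (intro conjI ballI)
  have co: "coordinate K (V j) (d j) (z j) \<in> carrier K" if "d \<in> frames r V" "j < r" for d j
    by (rule coordinate_section_closed[OF that(1) z that(2)])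
  show "tensor_monomial K r V z n \<in> frames r V \<rightarrow>\<^sub>E carrier K"
    unfolding tensor_monomial_def using co by (auto intro!: finprod_closed)
  fix d u assume d: "d \<in> frames r V" and u: "u \<in> {..<r} \<rightarrow> Units K"
  have "tensor_monomial K r V z n (scale_frame r V u d) =
      (\<Otimes>j\<in>{..<r}. u j [^] (- int (n j)) \<otimes> coordinate K (V j) (d j) (z j) [^] n j)"
    unfolding tensor_monomial_apply[OF scale_frame_closed[OF u d]]
  proof (rule finprod_cong')
    show "(\<lambda>j. u j [^] (- int (n j)) \<otimes> coordinate K (V j) (d j) (z j) [^] n j) \<in> {..<r} \<rightarrow> carrier K"
      using u co[OF d] by auto
    fix j assume "j \<in> {..<r}"
    then have j: "j < r" by simp
    have uj: "u j \<in> Units K" using u j by auto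
    have inv: "inv (u j) [^] n j = u j [^] (- int (n j))"
    proof -
      have "inv (u j) = u j [^] (-1 :: int)"
        using units_int_pow_neg[OF uj, of 1] int_pow_int[of K "u j" 1] uj by (simp add: Units_closed)
      then have "inv (u j) [^] int (n j) = u j [^] (-1 * int (n j))"
        using units_int_pow_pow[OF uj, of "-1" "int (n j)"] by simp
      then show ?thesis by (simp add: int_pow_int)
    qed
    show "coordinate K (V j) (scale_frame r V u d j) (z j) [^] n j =
        u j [^] (- int (n j)) \<otimes> coordinate K (V j) (d j) (z j) [^] n j"
      unfolding coordinate_scale_left[OF d u j z[OF j]] inv[symmetric]
      using co[OF d j] uj by (simp add: nat_pow_distrib)
  qed simp
  also have "\<dots> = torus_char K r u (\<lambda>j. - int (n j)) \<otimes> tensor_monomial K r V z n d"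
    unfolding tensor_monomial_apply[OF d] torus_char_def
    by (rule finprod_multf) (use u co[OF d] in auto)
  finally show "tensor_monomial K r V z n (scale_frame r V u d) =
      torus_char K r u (\<lambda>j. - int (n j)) \<otimes> tensor_monomial K r V z n d" .
qed

lemma tensor_monomial_cong:
  assumes z: "\<And>j. j < r \<Longrightarrow> z j \<in> carrier (V j)" and eq: "\<And>j. j < r \<Longrightarrow> n j = m j"
  shows "tensor_monomial K r V z n = tensor_monomial K r V z m"
  unfolding tensor_monomial_def
proof (rule restrict_ext)
  fix d assume d: "d \<in> frames r V"
  show "(\<Otimes>j\<in>{..<r}. coordinate K (V j) (d j) (z j) [^] n j) =
      (\<Otimes>j\<in>{..<r}. coordinate K (V j) (d j) (z j) [^] m j)"
    by (rule finprod_cong') (use coordinate_section_closed[OF d z] eq in auto)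
qed

lemma tensor_monomial_add:
  assumes z: "\<And>j. j < r \<Longrightarrow> z j \<in> carrier (V j)"
  shows "tensor_monomial K r V z (\<lambda>j. n j + m j) =
    tensor_mult K r V (tensor_monomial K r V z n) (tensor_monomial K r V z m)"
proof -
  have "(\<Otimes>j\<in>{..<r}. coordinate K (V j) (d j) (z j) [^] (n j + m j)) =
      (\<Otimes>j\<in>{..<r}. coordinate K (V j) (d j) (z j) [^] n j) \<otimes>
      (\<Otimes>j\<in>{..<r}. coordinate K (V j) (d j) (z j) [^] m j)" if d: "d \<in> frames r V" for d
  proof -
    note co = coordinate_section_closed[OF d z]
    have "(\<Otimes>j\<in>{..<r}. coordinate K (V j) (d j) (z j) [^] (n j + m j)) =
        (\<Otimes>j\<in>{..<r}. coordinate K (V j) (d j) (z j) [^] n j \<otimes> coordinate K (V j) (d j) (z j) [^] m j)"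
      by (rule finprod_cong') (use co in \<open>auto simp: nat_pow_mult\<close>)
    also have "\<dots> = (\<Otimes>j\<in>{..<r}. coordinate K (V j) (d j) (z j) [^] n j) \<otimes>
        (\<Otimes>j\<in>{..<r}. coordinate K (V j) (d j) (z j) [^] m j)"
      by (rule finprod_multf) (use co in auto)
    finally show ?thesis .
  qed
  then show ?thesis unfolding tensor_mult_def tensor_monomial_def by (intro restrict_ext) simp
qed

lemma tensor_monomial_0: "tensor_monomial K r V z (\<lambda>j. 0) = tensor_one K r V"
  by (simp add: tensor_monomial_def tensor_one_def)

end

text \<open>In coordinates a linear map between tensor powers is a multiplication, by a unit since it is injective.\<close>

lemma (in base_field) tensor_line_map:
  assumes V: "line_family K r V" and W: "line_family K s W"
    and \<Lambda>: "line_map (\<lambda>c. c) K (tensor_power K r V f) (tensor_power K s W g) \<Lambda>"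
    and e: "e \<in> frames r V" and d: "d \<in> frames s W"
  obtains \<mu> where "\<mu> \<in> Units K"
    "\<And>x. x \<in> carrier (tensor_power K r V f) \<Longrightarrow> \<Lambda> x \<in> carrier (tensor_power K s W g)"
    "\<And>x. x \<in> carrier (tensor_power K r V f) \<Longrightarrow> \<Lambda> x d = x e \<otimes> \<mu>"
proof -
  interpret V: line_family K r V by fact
  interpret W: line_family K s W by fact
  have cl: "\<Lambda> x \<in> carrier (W.tp g)" if "x \<in> carrier (V.tp f)" for x
    using \<Lambda> that by (auto simp: line_map_def)
  have lin: "\<Lambda> (c \<odot>\<^bsub>V.tp f\<^esub> x) = c \<odot>\<^bsub>W.tp g\<^esub> \<Lambda> x" if "c \<in> carrier K" "x \<in> carrier (V.tp f)" for c x
    using \<Lambda> that by (auto simp: line_map_def)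
  obtain x0 where x0: "x0 \<in> carrier (V.tp f)" "x0 e = \<one>" by (rule V.tensor_power_exists[OF e one_closed])
  note c0 = W.tensor_power_closed[OF cl[OF x0(1)] d]
  have eq: "\<Lambda> x d = x e \<otimes> \<Lambda> x0 d" if x: "x \<in> carrier (V.tp f)" for x
  proof -
    note xe = V.tensor_power_closed[OF x e]
    have "x = x e \<odot>\<^bsub>V.tp f\<^esub> x0"
      by (rule V.tensor_power_eqI[OF x V.tensor_smult(1)[OF x0(1) xe] e])
        (use V.tensor_smult(2)[OF x0(1) xe e] x0(2) xe in simp)
    then have "\<Lambda> x = x e \<odot>\<^bsub>W.tp g\<^esub> \<Lambda> x0" using lin[OF xe x0(1)] by simp
    then show ?thesis using W.tensor_smult(2)[OF cl[OF x0(1)] xe d] by simp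
  qed
  have "\<Lambda> x0 d \<noteq> \<zero>"
  proof
    assume z: "\<Lambda> x0 d = \<zero>"
    let ?z = "\<zero> \<odot>\<^bsub>V.tp f\<^esub> x0"
    have zc: "?z \<in> carrier (V.tp f)" by (rule V.tensor_smult(1)[OF x0(1) zero_closed])
    have "\<Lambda> ?z = \<Lambda> x0"
      by (rule W.tensor_power_eqI[OF cl[OF zc] cl[OF x0(1)] d])
        (use eq[OF zc] V.tensor_smult(2)[OF x0(1) zero_closed e] x0(2) z in simp)
    moreover have "inj_on \<Lambda> (carrier (V.tp f))" using \<Lambda> by (simp add: line_map_def)
    ultimately have "?z = x0" using zc x0(1) by (auto dest: inj_onD)
    then show False using V.tensor_smult(2)[OF x0(1) zero_closed e] x0(2) by simp
  qed
  then have "\<Lambda> x0 d \<in> Units K" using c0 by (simp add: unit_iff)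
  then show ?thesis using cl eq by (rule that)
qed

lemma (in base_field) tensor_line_map_surj:
  assumes V: "line_family K r V" and W: "line_family K s W"
    and \<Lambda>: "line_map (\<lambda>c. c) K (tensor_power K r V f) (tensor_power K s W g) \<Lambda>"
    and y: "y \<in> carrier (tensor_power K s W g)"
  obtains x where "x \<in> carrier (tensor_power K r V f)" "\<Lambda> x = y"
proof -
  interpret V: line_family K r V by fact
  interpret W: line_family K s W by fact
  obtain e where e: "e \<in> frames r V" by (rule V.frames_nonempty)
  obtain d where d: "d \<in> frames s W" by (rule W.frames_nonempty)
  obtain \<mu> where \<mu>: "\<mu> \<in> Units K"
    and cl: "\<And>x. x \<in> carrier (V.tp f) \<Longrightarrow> \<Lambda> x \<in> carrier (W.tp g)"
    and eq: "\<And>x. x \<in> carrier (V.tp f) \<Longrightarrow> \<Lambda> x d = x e \<otimes> \<mu>"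
    by (rule tensor_line_map[OF V W \<Lambda> e d]) blast
  note yd = W.tensor_power_closed[OF y d]
  have "y d \<otimes> inv \<mu> \<in> carrier K" using yd \<mu> by simp
  from V.tensor_power_exists[OF e this] obtain x where x: "x \<in> carrier (V.tp f)" "x e = y d \<otimes> inv \<mu>" by blast
  have "\<Lambda> x d = y d" unfolding eq[OF x(1)] x(2) using yd \<mu> by (simp add: m_assoc Units_closed)
  then have "\<Lambda> x = y" by (rule W.tensor_power_eqI[OF cl[OF x(1)] y d])
  with x(1) that show ?thesis by blast
qed

text \<open>The exponents \<open>E\<^sup>j\<close> define a second grading of \<open>T\<^sub>+\<close> (\<open>dual_graded\<close>), to which everything proved for
  \<open>\<phi>\<close> applies.\<close>

locale dual_family = graded_field K r \<phi>
  for K :: "'k ring" (structure) and r :: nat and \<phi> :: "'t::comm_monoid_add \<Rightarrow> nat \<Rightarrow> int" +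
  fixes s :: nat and Es :: "nat \<Rightarrow> 't \<Rightarrow> nat"
  assumes dual: "j < s \<Longrightarrow> Es j \<in> dual_monoid"
begin

lemma dual_graded: "graded_field K s (\<lambda>t j. int (Es j t))"
  by unfold_locales (use dual in \<open>auto simp: dual_monoid_def monoid_map_def\<close>)

lemma Es_add: "j < s \<Longrightarrow> Es j (t + t') = Es j t + Es j t'" and Es_0: "j < s \<Longrightarrow> Es j 0 = 0"
  using dual by (auto simp: dual_monoid_def monoid_map_def)

lemma ext_dual_of_monoid: "j < s \<Longrightarrow> ext_dual Es (of_monoid t) j = int (Es j t)"
proof -
  interpret D: graded_field K s "\<lambda>t j. int (Es j t)" by (rule dual_graded)
  show "j < s \<Longrightarrow> ?thesis" unfolding ext_dual_def by (rule D.ext_of_monoid)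
qed

lemma ext_dual_add: "j < s \<Longrightarrow> ext_dual Es (x + y) j = ext_dual Es x j + ext_dual Es y j"
proof -
  interpret D: graded_field K s "\<lambda>t j. int (Es j t)" by (rule dual_graded)
  show "j < s \<Longrightarrow> ?thesis" unfolding ext_dual_def by (rule D.ext_add)
qed

lemma F_obD:
  assumes "(V, W, z, \<Lambda>) \<in> F_ob r \<phi> s Es K"
  shows "line_family K r V" "line_family K s W" "\<And>j. j < s \<Longrightarrow> z j \<in> carrier (W j)"
    "\<And>t. line_map (\<lambda>c. c) K (tensor_power K r V (ext \<phi> t)) (tensor_power K s W (ext_dual Es t)) (\<Lambda> t)"
    "\<And>t t' x x'. x \<in> carrier (tensor_power K r V (ext \<phi> t)) \<Longrightarrow>
        x' \<in> carrier (tensor_power K r V (ext \<phi> t')) \<Longrightarrow>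
        \<Lambda> (t + t') (tensor_mult K r V x x') = tensor_mult K s W (\<Lambda> t x) (\<Lambda> t' x')"
proof -
  note F = assms[unfolded F_ob_def mem_Collect_eq prod.case]
  note F1 = F[THEN conjunct1] and F2 = F[THEN conjunct2, THEN conjunct1]
    and F3 = F[THEN conjunct2, THEN conjunct2, THEN conjunct1]
    and F4 = F[THEN conjunct2, THEN conjunct2, THEN conjunct2]
  show "line_family K r V" by unfold_locales (simp add: F1)
  show "line_family K s W" by unfold_locales (simp add: F2)
  show "\<And>j. j < s \<Longrightarrow> z j \<in> carrier (W j)" by (simp add: F2)
  show "\<And>t. line_map (\<lambda>c. c) K (tensor_power K r V (ext \<phi> t)) (tensor_power K s W (ext_dual Es t)) (\<Lambda> t)"
    by (rule F3[rule_format])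
  show "\<And>t t' x x'. x \<in> carrier (tensor_power K r V (ext \<phi> t)) \<Longrightarrow>
        x' \<in> carrier (tensor_power K r V (ext \<phi> t')) \<Longrightarrow>
        \<Lambda> (t + t') (tensor_mult K r V x x') = tensor_mult K s W (\<Lambda> t x) (\<Lambda> t' x')"
    by (rule F4[rule_format])
qed

text \<open>The second component of \<open>\<pi>\<close>. Since \<open>\<Lambda>\<close> is bijective on tensor powers, it is characterized by the
  equation \<open>\<Lambda> (a(t)) = z\<^sup>E\<^sup>(\<^sup>t\<^sup>)\<close> (\<open>pi_section_image\<close>, \<open>pi_section_unique\<close>).\<close>

definition pi_section where
  "pi_section V W z \<Lambda> t = inv_into (carrier (tensor_power K r V (\<phi> t))) (\<Lambda> (of_monoid t))
      (tensor_monomial K s W z (\<lambda>j. Es j t))"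

lemma F_pi_eq: "F_pi r \<phi> s Es K (V, W, z, \<Lambda>) = (V, pi_section V W z \<Lambda>)"
  by (simp add: F_pi_def pi_section_def fun_eq_iff)

lemma tensor_carriers:
  assumes "(V, W, z, \<Lambda>) \<in> F_ob r \<phi> s Es K"
  shows "carrier (tensor_power K r V (ext \<phi> (of_monoid t))) = carrier (tensor_power K r V (\<phi> t))"
    and "carrier (tensor_power K s W (ext_dual Es (of_monoid t))) =
      carrier (tensor_power K s W (\<lambda>j. int (Es j t)))"
proof -
  interpret V: line_family K r V by (rule F_obD(1)[OF assms])
  interpret W: line_family K s W by (rule F_obD(2)[OF assms])
  show "carrier (tensor_power K r V (ext \<phi> (of_monoid t))) = carrier (tensor_power K r V (\<phi> t))"
    by (rule V.tensor_power_cong) (rule ext_of_monoid)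
  show "carrier (tensor_power K s W (ext_dual Es (of_monoid t))) =
      carrier (tensor_power K s W (\<lambda>j. int (Es j t)))"
    by (rule W.tensor_power_cong) (rule ext_dual_of_monoid)
qed

lemma
  assumes F: "(V, W, z, \<Lambda>) \<in> F_ob r \<phi> s Es K"
  shows pi_section_closed: "pi_section V W z \<Lambda> t \<in> carrier (tensor_power K r V (\<phi> t))"
    and pi_section_image: "\<Lambda> (of_monoid t) (pi_section V W z \<Lambda> t) = tensor_monomial K s W z (\<lambda>j. Es j t)"
    and pi_section_unique: "\<And>x. x \<in> carrier (tensor_power K r V (\<phi> t)) \<Longrightarrow>
      \<Lambda> (of_monoid t) x = tensor_monomial K s W z (\<lambda>j. Es j t) \<Longrightarrow> x = pi_section V W z \<Lambda> t"
proof -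
  interpret V: line_family K r V by (rule F_obD(1)[OF F])
  interpret W: line_family K s W by (rule F_obD(2)[OF F])
  note \<Lambda> = F_obD(4)[OF F, of "of_monoid t"]
  note carr = tensor_carriers[OF F, of t]
  have "tensor_monomial K s W z (\<lambda>j. Es j t) \<in> carrier (W.tp (ext_dual Es (of_monoid t)))"
    unfolding carr(2) by (rule W.tensor_monomial_closed) (rule F_obD(3)[OF F])
  then obtain x where "x \<in> carrier (V.tp (ext \<phi> (of_monoid t)))"
    "\<Lambda> (of_monoid t) x = tensor_monomial K s W z (\<lambda>j. Es j t)"
    by (rule tensor_line_map_surj[OF F_obD(1,2)[OF F] \<Lambda>])
  then have mem: "tensor_monomial K s W z (\<lambda>j. Es j t) \<in> \<Lambda> (of_monoid t) ` carrier (V.tp (\<phi> t))"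
    unfolding carr by (intro image_eqI[OF sym])
  show "pi_section V W z \<Lambda> t \<in> carrier (V.tp (\<phi> t))"
    unfolding pi_section_def by (rule inv_into_into[OF mem])
  show "\<Lambda> (of_monoid t) (pi_section V W z \<Lambda> t) = tensor_monomial K s W z (\<lambda>j. Es j t)"
    unfolding pi_section_def by (rule f_inv_into_f[OF mem])
  have inj: "inj_on (\<Lambda> (of_monoid t)) (carrier (V.tp (\<phi> t)))"
    using \<Lambda> carr by (simp add: line_map_def)
  fix x assume "x \<in> carrier (V.tp (\<phi> t))" "\<Lambda> (of_monoid t) x = tensor_monomial K s W z (\<lambda>j. Es j t)"
  then show "x = pi_section V W z \<Lambda> t"
    unfolding pi_section_def using inv_into_f_f[OF inj] by metis
qed

text \<open>The axioms for \<open>a\<close> hold because both sides have the same image under the injective \<open>\<Lambda>\<close>; the image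
  depends on \<open>t\<close> only through its class in \<open>T\<close>, which places the object in \<open>Z\<^sub>\<phi>\<close>.\<close>

lemma F_pi_Z_ob:
  assumes F: "y \<in> F_ob r \<phi> s Es K"
  shows "F_pi r \<phi> s Es K y \<in> Z_ob r \<phi> K"
proof -
  obtain V W z \<Lambda> where y: "y = (V, W, z, \<Lambda>)" by (cases y)
  note F = F[unfolded y]
  interpret V: line_family K r V by (rule F_obD(1)[OF F])
  interpret W: line_family K s W by (rule F_obD(2)[OF F])
  note zc = F_obD(3)[OF F]
  define a where "a = pi_section V W z \<Lambda>"
  note ac = pi_section_closed[OF F, folded a_def] and im = pi_section_image[OF F, folded a_def]
    and uniq = pi_section_unique[OF F, folded a_def]
  have add: "a (t + t') = tensor_mult K r V (a t) (a t')" for t t'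
  proof (rule uniq[symmetric])
    have "carrier (V.tp (\<lambda>i. \<phi> t i + \<phi> t' i)) = carrier (V.tp (\<phi> (t + t')))"
      by (rule V.tensor_power_cong) (simp add: phi_add)
    then show "tensor_mult K r V (a t) (a t') \<in> carrier (V.tp (\<phi> (t + t')))"
      using V.tensor_mult_closed[OF ac ac] by blast
    have "\<Lambda> (of_monoid (t + t')) (tensor_mult K r V (a t) (a t')) =
        tensor_mult K s W (\<Lambda> (of_monoid t) (a t)) (\<Lambda> (of_monoid t') (a t'))"
      unfolding of_monoid_add by (rule F_obD(5)[OF F]) (simp_all only: tensor_carriers[OF F] ac)
    also have "\<dots> = tensor_monomial K s W z (\<lambda>j. Es j t + Es j t')"
      unfolding im by (rule W.tensor_monomial_add[symmetric]) (rule zc)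
    also have "\<dots> = tensor_monomial K s W z (\<lambda>j. Es j (t + t'))"
      by (rule W.tensor_monomial_cong[OF zc]) (simp_all add: Es_add)
    finally show "\<Lambda> (of_monoid (t + t')) (tensor_mult K r V (a t) (a t')) =
        tensor_monomial K s W z (\<lambda>j. Es j (t + t'))" .
  qed
  have zero: "a 0 = tensor_one K r V"
  proof (rule uniq[symmetric])
    have carr: "carrier (V.tp (\<lambda>i. 0)) = carrier (V.tp (\<phi> 0))"
      by (rule V.tensor_power_cong) (simp add: phi_0)
    then show one: "tensor_one K r V \<in> carrier (V.tp (\<phi> 0))" using V.tensor_one_closed by blast
    then have one': "tensor_one K r V \<in> carrier (V.tp (ext \<phi> 0))"
      using tensor_carriers(1)[OF F, of 0] by (simp add: of_monoid_0)
    obtain e where e: "e \<in> frames r V" by (rule V.frames_nonempty)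
    obtain d where d: "d \<in> frames s W" by (rule W.frames_nonempty)
    obtain \<mu> where \<mu>: "\<mu> \<in> Units K"
      and cl: "\<And>x. x \<in> carrier (V.tp (ext \<phi> 0)) \<Longrightarrow> \<Lambda> 0 x \<in> carrier (W.tp (ext_dual Es 0))"
      and eq: "\<And>x. x \<in> carrier (V.tp (ext \<phi> 0)) \<Longrightarrow> \<Lambda> 0 x d = x e \<otimes> \<mu>"
      by (rule tensor_line_map[OF F_obD(1,2,4)[OF F] e d]) blast
    have "tensor_mult K r V (tensor_one K r V) (tensor_one K r V) = tensor_one K r V"
      by (simp add: tensor_mult_def tensor_one_def cong: restrict_cong)
    then have "\<Lambda> 0 (tensor_one K r V) = tensor_mult K s W (\<Lambda> 0 (tensor_one K r V)) (\<Lambda> 0 (tensor_one K r V))"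
      using F_obD(5)[OF F one' one'] by simp
    then have "\<Lambda> 0 (tensor_one K r V) d = \<Lambda> 0 (tensor_one K r V) d \<otimes> \<Lambda> 0 (tensor_one K r V) d"
      using W.tensor_mult_apply[OF d] by metis
    then have "\<mu> = \<mu> \<otimes> \<mu>" using eq[OF one'] e \<mu> by (simp add: Units_closed)
    then have "\<mu> \<otimes> inv \<mu> = \<mu> \<otimes> \<mu> \<otimes> inv \<mu>" by simp
    then have "\<mu> = \<one>" using \<mu> by (simp add: m_assoc Units_closed)
    then have "\<Lambda> 0 (tensor_one K r V) d = \<one>" using eq[OF one'] e by simp
    moreover have "tensor_one K s W \<in> carrier (W.tp (ext_dual Es 0))"
      using W.tensor_one_closed W.tensor_power_cong[of "\<lambda>_. 0" "ext_dual Es 0"] ext_dual_of_monoid[of _ 0]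
      by (simp add: of_monoid_0 Es_0)
    ultimately have "\<Lambda> 0 (tensor_one K r V) = tensor_one K s W"
      using d by (intro W.tensor_power_eqI[OF cl[OF one'] _ d]) simp_all
    also have "\<dots> = tensor_monomial K s W z (\<lambda>j. 0)" by (rule W.tensor_monomial_0[symmetric])
    also have "\<dots> = tensor_monomial K s W z (\<lambda>j. Es j 0)"
      by (rule W.tensor_monomial_cong[OF zc]) (simp_all add: Es_0)
    finally show "\<Lambda> (of_monoid 0) (tensor_one K r V) = tensor_monomial K s W z (\<lambda>j. Es j 0)"
      by (simp add: of_monoid_0)
  qed
  have int: "a t = a t'" if eq: "of_monoid t = of_monoid t'" for t t'
  proof (rule uniq)
    have "carrier (V.tp (\<phi> t)) = carrier (V.tp (\<phi> t'))"
      by (rule V.tensor_power_cong) (rule phi_eq[OF eq])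
    then show "a t \<in> carrier (V.tp (\<phi> t'))" using ac by blast
    have "tensor_monomial K s W z (\<lambda>j. Es j t) = tensor_monomial K s W z (\<lambda>j. Es j t')"
      by (rule W.tensor_monomial_cong[OF zc]) (simp_all add: dual_monoid_int[OF dual eq])
    then show "\<Lambda> (of_monoid t') (a t) = tensor_monomial K s W z (\<lambda>j. Es j t')"
      using im[of t] by (simp only: eq)
  qed
  have "(V, a) \<in> X_ob r \<phi> K"
    unfolding X_ob_def using V.lines ac zero add by auto
  moreover have "respects_int a" unfolding respects_int_def using int by blast
  ultimately show ?thesis unfolding y F_pi_eq Z_ob_iff a_def[symmetric] by (rule conjI)
qed

end

lemma (in line_family) tensor_image_id:
  assumes "x \<in> carrier (tp f)" "x' \<in> carrier (tp f)"
  shows "tensor_image r (\<lambda>c. c) V (\<lambda>i v. v) x x' \<longleftrightarrow> x = x'"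
proof -
  have "(\<lambda>i\<in>{..<r}. e i) = e" if "e \<in> frames r V" for e
    using that by (auto simp: frames_def PiE_iff extensional_restrict)
  then have "tensor_image r (\<lambda>c. c) V (\<lambda>i v. v) x x' \<longleftrightarrow> (\<forall>e\<in>frames r V. x' e = x e)"
    unfolding tensor_image_def by simp
  also have "\<dots> \<longleftrightarrow> x = x'"
    using assms PiE_ext[of x "frames r V" "\<lambda>_. carrier K" x'] unfolding tensor_power_iff by metis
  finally show ?thesis .
qed

lemma line_map_closed: "line_map h K V V' \<beta> \<Longrightarrow> v \<in> carrier V \<Longrightarrow> \<beta> v \<in> carrier V'"
  by (auto simp: line_map_def)

lemma line_map_id: "line_map (\<lambda>c. c) K V V (\<lambda>v. v)"
  by (simp add: line_map_def)

context dual_family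
begin

lemma F_arrow_refl:
  assumes "y \<in> F_ob r \<phi> s Es K"
  shows "F_arrow r \<phi> s (\<lambda>c. c) K K y y"
proof -
  obtain V W z \<Lambda> where y: "y = (V, W, z, \<Lambda>)" by (cases y)
  note F = assms[unfolded y]
  interpret V: line_family K r V by (rule F_obD(1)[OF F])
  interpret W: line_family K s W by (rule F_obD(2)[OF F])
  have "tensor_image s (\<lambda>c. c) W (\<lambda>j w. w) (\<Lambda> t x) (\<Lambda> t x')"
    if "x \<in> carrier (V.tp (ext \<phi> t))" "x' \<in> carrier (V.tp (ext \<phi> t))"
      "tensor_image r (\<lambda>c. c) V (\<lambda>i v. v) x x'" for t x x'
  proof -
    have "\<Lambda> t x \<in> carrier (W.tp (ext_dual Es t))"
      by (rule line_map_closed[OF F_obD(4)[OF F] that(1)])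
    then show ?thesis using that V.tensor_image_id W.tensor_image_id by blast
  qed
  then show ?thesis
    unfolding y F_arrow_def prod.case
    by (intro exI[of _ "\<lambda>i v. v"] exI[of _ "\<lambda>j w. w"]) (simp add: line_map_id)
qed

end

text \<open>Functoriality of \<open>\<pi>\<close>. The image \<open>x\<close> of \<open>a(t)\<close> under \<open>\<sigma>\<close> is sent by \<open>\<Lambda>'\<close> to the image of the monomial
  of \<open>z\<close> under \<open>\<tau>\<close>, which is the monomial of \<open>z'\<close>; so \<open>x = a'(t)\<close>.\<close>

lemma F_arrow_X_arrow:
  assumes "dual_family K r \<phi> s Es" "dual_family L r \<phi> s Es" and h: "h \<in> ring_hom K L"
    and y: "y \<in> F_ob r \<phi> s Es K" and y': "y' \<in> F_ob r \<phi> s Es L" and arr: "F_arrow r \<phi> s h K L y y'"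
  shows "X_arrow r h K L (F_pi r \<phi> s Es K y) (F_pi r \<phi> s Es L y')"
proof -
  interpret K: dual_family K r \<phi> s Es by fact
  interpret L: dual_family L r \<phi> s Es by fact
  obtain V W z \<Lambda> where ye: "y = (V, W, z, \<Lambda>)" by (cases y)
  obtain V' W' z' \<Lambda>' where ye': "y' = (V', W', z', \<Lambda>')" by (cases y')
  note F = y[unfolded ye] and F' = y'[unfolded ye']
  interpret V: line_families_over K L r V V' h
    using K.F_obD(1)[OF F] L.F_obD(1)[OF F'] h
    by (simp add: line_families_over_def line_families_over_axioms_def)
  interpret W: line_families_over K L s W W' h
    using K.F_obD(2)[OF F] L.F_obD(2)[OF F'] h
    by (simp add: line_families_over_def line_families_over_axioms_def)
  interpret h: ring_hom_cring K L h
    by (rule hom_fields_ring_hom_cring[OF K.field_axioms L.field_axioms h])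
  obtain \<sigma> \<tau> where \<sigma>: "\<forall>i<r. line_map h K (V i) (V' i) (\<sigma> i)"
    and \<tau>': "\<forall>j<s. line_map h K (W j) (W' j) (\<tau> j) \<and> \<tau> j (z j) = z' j"
    and im: "\<forall>t. \<forall>x\<in>carrier (tensor_power K r V (ext \<phi> t)).
        \<forall>x'\<in>carrier (tensor_power L r V' (ext \<phi> t)).
          tensor_image r h V \<sigma> x x' \<longrightarrow> tensor_image s h W \<tau> (\<Lambda> t x) (\<Lambda>' t x')"
    using arr unfolding ye ye' F_arrow_def prod.case by (elim exE conjE)
  have \<tau>: "\<forall>j<s. line_map h K (W j) (W' j) (\<tau> j)" and \<tau>z: "\<And>j. j < s \<Longrightarrow> \<tau> j (z j) = z' j"
    using \<tau>' by auto
  define a a' where "a = K.pi_section V W z \<Lambda>" and "a' = L.pi_section V' W' z' \<Lambda>'"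
  note ac = K.pi_section_closed[OF F, folded a_def] and a'c = L.pi_section_closed[OF F', folded a'_def]
  obtain e where e: "e \<in> frames r V" by (rule V.A.frames_nonempty)
  obtain d where d: "d \<in> frames s W" by (rule W.A.frames_nonempty)
  have \<sigma>e: "frame_image r \<sigma> e \<in> frames r V'" by (rule V.frame_image_closed[OF \<sigma> e])
  have \<tau>d: "frame_image s \<tau> d \<in> frames s W'" by (rule W.frame_image_closed[OF \<tau> d])
  have "tensor_image r h V \<sigma> (a t) (a' t)" for t
  proof -
    have "h (a t e) \<in> carrier L" using V.A.tensor_power_closed[OF ac e] by (rule h.hom_closed)
    from V.B.tensor_power_exists[OF \<sigma>e this] obtain x
      where x: "x \<in> carrier (tensor_power L r V' (\<phi> t))" "x (frame_image r \<sigma> e) = h (a t e)" by blast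
    have imx: "tensor_image r h V \<sigma> (a t) x"
      unfolding V.tensor_image_iff[OF \<sigma> e ac x(1)] by (rule x(2))
    have xe: "x \<in> carrier (tensor_power L r V' (ext \<phi> (of_monoid t)))"
      using x(1) unfolding L.tensor_carriers[OF F'] .
    have ae: "a t \<in> carrier (tensor_power K r V (ext \<phi> (of_monoid t)))"
      using ac unfolding K.tensor_carriers[OF F] .
    have \<Lambda>x: "\<Lambda>' (of_monoid t) x \<in> carrier (tensor_power L s W' (\<lambda>j. int (Es j t)))"
      unfolding L.tensor_carriers(2)[OF F', symmetric]
      by (rule line_map_closed[OF L.F_obD(4)[OF F'] xe])
    have mon: "tensor_monomial K s W z (\<lambda>j. Es j t) \<in> carrier (tensor_power K s W (\<lambda>j. int (Es j t)))"
      by (rule W.A.tensor_monomial_closed) (rule K.F_obD(3)[OF F])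
    have mon': "tensor_monomial L s W' z' (\<lambda>j. Es j t) \<in> carrier (tensor_power L s W' (\<lambda>j. int (Es j t)))"
      by (rule W.B.tensor_monomial_closed) (rule L.F_obD(3)[OF F'])
    have "tensor_image s h W \<tau> (tensor_monomial K s W z (\<lambda>j. Es j t)) (\<Lambda>' (of_monoid t) x)"
      using im[rule_format, OF ae xe imx] K.pi_section_image[OF F, of t] by (simp add: a_def)
    then have "\<Lambda>' (of_monoid t) x (frame_image s \<tau> d) = h (tensor_monomial K s W z (\<lambda>j. Es j t) d)"
      unfolding W.tensor_image_iff[OF \<tau> d mon \<Lambda>x] .
    also have "\<dots> = tensor_monomial L s W' z' (\<lambda>j. Es j t) (frame_image s \<tau> d)"
    proof -
      have co: "coordinate K (W j) (d j) (z j) \<in> carrier K" if "j < s" for j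
        by (rule W.A.coordinate_section_closed[OF d K.F_obD(3)[OF F] that])
      have "coordinate L (W' j) (frame_image s \<tau> d j) (z' j) = h (coordinate K (W j) (d j) (z j))"
        if j: "j < s" for j
      proof -
        note dj = W.A.frame_nth[OF d j] and zj = K.F_obD(3)[OF F j]
        have c: "coordinate K (W j) (d j) (z j) \<in> carrier K" using co j by blast
        have "\<tau> j (z j) = \<tau> j (coordinate K (W j) (d j) (z j) \<odot>\<^bsub>W j\<^esub> d j)"
          unfolding K.coordinate_smult[OF W.A.lines[OF j] dj zj] ..
        also have "\<dots> = h (coordinate K (W j) (d j) (z j)) \<odot>\<^bsub>W' j\<^esub> \<tau> j (d j)"
          using \<tau> j c dj(1) by (auto simp: line_map_def)
        finally have "z' j = h (coordinate K (W j) (d j) (z j)) \<odot>\<^bsub>W' j\<^esub> frame_image s \<tau> d j"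
          using \<tau>z[OF j] j by (simp add: frame_image_def)
        then show ?thesis
          using L.coordinate_unique[OF W.B.lines[OF j] W.B.frame_nth[OF \<tau>d j] h.hom_closed[OF c]] by simp
      qed
      then have "tensor_monomial L s W' z' (\<lambda>j. Es j t) (frame_image s \<tau> d) =
          (\<Otimes>\<^bsub>L\<^esub>j\<in>{..<s}. h (coordinate K (W j) (d j) (z j) [^]\<^bsub>K\<^esub> Es j t))"
        unfolding W.B.tensor_monomial_apply[OF \<tau>d]
        by (intro L.finprod_cong')
          (use co in \<open>auto simp: hom_fields_nat_pow[OF K.field_axioms L.field_axioms h]\<close>)
      also have "\<dots> = h (tensor_monomial K s W z (\<lambda>j. Es j t) d)"
        unfolding W.A.tensor_monomial_apply[OF d]
        by (subst h.hom_finprod) (use co in \<open>auto simp: o_def\<close>)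
      finally show ?thesis ..
    qed
    finally have "\<Lambda>' (of_monoid t) x = tensor_monomial L s W' z' (\<lambda>j. Es j t)"
      by (rule W.B.tensor_power_eqI[OF \<Lambda>x mon' \<tau>d])
    then have "x = a' t" unfolding a'_def by (rule L.pi_section_unique[OF F' x(1)])
    then show ?thesis using imx by simp
  qed
  then show ?thesis
    unfolding ye ye' K.F_pi_eq L.F_pi_eq a_def[symmetric] a'_def[symmetric] X_arrow_def prod.case
    using \<sigma> by blast
qed

context base_field
begin

lemma trivial_coordinate:
  assumes "c \<in> carrier K"
  shows "coordinate K (trivial_line K) \<one> c = c"
proof -
  have "\<one> \<in> carrier (trivial_line K)" "\<one> \<noteq> \<zero>\<^bsub>trivial_line K\<^esub>"
    by (simp_all add: trivial_line_def)
  from coordinate_unique[OF trivial_line_line[OF field_axioms] this assms] assms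
  show ?thesis by (simp add: trivial_line_def)
qed

lemma trivial_monomial:
  assumes "\<And>j. j < s \<Longrightarrow> z j \<in> carrier K"
  shows "tensor_monomial K s (\<lambda>j. trivial_line K) z n (unit_frame K s) = (\<Otimes>j\<in>{..<s}. z j [^] n j)"
proof -
  interpret T: line_family K s "\<lambda>j. trivial_line K" by (rule trivial_line_family)
  show ?thesis
    unfolding T.tensor_monomial_apply[OF unit_frame]
    by (rule finprod_cong') (use assms in \<open>auto simp: unit_frame_def trivial_coordinate\<close>)
qed

end

context dual_family
begin

text \<open>The object of \<open>F\<close> with trivial lines, sections \<open>z\<close> and \<open>\<lambda>\<^sub>t\<close> the multiplication by \<open>l(t)\<^sup>-\<^sup>1\<close>.\<close>

lemma trivial_F_ob:
  fixes l :: "'t groth \<Rightarrow> 'k"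
  assumes l: "\<And>x. l x \<in> Units K" "\<And>x y. l (x + y) = l x \<otimes> l y"
    and z: "\<And>j. j < s \<Longrightarrow> z j \<in> carrier K"
    and \<alpha>: "\<And>t. \<alpha> t = l (of_monoid t) \<otimes> (\<Otimes>j\<in>{..<s}. z j [^] Es j t)"
  shows "\<exists>y\<in>F_ob r \<phi> s Es K. F_pi r \<phi> s Es K y = trivial_X_obj r \<phi> K \<alpha>"
proof -
  interpret V: line_family K r "\<lambda>i. trivial_line K" by (rule trivial_line_family)
  interpret W: line_family K s "\<lambda>j. trivial_line K" by (rule trivial_line_family)
  let ?V = "\<lambda>i::nat. trivial_line K"
  define \<Lambda> where "\<Lambda> x w = trivial_section s (ext_dual Es x) (inv (l x) \<otimes> w (unit_frame K r))" for x w
  note uV = unit_frame[of r] and uW = unit_frame[of s]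
  have il: "inv (l x) \<in> Units K" "inv (l x) \<in> carrier K" for x using l(1)[of x] by auto
  have c: "inv (l x) \<otimes> w (unit_frame K r) \<in> carrier K" if "w \<in> carrier (V.tp f)" for x w f
    using il V.tensor_power_closed[OF that uV] by simp
  have \<Lambda>c: "\<Lambda> x w \<in> carrier (W.tp (ext_dual Es x))" and \<Lambda>u: "\<Lambda> x w (unit_frame K s) = inv (l x) \<otimes> w (unit_frame K r)"
    if "w \<in> carrier (V.tp f)" for x w f
    unfolding \<Lambda>_def using c[OF that] by (auto intro: trivial_section_closed simp: trivial_section_unit)
  have lm: "line_map (\<lambda>c. c) K (V.tp (ext \<phi> x)) (W.tp (ext_dual Es x)) (\<Lambda> x)" for x
    unfolding line_map_def
  proof (intro conjI ballI)
    show "\<Lambda> x \<in> carrier (V.tp (ext \<phi> x)) \<rightarrow> carrier (W.tp (ext_dual Es x))" using \<Lambda>c by auto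
    show "inj_on (\<Lambda> x) (carrier (V.tp (ext \<phi> x)))"
    proof (rule inj_onI)
      fix v w assume v: "v \<in> carrier (V.tp (ext \<phi> x))" and w: "w \<in> carrier (V.tp (ext \<phi> x))"
        and eq: "\<Lambda> x v = \<Lambda> x w"
      have vw: "v (unit_frame K r) \<in> carrier K" "w (unit_frame K r) \<in> carrier K"
        using V.tensor_power_closed[OF v uV] V.tensor_power_closed[OF w uV] .
      have "inv (l x) \<otimes> v (unit_frame K r) = inv (l x) \<otimes> w (unit_frame K r)"
        using \<Lambda>u[OF v, of x] \<Lambda>u[OF w, of x] eq by simp
      then have "v (unit_frame K r) = w (unit_frame K r)"
        using Units_l_cancel[OF il(1) vw] by blast
      then show "v = w" by (rule V.tensor_power_eqI[OF v w uV])
    qed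
    fix v w assume v: "v \<in> carrier (V.tp (ext \<phi> x))" and w: "w \<in> carrier (V.tp (ext \<phi> x))"
    note vu = V.tensor_power_closed[OF v uV] and wu = V.tensor_power_closed[OF w uV]
    note vw = V.tensor_add[OF v w]
    show "\<Lambda> x (v \<oplus>\<^bsub>V.tp (ext \<phi> x)\<^esub> w) = \<Lambda> x v \<oplus>\<^bsub>W.tp (ext_dual Es x)\<^esub> \<Lambda> x w"
      by (rule W.tensor_power_eqI[OF \<Lambda>c[OF vw(1)] W.tensor_add(1)[OF \<Lambda>c[OF v] \<Lambda>c[OF w]] uW])
        (use vu wu il in \<open>simp add: \<Lambda>u[OF vw(1)] vw(2)[OF uV] W.tensor_add(2)[OF \<Lambda>c[OF v] \<Lambda>c[OF w] uW]
           \<Lambda>u[OF v] \<Lambda>u[OF w] r_distr\<close>)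
  next
    fix k w assume k: "k \<in> carrier K" and w: "w \<in> carrier (V.tp (ext \<phi> x))"
    note wu = V.tensor_power_closed[OF w uV]
    note kw = V.tensor_smult[OF w k]
    show "\<Lambda> x (k \<odot>\<^bsub>V.tp (ext \<phi> x)\<^esub> w) = k \<odot>\<^bsub>W.tp (ext_dual Es x)\<^esub> \<Lambda> x w"
      by (rule W.tensor_power_eqI[OF \<Lambda>c[OF kw(1)] W.tensor_smult(1)[OF \<Lambda>c[OF w] k] uW])
        (use wu il k in \<open>simp add: \<Lambda>u[OF kw(1)] kw(2)[OF uV] W.tensor_smult(2)[OF \<Lambda>c[OF w] k uW] \<Lambda>u[OF w] m_lcomm\<close>)
  qed
  have add: "\<Lambda> (x + y) (tensor_mult K r ?V v w) = tensor_mult K s ?V (\<Lambda> x v) (\<Lambda> y w)"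
    if v: "v \<in> carrier (V.tp (ext \<phi> x))" and w: "w \<in> carrier (V.tp (ext \<phi> y))" for x y v w
  proof -
    note vw = V.tensor_mult_closed[OF v w]
    have "carrier (W.tp (\<lambda>j. ext_dual Es x j + ext_dual Es y j)) = carrier (W.tp (ext_dual Es (x + y)))"
      by (rule W.tensor_power_cong) (simp add: ext_dual_add)
    then have mem: "tensor_mult K s ?V (\<Lambda> x v) (\<Lambda> y w) \<in> carrier (W.tp (ext_dual Es (x + y)))"
      using W.tensor_mult_closed[OF \<Lambda>c[OF v] \<Lambda>c[OF w]] by blast
    note vu = V.tensor_power_closed[OF v uV] and wu = V.tensor_power_closed[OF w uV]
    show ?thesis
      by (rule W.tensor_power_eqI[OF \<Lambda>c[OF vw] mem uW])
        (use vu wu il in \<open>simp add: \<Lambda>u[OF vw] uV uW \<Lambda>u[OF v] \<Lambda>u[OF w] l inv_mult m_ac\<close>)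
  qed
  have zc: "\<And>j. j < s \<Longrightarrow> z j \<in> carrier (trivial_line K)" using z by (simp add: trivial_line_def)
  define y where "y = (?V, ?V, z, \<Lambda>)"
  have F: "(?V, ?V, z, \<Lambda>) \<in> F_ob r \<phi> s Es K"
    unfolding F_ob_def mem_Collect_eq prod.case
    using V.lines W.lines zc lm add by blast
  have prodc: "(\<Otimes>j\<in>{..<s}. z j [^] Es j t) \<in> carrier K" for t by (rule finprod_closed) (use z in auto)
  have \<alpha>c: "\<alpha> t \<in> carrier K" for t unfolding \<alpha> using l(1) prodc by (simp add: Units_closed)
  have "pi_section ?V ?V z \<Lambda> t = trivial_section r (\<phi> t) (\<alpha> t)" for t
  proof (rule pi_section_unique[OF F, symmetric])
    show sec: "trivial_section r (\<phi> t) (\<alpha> t) \<in> carrier (V.tp (\<phi> t))" by (rule trivial_section_closed[OF \<alpha>c])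
    have "inv (l (of_monoid t)) \<otimes> \<alpha> t = (\<Otimes>j\<in>{..<s}. z j [^] Es j t)"
      using l(1)[of "of_monoid t"] prodc[of t] unfolding \<alpha> by (simp add: m_assoc[symmetric] Units_closed)
    then have at_unit: "\<Lambda> (of_monoid t) (trivial_section r (\<phi> t) (\<alpha> t)) (unit_frame K s) =
        tensor_monomial K s ?V z (\<lambda>j. Es j t) (unit_frame K s)"
      unfolding \<Lambda>u[OF sec] trivial_section_unit[OF \<alpha>c] using trivial_monomial[of s z, OF z] by simp
    show "\<Lambda> (of_monoid t) (trivial_section r (\<phi> t) (\<alpha> t)) = tensor_monomial K s ?V z (\<lambda>j. Es j t)"
    proof (rule W.tensor_power_eqI[where e = "unit_frame K s"])
      show "\<Lambda> (of_monoid t) (trivial_section r (\<phi> t) (\<alpha> t)) \<in> carrier (W.tp (\<lambda>j. int (Es j t)))"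
        using \<Lambda>c[OF sec] tensor_carriers(2)[OF F] by blast
      show "tensor_monomial K s ?V z (\<lambda>j. Es j t) \<in> carrier (W.tp (\<lambda>j. int (Es j t)))"
        by (rule W.tensor_monomial_closed) (rule zc)
    qed (fact uW at_unit)+
  qed
  then have "F_pi r \<phi> s Es K (?V, ?V, z, \<Lambda>) = trivial_X_obj r \<phi> K \<alpha>"
    unfolding F_pi_eq trivial_X_obj_eq by (simp add: fun_eq_iff)
  with F show ?thesis by blast
qed

text \<open>\<open>E(t)\<close> vanishes iff all \<open>E\<^sup>j(t)\<close> with \<open>q\<^sub>j > 0\<close> do, because no terms can cancel.\<close>

lemma power_zero_finprod:
  assumes E: "E \<in> dual_monoid" and gen: "generates_rational_cone s Es"
  obtains z where "\<And>j. j < s \<Longrightarrow> z j \<in> carrier K" "\<And>t. \<zero> [^] E t = (\<Otimes>j\<in>{..<s}. z j [^] Es j t)"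
proof -
  obtain q :: "nat \<Rightarrow> rat" where q: "\<forall>j<s. 0 \<le> q j"
    and eq: "\<And>t. of_nat (E t) = (\<Sum>j<s. q j * of_nat (Es j t))"
    using gen E unfolding generates_rational_cone_def by blast
  define z where "z j = (if q j > 0 then \<zero> else \<one>)" for j
  have pow: "\<zero> [^] (n::nat) = (if n = 0 then \<one> else \<zero>)" for n by (simp add: nat_pow_zero)
  have zc: "z j \<in> carrier K" for j by (simp add: z_def)
  have fin0: "(\<Otimes>j\<in>A. f j) = \<zero>" if "finite A" "f \<in> A \<rightarrow> carrier K" "i \<in> A" "f i = \<zero>" for f :: "nat \<Rightarrow> 'k" and A i
  proof -
    have "(\<Otimes>j\<in>A. f j) = (\<Otimes>j\<in>insert i (A - {i}). f j)" using that(3) by (simp add: insert_absorb)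
    also have "\<dots> = f i \<otimes> (\<Otimes>j\<in>A - {i}. f j)"
      by (rule finprod_insert) (use that in auto)
    also have "\<dots> = \<zero>" unfolding that(4) by (rule l_null) (use that in \<open>auto intro!: finprod_closed\<close>)
    finally show ?thesis .
  qed
  have "\<zero> [^] E t = (\<Otimes>j\<in>{..<s}. z j [^] Es j t)" for t
  proof (cases "E t = 0")
    case True
    then have "(\<Sum>j<s. q j * of_nat (Es j t)) = 0" using eq[of t] by simp
    then have "\<forall>j\<in>{..<s}. q j * of_nat (Es j t) = 0"
      using q by (subst (asm) sum_nonneg_eq_0_iff) auto
    then have "q j = 0 \<or> Es j t = 0" if "j < s" for j
      using that by force
    then have "z j [^] Es j t = \<one>" if "j < s" for j
      using that by (fastforce simp: z_def pow)
    then have "(\<Otimes>j\<in>{..<s}. z j [^] Es j t) = \<one>" by (intro finprod_one_eqI) auto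
    with True show ?thesis by (simp add: pow)
  next
    case False
    have "\<exists>i<s. q i * of_nat (Es i t) \<noteq> 0"
    proof (rule ccontr)
      assume "\<not> ?thesis"
      then have "(\<Sum>j<s. q j * of_nat (Es j t)) = 0" by (intro sum.neutral) auto
      then show False using eq[of t] False by simp
    qed
    then obtain i where i: "i < s" "q i * of_nat (Es i t) \<noteq> 0" by (elim exE conjE)
    have "0 \<le> q i" using q i(1) by blast
    moreover have "q i \<noteq> 0" "(of_nat (Es i t) :: rat) \<noteq> 0"
      using i(2) unfolding mult_eq_0_iff by blast+
    ultimately have "q i > 0" "Es i t \<noteq> 0" by simp_all
    then have "z i [^] Es i t = \<zero>" by (simp add: z_def pow)
    then have "(\<Otimes>j\<in>{..<s}. z j [^] Es j t) = \<zero>"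
      by (intro fin0[of "{..<s}" "\<lambda>j. z j [^] Es j t" i]) (simp_all add: i(1) zc)
    with False show ?thesis by (simp add: pow)
  qed
  with zc that show ?thesis by blast
qed

lemma F_pi_essentially_surjective:
  assumes roots: "roots_exist K"
    and fg: "finitely_generated_monoid TYPE('t)" and free: "free_of_finite_rank TYPE('t groth)"
    and gen: "generates_rational_cone s Es" and x: "x \<in> Z_ob r \<phi> K"
  shows "\<exists>y\<in>F_ob r \<phi> s Es K. X_arrow r (\<lambda>c. c) K K (F_pi r \<phi> s Es K y) x"
proof -
  obtain V a where xe: "x = (V, a)" by (cases x)
  note X = Z_ob_X_ob[OF x, unfolded xe]
  obtain e where e: "e \<in> frames r V" by (rule X_ob_frame[OF X])
  obtain l :: "'t groth \<Rightarrow> 'k" and E where l: "\<And>x. l x \<in> Units K" "\<And>x y. l (x + y) = l x \<otimes> l y"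
    and E: "E \<in> dual_monoid" and eq: "\<And>t. a t e = l (of_monoid t) \<otimes> \<zero> [^] E t"
    using integral_decomposition[OF roots fg free X_ob_coordinates[OF X e]
        Z_ob_respects_int[OF x[unfolded xe]]] by metis
  obtain z where z: "\<And>j. j < s \<Longrightarrow> z j \<in> carrier K"
    and zE: "\<And>t. \<zero> [^] E t = (\<Otimes>j\<in>{..<s}. z j [^] Es j t)"
    by (rule power_zero_finprod[OF E gen]) blast
  have "\<exists>y\<in>F_ob r \<phi> s Es K. F_pi r \<phi> s Es K y = trivial_X_obj r \<phi> K (\<lambda>t. a t e)"
  proof (rule trivial_F_ob[OF l, of z])
    show "a t e = l (of_monoid t) \<otimes> (\<Otimes>j\<in>{..<s}. z j [^] Es j t)" for t
      by (simp only: eq zE)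
  qed (rule z)
  then obtain y where y: "y \<in> F_ob r \<phi> s Es K" "F_pi r \<phi> s Es K y = trivial_X_obj r \<phi> K (\<lambda>t. a t e)" ..
  show ?thesis using y X_arrow_from_trivial[OF X e] unfolding xe by metis
qed

end

section \<open>Extensions with roots inside an infinite type\<close>

lemma card_lists_infinite:
  assumes inf: "infinite (UNIV :: 'u set)"
  shows "|UNIV :: 'u list set| \<le>o |UNIV :: 'u set|"
proof -
  have "|{xs :: 'u list. length xs = n}| \<le>o |UNIV :: 'u set|" for n
  proof (induction n)
    case 0
    have "|{[] :: 'u list}| \<le>o |UNIV :: 'u set|" by (rule card_of_singl_ordLeq) simp
    then show ?case by simp
  next
    case (Suc n)
    have eq: "{xs :: 'u list. length xs = Suc n} = (\<lambda>(x, xs). x # xs) ` (UNIV \<times> {xs. length xs = n})"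
      by (auto simp: length_Suc_conv image_iff)
    have "|{xs :: 'u list. length xs = Suc n}| \<le>o |(UNIV :: 'u set) \<times> {xs :: 'u list. length xs = n}|"
      unfolding eq by (rule card_of_image)
    also have "|(UNIV :: 'u set) \<times> {xs :: 'u list. length xs = n}| \<le>o |(UNIV :: 'u set) \<times> (UNIV :: 'u set)|"
      by (rule card_of_Times_mono2[OF Suc])
    also have "|(UNIV :: 'u set) \<times> (UNIV :: 'u set)| =o |UNIV :: 'u set|"
      by (rule card_of_Times_same_infinite[OF inf])
    finally show ?case .
  qed
  moreover have "|UNIV :: nat set| \<le>o |UNIV :: 'u set|"
    using inf by (simp add: infinite_iff_card_of_nat)
  ultimately have "|\<Union>n\<in>UNIV. {xs :: 'u list. length xs = n}| \<le>o |UNIV :: 'u set|"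
    using inf by (intro card_of_UNION_ordLeq_infinite) auto
  also have "(\<Union>n\<in>UNIV. {xs :: 'u list. length xs = n}) = UNIV" by auto
  finally show ?thesis .
qed

lemma finite_card_ordLeq:
  assumes "finite A" "infinite B"
  shows "|A| \<le>o |B|"
  using assms card_of_ordLeq_finite card_of_Well_order ordLeq_total by metis

text \<open>Every element is one of the finitely many roots of a polynomial, and polynomials are finite sequences.\<close>

lemma algebraic_extension_card:
  fixes K :: "'u ring" and L :: "'l ring"
  assumes inf: "infinite (UNIV :: 'u set)" and K: "field K"
    and L: "algebraic_closure L (h ` carrier K)"
  shows "|carrier L| \<le>o |UNIV :: 'u set|"
proof -
  interpret algebraic_closure L "h ` carrier K" by fact
  define A where "A q = (if map h q \<in> carrier (poly_ring L) then {x. is_root (map h q) x} else {})" for q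
  have "carrier L \<subseteq> (\<Union>q\<in>UNIV. A q)"
  proof
    fix x assume x: "x \<in> carrier L"
    have sub: "subring (h ` carrier K) L" by (rule subfieldE(1)[OF subfield_axioms])
    obtain p where p: "p \<in> carrier ((h ` carrier K)[X]\<^bsub>L\<^esub>)" "p \<noteq> []" "eval p x = \<zero>\<^bsub>L\<^esub>"
      by (rule algebraicE[OF sub x algebraic_extension[OF x]])
    have poly: "polynomial\<^bsub>L\<^esub> (h ` carrier K) p" using p(1) by (simp add: univ_poly_carrier)
    then have "set p \<subseteq> h ` carrier K" by (auto simp: polynomial_def)
    then obtain q where q: "p = map h q"
      by (metis (no_types, lifting) ex_map_conv image_iff subset_iff)
    have "polynomial\<^bsub>L\<^esub> (carrier L) p"
      using poly subringE(1)[OF sub] by (auto simp: polynomial_def)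
    then have "map h q \<in> carrier (poly_ring L)" by (simp add: univ_poly_carrier q)
    then have "x \<in> A q" using p x by (simp add: A_def is_root_def q)
    then show "x \<in> (\<Union>q\<in>UNIV. A q)" by blast
  qed
  then have "|carrier L| \<le>o |\<Union>q\<in>UNIV. A q|" by (rule card_of_mono1)
  also have "|\<Union>q\<in>UNIV. A q| \<le>o |UNIV :: 'u set|"
  proof (rule card_of_UNION_ordLeq_infinite[OF inf card_lists_infinite[OF inf]])
    have "finite (A q)" for q unfolding A_def using finite_number_of_roots by auto
    then show "\<forall>q\<in>UNIV. |A q| \<le>o |UNIV :: 'u set|" using finite_card_ordLeq inf by blast
  qed
  finally show ?thesis .
qed

text \<open>The algebraic closure lives in another type; by its cardinality it can be copied into \<open>'u\<close>.\<close>

lemma root_closed_extension_exists: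
  fixes K :: "'u ring"
  assumes inf: "infinite (UNIV :: 'u set)" and K: "field K"
  obtains L :: "'u ring" and h where "field L" "roots_exist L" "h \<in> ring_hom K L"
proof -
  interpret K: field K by fact
  define M where "M = K.alg_closure"
  have M: "algebraic_closure M (K.indexed_const ` carrier K)" and i: "K.indexed_const \<in> ring_hom K M"
    unfolding M_def by (rule K.alg_closureE)+
  interpret M: algebraic_closure M "K.indexed_const ` carrier K" by fact
  from algebraic_extension_card[OF inf K M] obtain f :: "_ \<Rightarrow> 'u" where f: "inj_on f (carrier M)"
    unfolding card_of_ordLeq[symmetric] by blast
  define L where "L = image_ring f M"
  have L: "field L" unfolding L_def by (rule M.inj_imp_image_ring_is_field[OF f])
  have iso: "f \<in> ring_iso M L" unfolding L_def by (rule inj_imp_image_ring_iso[OF f])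
  then have hom: "f \<in> ring_hom M L" and car: "f ` carrier M = carrier L"
    by (auto simp: ring_iso_def bij_betw_def)
  have "roots_exist L"
    unfolding roots_exist_def
  proof (intro allI impI ballI)
    fix n :: nat and c assume n: "n > 0" and "c \<in> carrier L"
    then obtain c' where c': "c' \<in> carrier M" "c = f c'" using car by auto
    obtain b where b: "b \<in> carrier M" "b [^]\<^bsub>M\<^esub> n = c'"
      using algebraically_closed_roots_exist[OF M.algebraically_closed_axioms] n c'(1)
      unfolding roots_exist_def by blast
    have "f b [^]\<^bsub>L\<^esub> n = c"
      using hom_fields_nat_pow[OF M.field_axioms L hom b(1), of n] b(2) c'(2) by simp
    then show "\<exists>b\<in>carrier L. b [^]\<^bsub>L\<^esub> n = c" using ring_hom_closed[OF hom b(1)] by blast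
  qed
  moreover have "f \<circ> K.indexed_const \<in> ring_hom K L" by (rule ring_hom_trans[OF i hom])
  ultimately show ?thesis using L that by blast
qed

section \<open>Prime fields\<close>

text \<open>The multiples of the characteristic; the set \<open>{0}\<close> stands for characteristic \<open>0\<close>.\<close>

definition char_multiples :: "('k, 'b) ring_scheme \<Rightarrow> nat set" where
  "char_multiples K = {n. [n] \<cdot>\<^bsub>K\<^esub> \<one>\<^bsub>K\<^esub> = \<zero>\<^bsub>K\<^esub>}"

lemma hom_add_pow_one:
  assumes "field K" "field L" "h \<in> ring_hom K L"
  shows "h ([(n::nat)] \<cdot>\<^bsub>K\<^esub> \<one>\<^bsub>K\<^esub>) = [n] \<cdot>\<^bsub>L\<^esub> \<one>\<^bsub>L\<^esub>"
proof -
  interpret h: ring_hom_cring K L h by (rule hom_fields_ring_hom_cring[OF assms])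
  show ?thesis by (induction n) (simp_all add: ring_hom_one[OF assms(3)])
qed

lemma char_multiples_hom:
  assumes "field K" "field L" "h \<in> ring_hom K L"
  shows "char_multiples K = char_multiples L"
proof -
  interpret h: ring_hom_cring K L h by (rule hom_fields_ring_hom_cring[OF assms])
  have "[n] \<cdot>\<^bsub>K\<^esub> \<one>\<^bsub>K\<^esub> = \<zero>\<^bsub>K\<^esub> \<longleftrightarrow> [n] \<cdot>\<^bsub>L\<^esub> \<one>\<^bsub>L\<^esub> = \<zero>\<^bsub>L\<^esub>" for n :: nat
    using inj_onD[OF hom_fields_inj[OF assms], of "[n] \<cdot>\<^bsub>K\<^esub> \<one>\<^bsub>K\<^esub>" "\<zero>\<^bsub>K\<^esub>"]
    unfolding hom_add_pow_one[OF assms, symmetric] by auto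
  then show ?thesis by (simp add: char_multiples_def)
qed

lemma char_multiples_rat: "char_multiples (ring_of_type_algebra :: rat ring) = {0}"
proof -
  interpret Q: field "ring_of_type_algebra :: rat ring" by (rule field_from_type_algebra)
  have "[n] \<cdot>\<^bsub>ring_of_type_algebra\<^esub> \<one>\<^bsub>ring_of_type_algebra\<^esub> = (of_nat n :: rat)" for n :: nat
  proof (induction n)
    case 0
    then show ?case by (simp add: ring_of_type_algebra_def add_pow_def)
  next
    case (Suc n)
    then have "[Suc n] \<cdot>\<^bsub>ring_of_type_algebra\<^esub> \<one>\<^bsub>ring_of_type_algebra\<^esub> =
        (of_nat n :: rat) \<oplus>\<^bsub>ring_of_type_algebra\<^esub> \<one>\<^bsub>ring_of_type_algebra\<^esub>"
      by simp
    then show ?case by (simp add: ring_of_type_algebra_def)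
  qed
  then show ?thesis by (auto simp: char_multiples_def) (simp_all add: ring_of_type_algebra_def)
qed

lemma char_multiples_residue:
  assumes p: "Factorial_Ring.prime (p::nat)" and F: "field (residue_ring (int p))"
  shows "char_multiples (residue_ring (int p)) = {n. p dvd n}"
proof -
  interpret F: field "residue_ring (int p)" by fact
  have p1: "1 < int p" using prime_gt_1_nat[OF p] by simp
  have "[n] \<cdot>\<^bsub>residue_ring (int p)\<^esub> \<one>\<^bsub>residue_ring (int p)\<^esub> = int n mod int p" for n :: nat
  proof (induction n)
    case 0
    then show ?case by (simp add: residue_ring_def add_pow_def)
  next
    case (Suc n)
    have "[Suc n] \<cdot>\<^bsub>residue_ring (int p)\<^esub> \<one>\<^bsub>residue_ring (int p)\<^esub> =
        (int n mod int p) \<oplus>\<^bsub>residue_ring (int p)\<^esub> \<one>\<^bsub>residue_ring (int p)\<^esub>"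
      using Suc by simp
    then show ?case by (simp add: residue_ring_def mod_simps ac_simps)
  qed
  then show ?thesis
    by (auto simp: char_multiples_def) (simp_all add: residue_ring_def flip: zmod_int dvd_eq_mod_eq_0)
qed

context base_field
begin

definition int_image :: "int \<Rightarrow> 'k" where
  "int_image z = [z] \<cdot>\<^bsub>K\<^esub> \<one>"

lemma int_image_closed [simp]: "int_image z \<in> carrier K"
  by (simp add: int_image_def)

lemma int_image_add: "int_image (x + y) = int_image x \<oplus> int_image y"
  by (simp add: int_image_def add.int_pow_mult)

lemma int_image_mult: "int_image (x * y) = int_image x \<otimes> int_image y"
proof -
  have "int_image x \<otimes> int_image y = [x] \<cdot>\<^bsub>K\<^esub> ([y] \<cdot>\<^bsub>K\<^esub> \<one>)"
    unfolding int_image_def by (subst add_pow_ldistr_int) simp_all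
  also have "\<dots> = int_image (x * y)"
    unfolding int_image_def by (simp add: add.int_pow_pow mult.commute)
  finally show ?thesis ..
qed

lemma int_image_nat: "int_image (int n) = [n] \<cdot>\<^bsub>K\<^esub> \<one>"
  by (simp add: int_image_def add_pow_def int_pow_int)

lemma int_image_0 [simp]: "int_image 0 = \<zero>"
  using int_image_nat[of 0] by simp

lemma int_image_1 [simp]: "int_image 1 = \<one>"
  using int_image_nat[of 1] by simp

lemma int_image_neg: "int_image (- z) = \<ominus> int_image z"
  using int_image_add[of "- z" z] by (intro minus_equality[symmetric]) simp_all

lemma char_multiples_int: "int_image z = \<zero> \<longleftrightarrow> nat \<bar>z\<bar> \<in> char_multiples K"
proof (cases "z \<ge> 0")
  case True
  then show ?thesis using int_image_nat[of "nat z"] by (simp add: char_multiples_def)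
next
  case False
  then have "int_image (- z) = \<zero> \<longleftrightarrow> nat \<bar>z\<bar> \<in> char_multiples K"
    using int_image_nat[of "nat (- z)"] by (simp add: char_multiples_def)
  moreover have "int_image (- z) = \<zero> \<longleftrightarrow> int_image z = \<zero>"
    using int_image_neg[of z] int_image_neg[of "- z"] by auto
  ultimately show ?thesis by simp
qed

text \<open>Nonzero integers are invertible in \<open>K\<close>, so \<open>a / b \<mapsto> a b\<^sup>-\<^sup>1\<close> is defined and independent of the
  representation of the fraction.\<close>

lemma rat_hom_exists:
  assumes "char_multiples K = {0}"
  shows "\<exists>\<rho>. \<rho> \<in> ring_hom (ring_of_type_algebra :: rat ring) K"
proof -
  have U: "int_image z \<in> Units K" if "z \<noteq> 0" for z
    using char_multiples_int[of z] assms that by (simp add: unit_iff)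
  define \<rho> where "\<rho> q = int_image (fst (quotient_of q)) \<otimes> inv (int_image (snd (quotient_of q)))" for q
  have \<rho>: "\<rho> (Rat.Fract a b) = int_image a \<otimes> inv (int_image b)" if b: "b \<noteq> 0" for a b
  proof -
    obtain p d where pd: "quotient_of (Rat.Fract a b) = (p, d)" by (cases "quotient_of (Rat.Fract a b)")
    have d: "d > 0" using quotient_of_denom_pos[OF pd] .
    have "Rat.Fract p d = Rat.Fract a b" by (rule quotient_of_eq[OF pd])
    then have "p * b = a * d" using b d by (simp add: eq_rat)
    then have eq: "int_image p \<otimes> int_image b = int_image a \<otimes> int_image d"
      by (metis int_image_mult)
    have Ub: "int_image b \<in> Units K" and Ud: "int_image d \<in> Units K" using U b d by auto
    have "int_image p \<otimes> inv (int_image d) =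
        int_image p \<otimes> int_image b \<otimes> inv (int_image b) \<otimes> inv (int_image d)"
      using Ub Ud by (simp add: m_assoc)
    also have "\<dots> = int_image a \<otimes> (int_image d \<otimes> inv (int_image d)) \<otimes> inv (int_image b)"
      unfolding eq using Ub Ud by (simp add: m_ac del: Units_r_inv)
    also have "\<dots> = int_image a \<otimes> inv (int_image b)" using Ud by simp
    finally show ?thesis by (simp add: \<rho>_def pd)
  qed
  have rat: "\<exists>a b. q = Rat.Fract a b \<and> b \<noteq> 0" for q
    using quotient_of_denom_pos'[of q] Fract_quotient_of[of q] by (metis less_irrefl)
  have "\<rho> \<in> ring_hom (ring_of_type_algebra :: rat ring) K"
  proof (rule ring_hom_memI)
    show "\<rho> q \<in> carrier K" for q using rat[of q] \<rho> U by auto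
    show "\<rho> \<one>\<^bsub>ring_of_type_algebra\<^esub> = \<one>"
      using \<rho>[of 1 1] by (simp add: ring_of_type_algebra_def flip: One_rat_def)
    fix x y :: rat
    obtain a b where x: "x = Rat.Fract a b" "b \<noteq> 0" using rat by blast
    obtain c d where y: "y = Rat.Fract c d" "d \<noteq> 0" using rat by blast
    note U = U[OF x(2)] U[OF y(2)]
    have bd: "b * d \<noteq> 0" using x y by simp
    have "\<rho> (x * y) = \<rho> x \<otimes> \<rho> y"
      using U by (simp add: x(1) y(1) \<rho>[OF bd] \<rho>[OF x(2)] \<rho>[OF y(2)] int_image_mult inv_mult m_ac)
    then show "\<rho> (x \<otimes>\<^bsub>ring_of_type_algebra\<^esub> y) = \<rho> x \<otimes> \<rho> y" by (simp add: ring_of_type_algebra_def)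
    have "\<rho> (x + y) = int_image (a * d + c * b) \<otimes> inv (int_image (b * d))"
      using x y by (simp add: \<rho>[OF bd])
    also have "\<dots> = int_image a \<otimes> inv (int_image b) \<otimes> (int_image d \<otimes> inv (int_image d)) \<oplus>
        int_image c \<otimes> inv (int_image d) \<otimes> (int_image b \<otimes> inv (int_image b))"
      using U by (simp add: int_image_mult int_image_add inv_mult r_distr m_ac del: Units_r_inv)
    also have "\<dots> = \<rho> x \<oplus> \<rho> y" using U by (simp add: x(1) y(1) \<rho>[OF x(2)] \<rho>[OF y(2)])
    finally show "\<rho> (x \<oplus>\<^bsub>ring_of_type_algebra\<^esub> y) = \<rho> x \<oplus> \<rho> y" by (simp add: ring_of_type_algebra_def)
  qed
  then show ?thesis by (rule exI[of _ \<rho>])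
qed

text \<open>The least positive element of \<open>char_multiples K\<close> is a prime \<open>p\<close>, as \<open>K\<close> has no zero divisors, and
  reduction modulo \<open>p\<close> does not change the image in \<open>K\<close>.\<close>

lemma residue_hom_exists:
  assumes "char_multiples K \<noteq> {0}"
  shows "\<exists>p \<rho>. Factorial_Ring.prime (p::nat) \<and> \<rho> \<in> ring_hom (residue_ring (int p)) K"
proof -
  have 0: "0 \<in> char_multiples K" by (simp add: char_multiples_def)
  define p where "p = (LEAST n. n > 0 \<and> n \<in> char_multiples K)"
  have ex: "\<exists>n. n > 0 \<and> n \<in> char_multiples K" using assms 0 by auto
  have p: "p > 0" "p \<in> char_multiples K" using LeastI_ex[OF ex] unfolding p_def by auto
  have least: "n = 0" if "n \<in> char_multiples K" "n < p" for n
    using that not_less_Least[of n "\<lambda>n. n > 0 \<and> n \<in> char_multiples K"] unfolding p_def by auto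
  have Ip: "int_image (int p) = \<zero>" using p(2) by (simp add: char_multiples_int)
  have mod: "int_image (z mod int p) = int_image z" for z
  proof -
    have "int_image z = int_image (z div int p * int p + z mod int p)" by simp
    also have "\<dots> = int_image (z mod int p)" unfolding int_image_add int_image_mult Ip by simp
    finally show ?thesis ..
  qed
  have "Factorial_Ring.prime p"
  proof (rule ccontr)
    assume np: "\<not> Factorial_Ring.prime p"
    have "1 \<notin> char_multiples K" using char_multiples_int[of 1] by simp
    then have "p \<noteq> 1" using p(2) by metis
    then have "1 < p" using p(1) by simp
    with np obtain a where a: "a dvd p" "a \<noteq> 1" "a \<noteq> p" by (auto simp: prime_nat_iff)
    then obtain b where ab: "p = a * b" by (auto simp: dvd_def)
    have pos: "0 < a" "0 < b" using ab p(1) by (auto intro: Nat.gr0I)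
    have "a \<le> p" by (rule dvd_imp_le[OF a(1) p(1)])
    with a(3) have "a < p" by linarith
    have "1 < a" using pos(1) a(2) by linarith
    with pos(2) have "b < p" unfolding ab by simp
    note lt = pos \<open>a < p\<close> \<open>b < p\<close>
    have "int_image (int a) \<otimes> int_image (int b) = \<zero>"
      using Ip by (simp add: ab flip: int_image_mult)
    then have "int_image (int a) = \<zero> \<or> int_image (int b) = \<zero>" by (simp add: nonzero_mult_iff)
    then show False using least[of a] least[of b] lt by (auto simp: char_multiples_int)
  qed
  moreover have "int_image \<in> ring_hom (residue_ring (int p)) K"
    by (rule ring_hom_memI) (simp_all add: residue_ring_def mod int_image_add int_image_mult)
  ultimately show ?thesis by blast
qed

end

section \<open>Points of the stacks\<close>

text \<open>The relation whose transitive closure is \<open>point_equiv\<close>.\<close>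

definition common_extension ::
  "('u ring \<Rightarrow> 'x set) \<Rightarrow> (('u \<Rightarrow> 'u) \<Rightarrow> 'u ring \<Rightarrow> 'u ring \<Rightarrow> 'x \<Rightarrow> 'x \<Rightarrow> bool) \<Rightarrow>
    (('u ring \<times> 'x) \<times> ('u ring \<times> 'x)) set" where
  "common_extension ob arr = {((K, x), (K', x')). (K, x) \<in> field_points ob \<and> (K', x') \<in> field_points ob \<and>
    (\<exists>L y h h'. (L, y) \<in> field_points ob \<and> h \<in> ring_hom K L \<and> h' \<in> ring_hom K' L \<and>
      arr h K L x y \<and> arr h' K' L x' y)}"

lemma point_equiv_trancl: "point_equiv ob arr = (common_extension ob arr)\<^sup>+"
  unfolding point_equiv_def common_extension_def ..

lemma common_extensionE:
  assumes "((K, x), (K', x')) \<in> common_extension ob arr"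
  obtains L y h h' where "(K, x) \<in> field_points ob" "(K', x') \<in> field_points ob" "(L, y) \<in> field_points ob"
    "h \<in> ring_hom K L" "h' \<in> ring_hom K' L" "arr h K L x y" "arr h' K' L x' y"
  using assms unfolding common_extension_def by blast

lemma common_extensionI:
  assumes "(K, x) \<in> field_points ob" "(K', x') \<in> field_points ob" "(L, y) \<in> field_points ob"
    "h \<in> ring_hom K L" "h' \<in> ring_hom K' L" "arr h K L x y" "arr h' K' L x' y"
  shows "((K, x), (K', x')) \<in> common_extension ob arr"
  using assms unfolding common_extension_def by blast

lemma point_equiv_equiv:
  assumes refl: "\<And>K x. field K \<Longrightarrow> x \<in> ob K \<Longrightarrow> arr (\<lambda>c. c) K K x x"
  shows "equiv (field_points ob) (point_equiv ob arr)"
proof -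
  define R where "R = common_extension ob arr"
  have pe: "point_equiv ob arr = R\<^sup>+" by (simp add: point_equiv_trancl R_def)
  have sub: "R \<subseteq> field_points ob \<times> field_points ob" by (auto simp: R_def common_extension_def)
  have "sym R" unfolding sym_def R_def common_extension_def by blast
  then have "sym (R\<^sup>+)" by (rule sym_trancl)
  moreover have "refl_on (field_points ob) (R\<^sup>+)"
  proof (rule refl_onI)
    fix p assume p: "p \<in> field_points ob"
    obtain K x where Kx: "p = (K, x)" by (cases p)
    then have "arr (\<lambda>c. c) K K x x" using refl p by (auto simp: field_points_def)
    then have "(p, p) \<in> R"
      using p id_ring_hom[of K, unfolded id_def] unfolding R_def Kx by (intro common_extensionI)
    then show "(p, p) \<in> R\<^sup>+" by (rule r_into_trancl)
  qed
  moreover have "R\<^sup>+ \<subseteq> field_points ob \<times> field_points ob" by (rule trancl_subset_Sigma[OF sub])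
  ultimately show ?thesis unfolding pe equiv_def by (auto simp: trans_trancl)
qed

text \<open>The target of the arrow serves as the common extension.\<close>

lemma point_equiv_arrow:
  assumes "(K, x) \<in> field_points ob" "(L, y) \<in> field_points ob" "h \<in> ring_hom K L"
    "arr h K L x y" "arr (\<lambda>c. c) L L y y"
  shows "((K, x), (L, y)) \<in> point_equiv ob arr"
  unfolding point_equiv_trancl
  by (rule r_into_trancl) (rule common_extensionI[where ob = ob and arr = arr, OF assms(1,2,2,3) id_ring_hom[unfolded id_def] assms(4,5)])

lemma point_equiv_invariant:
  assumes inv: "\<And>K L x y h. (K, x) \<in> field_points ob \<Longrightarrow> (L, y) \<in> field_points ob \<Longrightarrow>
      h \<in> ring_hom K L \<Longrightarrow> arr h K L x y \<Longrightarrow> f (K, x) = f (L, y)"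
    and pq: "(p, q) \<in> point_equiv ob arr"
  shows "f p = f q"
  using pq unfolding point_equiv_trancl
proof (induction rule: trancl_induct)
  have inv_step: "f q = f w" if "(q, w) \<in> common_extension ob arr" for q w
  proof -
    obtain K x K' x' where q: "q = (K, x)" and w: "w = (K', x')" by (cases q, cases w)
    from that[unfolded q w] show ?thesis
    proof (rule common_extensionE)
      fix L y h h'
      assume *: "(K, x) \<in> field_points ob" "(K', x') \<in> field_points ob" "(L, y) \<in> field_points ob"
        "h \<in> ring_hom K L" "h' \<in> ring_hom K' L" "arr h K L x y" "arr h' K' L x' y"
      show ?thesis unfolding q w inv[OF *(1,3,4,6)] inv[OF *(2,3,5,7)] ..
    qed
  qed
  { case (base q) then show ?case by (rule inv_step) }
  { case (step q w) then show ?case using inv_step by metis }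
qed

lemma point_equiv_map:
  assumes ob: "\<And>K x. field K \<Longrightarrow> x \<in> ob K \<Longrightarrow> F K x \<in> ob' K"
    and arr: "\<And>K L x y h. field K \<Longrightarrow> field L \<Longrightarrow> x \<in> ob K \<Longrightarrow> y \<in> ob L \<Longrightarrow> h \<in> ring_hom K L \<Longrightarrow>
      arr h K L x y \<Longrightarrow> arr' h K L (F K x) (F L y)"
    and pq: "((K, x), (K', x')) \<in> point_equiv ob arr"
  shows "((K, F K x), (K', F K' x')) \<in> point_equiv ob' arr'"
proof -
  define G where "G p = (fst p, F (fst p) (snd p))" for p
  have fp: "(K, F K x) \<in> field_points ob'" if "(K, x) \<in> field_points ob" for K x
    using that ob by (auto simp: field_points_def)
  have arr': "arr' h K L (F K x) (F L y)"
    if "(K, x) \<in> field_points ob" "(L, y) \<in> field_points ob" "h \<in> ring_hom K L" "arr h K L x y" for K L x y h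
    using that arr by (auto simp: field_points_def)
  have step: "(G p, G q) \<in> common_extension ob' arr'" if "(p, q) \<in> common_extension ob arr" for p q
  proof -
    obtain K x K' x' where p: "p = (K, x)" and q: "q = (K', x')" by (cases p, cases q)
    from that[unfolded p q] show ?thesis
    proof (rule common_extensionE)
      fix L y h h'
      assume *: "(K, x) \<in> field_points ob" "(K', x') \<in> field_points ob" "(L, y) \<in> field_points ob"
        "h \<in> ring_hom K L" "h' \<in> ring_hom K' L" "arr h K L x y" "arr h' K' L x' y"
      show ?thesis
        unfolding G_def p q fst_conv snd_conv
        by (rule common_extensionI[where ob = ob' and arr = arr', OF fp[OF *(1)] fp[OF *(2)] fp[OF *(3)] *(4,5)
              arr'[OF *(1,3,4,6)] arr'[OF *(2,3,5,7)]])
    qed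
  qed
  have "(G p, G q) \<in> (common_extension ob' arr')\<^sup>+" if "(p, q) \<in> (common_extension ob arr)\<^sup>+" for p q
    using that
  proof (induction rule: trancl_induct)
    case (base q)
    then show ?case by (intro r_into_trancl step)
  next
    case (step q w)
    from step(3) \<open>\<And>p q. (p, q) \<in> common_extension ob arr \<Longrightarrow> _\<close>[OF step(2)] show ?case
      by (rule trancl_into_trancl)
  qed
  from this[OF pq[unfolded point_equiv_trancl]] show ?thesis
    by (simp add: point_equiv_trancl G_def)
qed

lemma quotient_map_exists:
  assumes R: "equiv A R" and S: "equiv B S"
    and f: "\<And>x y. (x, y) \<in> R \<Longrightarrow> (f x, f y) \<in> S"
  shows "\<exists>g. \<forall>x\<in>A. g (R `` {x}) = S `` {f x}"
proof -
  define g where "g C = S `` {f (SOME x. x \<in> C)}" for C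
  have "g (R `` {x}) = S `` {f x}" if x: "x \<in> A" for x
  proof -
    have "x \<in> R `` {x}" by (rule equiv_class_self[OF R x])
    then have "(SOME y. y \<in> R `` {x}) \<in> R `` {x}" by (rule someI)
    then have "(f x, f (SOME y. y \<in> R `` {x})) \<in> S" using f by blast
    then show ?thesis unfolding g_def using equiv_class_eq[OF S] by metis
  qed
  then show ?thesis by blast
qed

locale graded_monoid =
  fixes r :: nat and \<phi> :: "'t::comm_monoid_add \<Rightarrow> nat \<Rightarrow> int"
  assumes fg: "finitely_generated_monoid TYPE('t)"
    and free: "free_of_finite_rank TYPE('t groth)"
    and grading: "\<forall>i<r. monoid_map (\<lambda>t. \<phi> t i)"
begin

lemma graded_fieldI: "field K \<Longrightarrow> graded_field K r \<phi>"
  by (simp add: graded_field_def base_field_def graded_field_axioms_def grading)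

lemma dual_familyI: "field K \<Longrightarrow> \<forall>j<s. Es j \<in> dual_monoid \<Longrightarrow> dual_family K r \<phi> s Es"
  by (simp add: dual_family_def dual_family_axioms_def graded_fieldI)

lemma Z_arrow_refl: "field K \<Longrightarrow> x \<in> Z_ob r \<phi> K \<Longrightarrow> X_arrow r (\<lambda>c. c) K K x x"
  using graded_field.X_arrow_refl[OF graded_fieldI] graded_field.Z_ob_X_ob[OF graded_fieldI] by blast

lemma Z_equiv: "equiv (field_points (Z_ob r \<phi>)) (Z_point_equiv r \<phi>)"
  unfolding Z_point_equiv_def by (rule point_equiv_equiv) (rule Z_arrow_refl)

lemma Z_pointI: "field K \<Longrightarrow> x \<in> Z_ob r \<phi> K \<Longrightarrow> (K, x) \<in> field_points (Z_ob r \<phi>)"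
  by (simp add: field_points_def)

lemma Z_point_arrow:
  assumes "field K" "x \<in> Z_ob r \<phi> K" "field L" "y \<in> Z_ob r \<phi> L" "h \<in> ring_hom K L" "X_arrow r h K L x y"
  shows "((K, x), (L, y)) \<in> Z_point_equiv r \<phi>"
  unfolding Z_point_equiv_def
  using assms by (intro point_equiv_arrow[where h = h]) (auto intro: Z_pointI Z_arrow_refl)

lemma Z_point_sym: "(p, q) \<in> Z_point_equiv r \<phi> \<Longrightarrow> (q, p) \<in> Z_point_equiv r \<phi>"
  and Z_point_trans: "(p, q) \<in> Z_point_equiv r \<phi> \<Longrightarrow> (q, w) \<in> Z_point_equiv r \<phi> \<Longrightarrow> (p, w) \<in> Z_point_equiv r \<phi>"
  using Z_equiv unfolding equiv_def by (blast dest: symD transD)+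

text \<open>Both are preserved by every arrow between objects over fields.\<close>

lemma Z_point_invariants:
  assumes "((K, x), (L, y)) \<in> Z_point_equiv r \<phi>"
  shows "char_multiples K = char_multiples L" "zero_set r \<phi> K x = zero_set r \<phi> L y"
proof -
  have "(\<lambda>(K, x). (char_multiples K, zero_set r \<phi> K x)) (K, x) =
      (\<lambda>(K, x). (char_multiples K, zero_set r \<phi> K x)) (L, y)"
  proof (rule point_equiv_invariant[OF _ assms[unfolded Z_point_equiv_def]])
    fix K L :: "'a ring" and x y h
    assume "(K, x) \<in> field_points (Z_ob r \<phi>)" "(L, y) \<in> field_points (Z_ob r \<phi>)"
      and h: "h \<in> ring_hom K L" and arr: "X_arrow r h K L x y"
    then have *: "field K" "field L" "x \<in> Z_ob r \<phi> K" "y \<in> Z_ob r \<phi> L" by (auto simp: field_points_def)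
    note G = graded_fieldI[OF *(1)] graded_fieldI[OF *(2)]
    show "(case (K, x) of (K, x) \<Rightarrow> (char_multiples K, zero_set r \<phi> K x)) =
        (case (L, y) of (K, x) \<Rightarrow> (char_multiples K, zero_set r \<phi> K x))"
      using char_multiples_hom[OF *(1,2) h] X_arrow_zero_set[OF G h _ _ arr]
        graded_field.Z_ob_X_ob[OF G(1) *(3)] graded_field.Z_ob_X_ob[OF G(2) *(4)] by simp
  qed
  then show "char_multiples K = char_multiples L" "zero_set r \<phi> K x = zero_set r \<phi> L y" by auto
qed

text \<open>The pullback can be taken with trivial lines, using a frame of the given ones.\<close>

lemma Z_base_change:
  assumes K: "field K" and L: "field L" and h: "h \<in> ring_hom K L" and x: "x \<in> Z_ob r \<phi> K"
  obtains y where "y \<in> Z_ob r \<phi> L" "X_arrow r h K L x y"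
proof -
  interpret K: graded_field K r \<phi> by (rule graded_fieldI[OF K])
  interpret L: graded_field L r \<phi> by (rule graded_fieldI[OF L])
  obtain V a where xe: "x = (V, a)" by (cases x)
  note Z = x[unfolded xe] and X = K.Z_ob_X_ob[OF x, unfolded xe]
  obtain e where e: "e \<in> frames r V" by (rule K.X_ob_frame[OF X])
  have "respects_int (\<lambda>t. h (a t e))"
    using K.Z_ob_respects_int[OF Z, of e] unfolding respects_int_def by metis
  then have "trivial_X_obj r \<phi> L (\<lambda>t. h (a t e)) \<in> Z_ob r \<phi> L"
    by (rule L.trivial_Z_ob[OF mult_monoid_map_hom[OF K.X_ob_coordinates[OF X e] h]])
  moreover have "X_arrow r h K L x (trivial_X_obj r \<phi> L (\<lambda>t. h (a t e)))"
    unfolding xe by (rule X_arrow_base_change[OF K.graded_field_axioms L.graded_field_axioms h X e])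
  ultimately show ?thesis by (rule that)
qed

lemma F_pi_points_surjective:
  assumes Es: "\<forall>j<s. Es j \<in> dual_monoid" and gen: "generates_rational_cone s Es"
    and inf: "infinite (UNIV :: 'u set)"
    and K: "field (K :: 'u ring)" and x: "x \<in> Z_ob r \<phi> K"
  shows "\<exists>(L :: 'u ring) y. field L \<and> y \<in> F_ob r \<phi> s Es L \<and> ((L, F_pi r \<phi> s Es L y), (K, x)) \<in> Z_point_equiv r \<phi>"
proof -
  obtain L :: "'u ring" and h where L: "field L" "roots_exist L" and h: "h \<in> ring_hom K L"
    by (rule root_closed_extension_exists[OF inf K])
  interpret L: dual_family L r \<phi> s Es by (rule dual_familyI[OF L(1) Es])
  obtain x' where x': "x' \<in> Z_ob r \<phi> L" "X_arrow r h K L x x'" by (rule Z_base_change[OF K L(1) h x])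
  obtain y where y: "y \<in> F_ob r \<phi> s Es L" "X_arrow r (\<lambda>c. c) L L (F_pi r \<phi> s Es L y) x'"
    using L.F_pi_essentially_surjective[OF L(2) fg free gen x'(1)] by blast
  have "((L, F_pi r \<phi> s Es L y), (L, x')) \<in> Z_point_equiv r \<phi>"
    by (rule Z_point_arrow[OF L(1) L.F_pi_Z_ob[OF y(1)] L(1) x'(1) id_ring_hom[unfolded id_def] y(2)])
  moreover have "((K, x), (L, x')) \<in> Z_point_equiv r \<phi>"
    by (rule Z_point_arrow[OF K x L(1) x'(1) h x'(2)])
  ultimately show ?thesis using L(1) y(1) Z_point_sym Z_point_trans by blast
qed

text \<open>Well defined since \<open>\<pi>\<close> maps arrows to arrows; surjective since a lift exists after adjoining
  roots, which does not change the point.\<close>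

lemma F_points_map:
  fixes Es :: "nat \<Rightarrow> 't \<Rightarrow> nat"
  assumes Es: "\<forall>j<s. Es j \<in> dual_monoid" and gen: "generates_rational_cone s Es"
    and inf: "infinite (UNIV :: 'u set)"
  shows "\<exists>g :: ('u ring \<times> ('t, 'u) F_obj) set \<Rightarrow> ('u ring \<times> ('t, 'u) X_obj) set.
    (\<forall>(K, y)\<in>field_points (F_ob r \<phi> s Es).
      g (F_point_equiv r \<phi> s Es `` {(K, y)}) = Z_point_equiv r \<phi> `` {(K, F_pi r \<phi> s Es K y)}) \<and>
    g ` F_points r \<phi> s Es = Z_points r \<phi>"
proof -
  let ?A = "field_points (F_ob r \<phi> s Es) :: ('u ring \<times> ('t, 'u) F_obj) set"
  let ?B = "field_points (Z_ob r \<phi>) :: ('u ring \<times> ('t, 'u) X_obj) set"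
  let ?R = "F_point_equiv r \<phi> s Es :: (('u ring \<times> ('t, 'u) F_obj) \<times> _) set"
  let ?S = "Z_point_equiv r \<phi> :: (('u ring \<times> ('t, 'u) X_obj) \<times> _) set"
  define f where "f p = (fst p, F_pi r \<phi> s Es (fst p) (snd p))" for p :: "'u ring \<times> ('t, 'u) F_obj"
  have R: "equiv ?A ?R"
    unfolding F_point_equiv_def
    by (rule point_equiv_equiv) (rule dual_family.F_arrow_refl[OF dual_familyI[OF _ Es]])
  have fB: "f p \<in> ?B" if "p \<in> ?A" for p
    using that dual_family.F_pi_Z_ob[OF dual_familyI[OF _ Es]] by (auto simp: field_points_def f_def)
  have map: "(f p, f q) \<in> ?S" if "(p, q) \<in> ?R" for p q
  proof -
    have "((fst p, F_pi r \<phi> s Es (fst p) (snd p)), (fst q, F_pi r \<phi> s Es (fst q) (snd q)))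
        \<in> point_equiv (Z_ob r \<phi>) (X_arrow r)"
    proof (rule point_equiv_map[where ob = "F_ob r \<phi> s Es" and arr = "F_arrow r \<phi> s" and F = "F_pi r \<phi> s Es"])
      fix K :: "'u ring" and x
      assume K: "field K" "x \<in> F_ob r \<phi> s Es K"
      show "F_pi r \<phi> s Es K x \<in> Z_ob r \<phi> K"
        by (rule dual_family.F_pi_Z_ob[OF dual_familyI[OF K(1) Es] K(2)])
    next
      fix K L :: "'u ring" and x y h
      assume *: "field K" "field L" "x \<in> F_ob r \<phi> s Es K" "y \<in> F_ob r \<phi> s Es L" "h \<in> ring_hom K L"
        "F_arrow r \<phi> s h K L x y"
      show "X_arrow r h K L (F_pi r \<phi> s Es K x) (F_pi r \<phi> s Es L y)"
        by (rule F_arrow_X_arrow[OF dual_familyI[OF *(1) Es] dual_familyI[OF *(2) Es] *(5,3,4,6)])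
    next
      show "((fst p, snd p), (fst q, snd q)) \<in> point_equiv (F_ob r \<phi> s Es) (F_arrow r \<phi> s)"
        using that unfolding F_point_equiv_def by simp
    qed
    then show ?thesis unfolding f_def Z_point_equiv_def .
  qed
  have "\<exists>g. \<forall>p\<in>?A. g (?R `` {p}) = ?S `` {f p}"
    by (rule quotient_map_exists[OF R Z_equiv]) (rule map)
  then obtain g where g': "\<forall>p\<in>?A. g (?R `` {p}) = ?S `` {f p}" ..
  note g = bspec[OF g']
  have quo: "?A // ?R = (\<lambda>p. ?R `` {p}) ` ?A" "?B // ?S = (\<lambda>p. ?S `` {p}) ` ?B"
    by (auto simp: quotient_def)
  have "g ` (?A // ?R) = ?B // ?S"
  proof (intro equalityI subsetI)
    fix C assume "C \<in> g ` (?A // ?R)"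
    then obtain p where p: "p \<in> ?A" "C = g (?R `` {p})" unfolding quo by blast
    then have "C = ?S `` {f p}" using g by simp
    then show "C \<in> ?B // ?S" unfolding quo using fB[OF p(1)] by blast
  next
    fix C assume "C \<in> ?B // ?S"
    then obtain q where q: "q \<in> ?B" "C = ?S `` {q}" unfolding quo by blast
    obtain K x where Kx: "q = (K, x)" by (cases q)
    then have "field K" "x \<in> Z_ob r \<phi> K" using q(1) by (auto simp: field_points_def)
    from F_pi_points_surjective[OF Es gen inf this] obtain L :: "'u ring" and y
      where y: "field L" "y \<in> F_ob r \<phi> s Es L" "((L, F_pi r \<phi> s Es L y), (K, x)) \<in> ?S" by blast
    have A: "(L, y) \<in> ?A" using y by (simp add: field_points_def)
    have "g (?R `` {(L, y)}) = ?S `` {f (L, y)}" by (rule g[OF A])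
    also have "\<dots> = C" unfolding q(2) Kx f_def fst_conv snd_conv by (rule equiv_class_eq[OF Z_equiv y(3)])
    finally show "C \<in> g ` (?A // ?R)" unfolding quo using A by blast
  qed
  then show ?thesis
    using g unfolding F_points_def Z_points_def stack_points_def F_point_equiv_def Z_point_equiv_def f_def
    by (intro exI[of _ g]) auto
qed

text \<open>The point with zero set \<open>Supp E\<close> that is defined over the prime field.\<close>

definition std_point :: "'k ring \<Rightarrow> ('t \<Rightarrow> nat) \<Rightarrow> ('t, 'k) X_obj" where
  "std_point K E = trivial_X_obj r \<phi> K (\<lambda>t. \<zero>\<^bsub>K\<^esub> [^]\<^bsub>K\<^esub> E t)"

lemma std_point_Z_ob:
  assumes "field K" "E \<in> dual_monoid"
  shows "std_point K E \<in> Z_ob r \<phi> K" "zero_set r \<phi> K (std_point K E) = Supp E"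
proof -
  interpret K: graded_field K r \<phi> by (rule graded_fieldI[OF assms(1)])
  note p = K.power_zero_map[OF assms(2)]
  show "std_point K E \<in> Z_ob r \<phi> K" unfolding std_point_def by (rule K.trivial_Z_ob[OF p(1,2)])
  show "zero_set r \<phi> K (std_point K E) = Supp E"
    unfolding std_point_def K.trivial_zero_set[OF p(1)] by (rule p(3))
qed

lemma std_point_equiv:
  assumes K: "field K" and L: "field L" and h: "h \<in> ring_hom K L" and E: "E \<in> dual_monoid"
  shows "((K, std_point K E), (L, std_point L E)) \<in> Z_point_equiv r \<phi>"
proof -
  interpret K: graded_field K r \<phi> by (rule graded_fieldI[OF K])
  interpret L: graded_field L r \<phi> by (rule graded_fieldI[OF L])
  note p = K.power_zero_map(1)[OF E]
  note c = K.mult_monoid_map_closed[OF p]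
  have hz: "h (\<zero>\<^bsub>K\<^esub> [^]\<^bsub>K\<^esub> E t) = \<zero>\<^bsub>L\<^esub> [^]\<^bsub>L\<^esub> E t" for t
    using hom_fields_nat_pow[OF K L h, of "\<zero>\<^bsub>K\<^esub>"] ring_hom_zero[OF h K.ring_axioms L.ring_axioms] by simp
  have "X_arrow r h K L (std_point K E) (std_point L E)"
    using X_arrow_base_change[OF K.graded_field_axioms L.graded_field_axioms h
        K.trivial_X_ob[OF p, unfolded K.trivial_X_obj_eq] K.unit_frame]
    unfolding std_point_def K.trivial_X_obj_eq K.trivial_section_unit[OF c] hz .
  then show ?thesis by (intro Z_point_arrow[OF K _ L _ h] std_point_Z_ob K L E)
qed

text \<open>As \<open>\<phi>\<close> is injective, objects with the same zero set become isomorphic when roots are adjoined.\<close>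

lemma Z_point_std:
  assumes inf: "infinite (UNIV :: 'u set)" and inj: "inj (\<lambda>x. restrict (ext \<phi> x) {..<r})"
    and K: "field (K :: 'u ring)" and x: "x \<in> Z_ob r \<phi> K"
  obtains L :: "'u ring" and h and E where "field L" "h \<in> ring_hom K L" "E \<in> dual_monoid"
    "((K, x), (L, std_point L E)) \<in> Z_point_equiv r \<phi>"
proof -
  obtain L :: "'u ring" and h where L: "field L" "roots_exist L" and h: "h \<in> ring_hom K L"
    by (rule root_closed_extension_exists[OF inf K])
  interpret L: graded_field L r \<phi> by (rule graded_fieldI[OF L(1)])
  obtain y where y: "y \<in> Z_ob r \<phi> L" "X_arrow r h K L x y" by (rule Z_base_change[OF K L(1) h x])
  obtain E where E: "E \<in> dual_monoid" "zero_set r \<phi> L y = Supp E" by (rule L.zero_set_Supp[OF fg free y(1)])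
  note std = std_point_Z_ob[OF L(1) E(1)]
  have "X_arrow r (\<lambda>c. c) L L y (std_point L E)"
    by (rule L.X_arrow_of_zero_sets[OF L(2) inj y(1) std(1)]) (simp add: E(2) std(2))
  then have "((L, y), (L, std_point L E)) \<in> Z_point_equiv r \<phi>"
    by (rule Z_point_arrow[OF L(1) y(1) L(1) std(1) id_ring_hom[unfolded id_def]])
  with Z_point_arrow[OF K x L(1) y(1) h y(2)] have "((K, x), (L, std_point L E)) \<in> Z_point_equiv r \<phi>"
    by (rule Z_point_trans)
  with L(1) h E(1) that show ?thesis by blast
qed

text \<open>The standard object is defined over the copy \<open>P0\<close> of the prime field inside \<open>Pbar\<close>. This field maps
  to \<open>Pbar\<close> and, through \<open>P\<close> and \<open>K\<close>, to an extension \<open>L\<close> of \<open>K\<close> over which the given object becomes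
  standard; so \<open>(Pbar, E)\<close> and \<open>(K, x)\<close> are connected through \<open>P0\<close> and \<open>L\<close>.\<close>

lemma Z_point_over_prime_closure:
  fixes P :: "'p ring" and Pbar K :: "'u ring"
  assumes inf: "infinite (UNIV :: 'u set)" and inj: "inj (\<lambda>x. restrict (ext \<phi> x) {..<r})"
    and P: "is_alg_closure P Pbar j" and \<rho>: "\<rho> \<in> ring_hom P K"
    and K: "field K" and x: "x \<in> Z_ob r \<phi> K"
  shows "\<exists>y\<in>Z_ob r \<phi> Pbar. ((Pbar, y), (K, x)) \<in> Z_point_equiv r \<phi>"
proof -
  have fP: "field P" and fPbar: "field Pbar" and j: "j \<in> ring_hom P Pbar"
    and ac: "algebraic_closure Pbar (j ` carrier P)" using P by (auto simp: is_alg_closure_def)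
  interpret Pbar: algebraic_closure Pbar "j ` carrier P" by fact
  obtain L :: "'u ring" and h and E where L: "field L" and h: "h \<in> ring_hom K L" and E: "E \<in> dual_monoid"
    and eq: "((K, x), (L, std_point L E)) \<in> Z_point_equiv r \<phi>"
    by (rule Z_point_std[OF inf inj K x])
  define P0 where "P0 = Pbar\<lparr>carrier := j ` carrier P\<rparr>"
  have P0: "field P0" unfolding P0_def by (rule Pbar.subfield_iff(2)[OF Pbar.subfield_axioms])
  have inc: "(\<lambda>c. c) \<in> ring_hom P0 Pbar"
    by (rule ring_hom_memI) (use ring_hom_closed[OF j] in \<open>auto simp: P0_def\<close>)
  have jinj: "inj_on j (carrier P)" by (rule hom_fields_inj[OF fP fPbar j])
  interpret P: field P by fact
  have inv: "inv_into (carrier P) j \<in> ring_hom P0 P"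
  proof (rule ring_hom_memI)
    note f = inv_into_f_f[OF jinj]
    show "inv_into (carrier P) j c \<in> carrier P" if "c \<in> carrier P0" for c
      using that by (auto simp: P0_def f)
    show "inv_into (carrier P) j \<one>\<^bsub>P0\<^esub> = \<one>\<^bsub>P\<^esub>"
      using f[of "\<one>\<^bsub>P\<^esub>"] ring_hom_one[OF j] by (simp add: P0_def)
    fix c d assume "c \<in> carrier P0" "d \<in> carrier P0"
    then obtain a b where ab: "a \<in> carrier P" "b \<in> carrier P" "c = j a" "d = j b" by (auto simp: P0_def)
    show "inv_into (carrier P) j (c \<otimes>\<^bsub>P0\<^esub> d) = inv_into (carrier P) j c \<otimes>\<^bsub>P\<^esub> inv_into (carrier P) j d"
      using ab f[of "a \<otimes>\<^bsub>P\<^esub> b"] ring_hom_mult[OF j ab(1,2)] by (simp add: P0_def f)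
    show "inv_into (carrier P) j (c \<oplus>\<^bsub>P0\<^esub> d) = inv_into (carrier P) j c \<oplus>\<^bsub>P\<^esub> inv_into (carrier P) j d"
      using ab f[of "a \<oplus>\<^bsub>P\<^esub> b"] ring_hom_add[OF j ab(1,2)] by (simp add: P0_def f)
  qed
  have "h \<circ> (\<rho> \<circ> inv_into (carrier P) j) \<in> ring_hom P0 L"
    by (rule ring_hom_trans[OF ring_hom_trans[OF inv \<rho>] h])
  from std_point_equiv[OF P0 L this E] std_point_equiv[OF P0 fPbar inc E] eq
  have "((Pbar, std_point Pbar E), (K, x)) \<in> Z_point_equiv r \<phi>"
    using Z_point_sym Z_point_trans by meson
  then show ?thesis using std_point_Z_ob(1)[OF fPbar E] by blast
qed

text \<open>Every point comes from the algebraic closure of a prime field. It determines the characteristic, hence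
  the summand, and the zero set, hence the isomorphism class.\<close>

lemma Z_points_decomposition:
  fixes Qbar :: "'u ring" and Fbar :: "nat \<Rightarrow> 'u ring"
  assumes inf: "infinite (UNIV :: 'u set)" and inj: "inj (\<lambda>x. restrict (ext \<phi> x) {..<r})"
    and Q: "is_alg_closure (ring_of_type_algebra :: rat ring) Qbar jQ"
    and F: "\<And>p. Factorial_Ring.prime p \<Longrightarrow> is_alg_closure (residue_ring (int p)) (Fbar p) (jF p)"
  shows "\<exists>g. bij_betw g
      ((Z_ob r \<phi> Qbar // Z_iso r \<phi> Qbar) <+>
        (SIGMA p:{p. Factorial_Ring.prime p}. Z_ob r \<phi> (Fbar p) // Z_iso r \<phi> (Fbar p)))
      (Z_points r \<phi> :: ('u ring \<times> ('t, 'u) X_obj) set set) \<and>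
    (\<forall>x\<in>Z_ob r \<phi> Qbar. g (Inl (Z_iso r \<phi> Qbar `` {x})) = Z_point_equiv r \<phi> `` {(Qbar, x)}) \<and>
    (\<forall>p. Factorial_Ring.prime p \<longrightarrow> (\<forall>x\<in>Z_ob r \<phi> (Fbar p).
      g (Inr (p, Z_iso r \<phi> (Fbar p) `` {x})) = Z_point_equiv r \<phi> `` {(Fbar p, x)}))"
proof -
  let ?S = "Z_point_equiv r \<phi> :: (('u ring \<times> ('t, 'u) X_obj) \<times> _) set"
  let ?B = "field_points (Z_ob r \<phi>) :: ('u ring \<times> ('t, 'u) X_obj) set"
  let ?D = "(Z_ob r \<phi> Qbar // Z_iso r \<phi> Qbar) <+>
        (SIGMA p:{p. Factorial_Ring.prime p}. Z_ob r \<phi> (Fbar p) // Z_iso r \<phi> (Fbar p))"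
  \<comment> \<open>The characteristic \<open>n\<close> is \<open>0\<close> or a prime; \<open>char_multiples\<close> is \<open>n\<nat>\<close> in both cases.\<close>
  define N where "N = insert 0 {p::nat. Factorial_Ring.prime p}"
  define Kbar where "Kbar n = (if n = 0 then Qbar else Fbar n)" for n
  define comp where "comp n C = (if n = 0 then Inl C else Inr (n, C))"
    for n :: nat and C :: "('t, 'u) X_obj set"
  define cls where "cls n x = Z_iso r \<phi> (Kbar n) `` {x}" for n x
  have prime_nz: "p \<noteq> 0" if "Factorial_Ring.prime p" for p :: nat
    using prime_gt_0_nat[OF that] by simp
  have Kbar: "field (Kbar n)" "roots_exist (Kbar n)" "char_multiples (Kbar n) = {m. n dvd m}" if n: "n \<in> N" for n
  proof -
    have "field (Kbar n) \<and> roots_exist (Kbar n) \<and> char_multiples (Kbar n) = {m. n dvd m}"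
    proof (cases "n = 0")
      case True
      then show ?thesis
        using char_multiples_hom[of "ring_of_type_algebra :: rat ring" Qbar jQ] Q alg_closure_roots_exist[OF Q]
        by (simp add: is_alg_closure_def char_multiples_rat Kbar_def)
    next
      case False
      then have p: "Factorial_Ring.prime n" using n by (simp add: N_def)
      show ?thesis
        using char_multiples_hom[of "residue_ring (int n)" "Fbar n" "jF n"] F[OF p] False
          char_multiples_residue[OF p] alg_closure_roots_exist[OF F[OF p]]
        by (simp add: is_alg_closure_def Kbar_def)
    qed
    then show "field (Kbar n)" "roots_exist (Kbar n)" "char_multiples (Kbar n) = {m. n dvd m}" by auto
  qed
  have iso: "Z_iso r \<phi> (Kbar n) =
      {(x, y). x \<in> Z_ob r \<phi> (Kbar n) \<and> y \<in> Z_ob r \<phi> (Kbar n) \<and> zero_set r \<phi> (Kbar n) x = zero_set r \<phi> (Kbar n) y}"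
    if "n \<in> N" for n
    by (rule graded_field.Z_iso_eq_zero_sets[OF graded_fieldI[OF Kbar(1)[OF that]] Kbar(2)[OF that] inj])
  have D: "c \<in> ?D \<longleftrightarrow> (\<exists>n\<in>N. \<exists>x\<in>Z_ob r \<phi> (Kbar n). c = comp n (cls n x))" for c
    by (auto simp: quotient_def N_def Kbar_def comp_def cls_def dest: prime_nz split: if_splits)
  define g where "g c = (case c of Inl C \<Rightarrow> ?S `` {(Qbar, SOME x. x \<in> C)}
      | Inr (p, C) \<Rightarrow> ?S `` {(Fbar p, SOME x. x \<in> C)})" for c
  have g: "g (comp n (cls n x)) = ?S `` {(Kbar n, x)}" if n: "n \<in> N" and x: "x \<in> Z_ob r \<phi> (Kbar n)" for n x
  proof -
    define y where "y = (SOME y. y \<in> cls n x)"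
    have "x \<in> cls n x" using x by (simp add: iso[OF n] cls_def)
    then have "y \<in> cls n x" unfolding y_def by (rule someI)
    then have y: "y \<in> Z_ob r \<phi> (Kbar n)" "X_arrow r (\<lambda>c. c) (Kbar n) (Kbar n) x y"
      by (auto simp: Z_iso_def cls_def)
    have "g (comp n (cls n x)) = ?S `` {(Kbar n, y)}" by (simp add: g_def comp_def Kbar_def y_def)
    also have "\<dots> = ?S `` {(Kbar n, x)}"
      using Z_point_arrow[OF Kbar(1)[OF n] x Kbar(1)[OF n] y(1) id_ring_hom[unfolded id_def] y(2)]
      by (rule equiv_class_eq[OF Z_equiv, symmetric])
    finally show ?thesis .
  qed
  have "inj_on g ?D"
  proof (rule inj_onI)
    fix c d assume "c \<in> ?D" "d \<in> ?D" and eq: "g c = g d"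
    then obtain n x m y where n: "n \<in> N" "x \<in> Z_ob r \<phi> (Kbar n)" "c = comp n (cls n x)"
      and m: "m \<in> N" "y \<in> Z_ob r \<phi> (Kbar m)" "d = comp m (cls m y)" unfolding D by blast
    have "?S `` {(Kbar n, x)} = ?S `` {(Kbar m, y)}"
      using eq unfolding n(3) m(3) g[OF n(1,2)] g[OF m(1,2)] .
    from eq_equiv_class[OF this Z_equiv Z_pointI[OF Kbar(1)[OF m(1)] m(2)]]
    have eqv: "((Kbar n, x), (Kbar m, y)) \<in> ?S" .
    have "{k. n dvd k} = {k. m dvd k}"
      using Z_point_invariants(1)[OF eqv] unfolding Kbar(3)[OF n(1)] Kbar(3)[OF m(1)] .
    from eqset_imp_iff[OF this, of n] eqset_imp_iff[OF this, of m] have nm: "n = m"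
      by (simp add: dvd_antisym)
    have "cls n x = cls n y"
      unfolding cls_def iso[OF n(1)]
      using n(2) m(2)[folded nm] Z_point_invariants(2)[OF eqv, folded nm] by auto
    then show "c = d" unfolding n(3) m(3) nm[symmetric] by simp
  qed
  moreover have "g ` ?D = Z_points r \<phi>"
  proof (intro equalityI subsetI)
    have quo: "Z_points r \<phi> = (\<lambda>p. ?S `` {p}) ` ?B"
      unfolding Z_points_def stack_points_def Z_point_equiv_def by (auto simp: quotient_def)
    fix C :: "('u ring \<times> ('t, 'u) X_obj) set"
    {
      assume "C \<in> g ` ?D"
      then obtain c where "c \<in> ?D" "C = g c" ..
      then obtain n x where n: "n \<in> N" "x \<in> Z_ob r \<phi> (Kbar n)" "C = g (comp n (cls n x))"
        using D[of c] by auto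
      show "C \<in> Z_points r \<phi>"
        unfolding n(3) g[OF n(1,2)] quo using Z_pointI[OF Kbar(1)[OF n(1)] n(2)] by blast
    next
      assume "C \<in> Z_points r \<phi>"
      then obtain K x where K: "field K" and x: "x \<in> Z_ob r \<phi> K" and C: "C = ?S `` {(K, x)}"
        unfolding quo by (auto simp: field_points_def)
      interpret K: base_field K using K by (simp add: base_field_def)
      have "\<exists>n\<in>N. \<exists>y\<in>Z_ob r \<phi> (Kbar n). ((Kbar n, y), (K, x)) \<in> ?S"
      proof (cases "char_multiples K = {0}")
        case True
        obtain \<rho> where "\<rho> \<in> ring_hom (ring_of_type_algebra :: rat ring) K"
          using K.rat_hom_exists[OF True] by blast
        from Z_point_over_prime_closure[OF inf inj Q this K x] show ?thesis
          by (intro bexI[of _ 0]) (simp_all add: N_def Kbar_def)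
      next
        case False
        obtain p \<rho> where p: "Factorial_Ring.prime p" and \<rho>: "\<rho> \<in> ring_hom (residue_ring (int p)) K"
          using K.residue_hom_exists[OF False] by blast
        from Z_point_over_prime_closure[OF inf inj F[OF p] \<rho> K x] show ?thesis
          using p prime_nz[OF p] by (intro bexI[of _ p]) (simp_all add: N_def Kbar_def)
      qed
      then obtain n y where n: "n \<in> N" "y \<in> Z_ob r \<phi> (Kbar n)" "((Kbar n, y), (K, x)) \<in> ?S" by (elim bexE)
      have "C = g (comp n (cls n y))"
        unfolding g[OF n(1,2)] C by (rule equiv_class_eq[OF Z_equiv n(3), symmetric])
      moreover have "comp n (cls n y) \<in> ?D" unfolding D using n(1,2) by blast
      ultimately show "C \<in> g ` ?D" by (rule image_eqI)
    }
  qed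
  ultimately have "bij_betw g ?D (Z_points r \<phi>)" by (rule bij_betw_imageI)
  moreover have "g (Inl (Z_iso r \<phi> Qbar `` {x})) = ?S `` {(Qbar, x)}" if "x \<in> Z_ob r \<phi> Qbar" for x
    using g[of 0 x] that by (simp add: N_def Kbar_def comp_def cls_def)
  moreover have "g (Inr (p, Z_iso r \<phi> (Fbar p) `` {x})) = ?S `` {(Fbar p, x)}"
    if "Factorial_Ring.prime p" "x \<in> Z_ob r \<phi> (Fbar p)" for p x
    using g[of p x] that prime_nz[OF that(1)] by (simp add: N_def Kbar_def comp_def cls_def)
  ultimately show ?thesis by blast
qed

end

section \<open>The main component\<close>

theorem theorem2p22:
  fixes \<phi> :: "'t::comm_monoid_add \<Rightarrow> nat \<Rightarrow> int" and r :: nat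
    and k :: "'k ring" and kbar :: "'l ring" and j :: "'k \<Rightarrow> 'l"
  assumes "finitely_generated_monoid TYPE('t)"
    and "free_of_finite_rank TYPE('t groth)"
    and "\<forall>i<r. monoid_map (\<lambda>t. \<phi> t i)"
    and "is_alg_closure k kbar j"
    and "infinite (UNIV :: 'u set)"
  shows
    "(\<forall>a. mult_monoid_map a k \<longrightarrow>
        (trivial_X_obj r \<phi> k a \<in> Z_ob r \<phi> k \<longleftrightarrow>
          (\<exists>(l :: 't groth \<Rightarrow> 'l) E.
            (\<forall>x. l x \<in> Units kbar) \<and> (\<forall>x y. l (x + y) = l x \<otimes>\<^bsub>kbar\<^esub> l y) \<and>
            E \<in> dual_monoid \<and>
            (\<forall>t. j (a t) = l (of_monoid t) \<otimes>\<^bsub>kbar\<^esub> \<zero>\<^bsub>kbar\<^esub> [^]\<^bsub>kbar\<^esub> E t))))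
     \<and>
     (\<forall>s (Es :: nat \<Rightarrow> 't \<Rightarrow> nat).
        (\<forall>i<s. Es i \<in> dual_monoid) \<and> generates_rational_cone s Es \<longrightarrow>
          F_pi r \<phi> s Es kbar ` F_ob r \<phi> s Es kbar \<subseteq> Z_ob r \<phi> kbar \<and>
          (\<forall>x\<in>Z_ob r \<phi> kbar. \<exists>y\<in>F_ob r \<phi> s Es kbar. (F_pi r \<phi> s Es kbar y, x) \<in> Z_iso r \<phi> kbar) \<and>
          (\<exists>g :: ('u ring \<times> ('t, 'u) F_obj) set \<Rightarrow> ('u ring \<times> ('t, 'u) X_obj) set.
            (\<forall>(K, y)\<in>field_points (F_ob r \<phi> s Es).
              g (F_point_equiv r \<phi> s Es `` {(K, y)}) = Z_point_equiv r \<phi> `` {(K, F_pi r \<phi> s Es K y)}) \<and>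
            g ` F_points r \<phi> s Es = Z_points r \<phi>))
     \<and>
     (inj (\<lambda>x. restrict (ext \<phi> x) {..<r}) \<longrightarrow>
        (\<exists>g. bij_betw g (Z_ob r \<phi> kbar // Z_iso r \<phi> kbar) {Supp E | E :: 't \<Rightarrow> nat. E \<in> dual_monoid} \<and>
          (\<forall>x\<in>Z_ob r \<phi> kbar. g (Z_iso r \<phi> kbar `` {x}) = zero_set r \<phi> kbar x)) \<and>
        (\<forall>(Qbar :: 'u ring) jQ (Fbar :: nat \<Rightarrow> 'u ring) jF.
          is_alg_closure (ring_of_type_algebra :: rat ring) Qbar jQ \<and>
          (\<forall>p. normalization_semidom_class.prime p \<longrightarrow> is_alg_closure (residue_ring (int p)) (Fbar p) (jF p)) \<longrightarrow>
          (\<exists>g. bij_betw g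
              ((Z_ob r \<phi> Qbar // Z_iso r \<phi> Qbar) <+>
                (SIGMA p:{p. normalization_semidom_class.prime p}. Z_ob r \<phi> (Fbar p) // Z_iso r \<phi> (Fbar p)))
              (Z_points r \<phi> :: ('u ring \<times> ('t, 'u) X_obj) set set) \<and>
            (\<forall>x\<in>Z_ob r \<phi> Qbar.
              g (Inl (Z_iso r \<phi> Qbar `` {x})) = Z_point_equiv r \<phi> `` {(Qbar, x)}) \<and>
            (\<forall>p. normalization_semidom_class.prime p \<longrightarrow> (\<forall>x\<in>Z_ob r \<phi> (Fbar p).
              g (Inr (p, Z_iso r \<phi> (Fbar p) `` {x})) = Z_point_equiv r \<phi> `` {(Fbar p, x)})))))"
proof -
  interpret graded_monoid r \<phi> by unfold_locales (rule assms(1-3))+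
  have k: "field k" "field kbar" "j \<in> ring_hom k kbar" using assms(4) by (auto simp: is_alg_closure_def)
  have roots: "roots_exist kbar" by (rule alg_closure_roots_exist[OF assms(4)])
  interpret k: graded_field k r \<phi> by (rule graded_fieldI[OF k(1)])
  interpret kbar: graded_field kbar r \<phi> by (rule graded_fieldI[OF k(2)])
  show ?thesis
  proof (intro conjI allI impI)
    fix a :: "'t \<Rightarrow> 'k" assume a: "mult_monoid_map a k"
    show "trivial_X_obj r \<phi> k a \<in> Z_ob r \<phi> k \<longleftrightarrow>
      (\<exists>(l :: 't groth \<Rightarrow> 'l) E.
        (\<forall>x. l x \<in> Units kbar) \<and> (\<forall>x y. l (x + y) = l x \<otimes>\<^bsub>kbar\<^esub> l y) \<and>
        E \<in> dual_monoid \<and>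
        (\<forall>t. j (a t) = l (of_monoid t) \<otimes>\<^bsub>kbar\<^esub> \<zero>\<^bsub>kbar\<^esub> [^]\<^bsub>kbar\<^esub> E t))"
      unfolding k.trivial_Z_ob_iff[OF a] by (rule respects_int_iff_decomposition[OF k roots fg free a])
  next
    fix s and Es :: "nat \<Rightarrow> 't \<Rightarrow> nat"
    assume "(\<forall>i<s. Es i \<in> dual_monoid) \<and> generates_rational_cone s Es"
    then have Es: "\<forall>i<s. Es i \<in> dual_monoid" and gen: "generates_rational_cone s Es" by auto
    interpret F: dual_family kbar r \<phi> s Es by (rule dual_familyI[OF k(2) Es])
    show "F_pi r \<phi> s Es kbar ` F_ob r \<phi> s Es kbar \<subseteq> Z_ob r \<phi> kbar"
      using F.F_pi_Z_ob by blast
    then show "\<forall>x\<in>Z_ob r \<phi> kbar. \<exists>y\<in>F_ob r \<phi> s Es kbar. (F_pi r \<phi> s Es kbar y, x) \<in> Z_iso r \<phi> kbar"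
      using F.F_pi_essentially_surjective[OF roots fg free gen] by (fastforce simp: Z_iso_def)
    show "\<exists>g :: ('u ring \<times> ('t, 'u) F_obj) set \<Rightarrow> ('u ring \<times> ('t, 'u) X_obj) set.
        (\<forall>(K, y)\<in>field_points (F_ob r \<phi> s Es).
          g (F_point_equiv r \<phi> s Es `` {(K, y)}) = Z_point_equiv r \<phi> `` {(K, F_pi r \<phi> s Es K y)}) \<and>
        g ` F_points r \<phi> s Es = Z_points r \<phi>"
      by (rule F_points_map[OF Es gen assms(5)])
  next
    assume inj: "inj (\<lambda>x. restrict (ext \<phi> x) {..<r})"
    show "\<exists>g. bij_betw g (Z_ob r \<phi> kbar // Z_iso r \<phi> kbar) {Supp E | E :: 't \<Rightarrow> nat. E \<in> dual_monoid} \<and>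
        (\<forall>x\<in>Z_ob r \<phi> kbar. g (Z_iso r \<phi> kbar `` {x}) = zero_set r \<phi> kbar x)"
      using bij_betw_quotient[OF kbar.Z_iso_eq_zero_sets[OF roots inj]]
      unfolding kbar.zero_set_image[OF fg free] .
  qed (rule Z_points_decomposition[OF assms(5)], auto)
qed

end
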